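(* Let $G$ be a finite group, let $\alpha=(D_g,\alpha_g)_{g\in G}$ be a unital partial action of $G$ on a commutative ring $R$, and assume that $R\supseteq R^\alpha$ is an $\alpha$-partial Galois extension. For $f\in Z^1(G,\alpha^*,\mathbf{PicS}(R))$ set $\Phi_f=f\Phi_0\colon G\to\mathbf{PicS}_{R^\alpha}(R)$, that is, $\Phi_f(g)=f(g)\Phi_0(g)$ for $g\in G$, where $\Phi_0(g)=[{}_g(D_{g^{-1}})_I]$. Then: 1. $\Phi_f$ is a partial representation. 2. $\Phi_f(g)\Phi_f(g^{-1})=[D_g]$ for all $g\in G$. Moreover, writing $\Phi_f(g)=[J_g]$, one has $D_g\cong\mathrm{End}_{D_g}(J_g)$ as $R$- and $D_g$-algebras, for any $g\in G$.
   Context: A unital partial action $\alpha=(D_g,\alpha_g)_{g\in G}$ of a group $G$ on a commutative ring $R$ consists of ideals $D_g=R1_g$ generated by idempotents $1_g$ (possibly zero) and ring isomorphisms $\alpha_g\colon D_{g^{-1}}\to D_g$ such that $D_1=R$, $\alpha_1=\mathrm{id}_R$, $\alpha_g(D_{g^{-1}}D_h)=D_gD_{gh}$, and $\alpha_g(\alpha_h(t))=\alpha_{gh}(t)$ for all $t\in D_{h^{-1}}D_{(gh)^{-1}}$. $R^\alpha=\{r\in R:\alpha_g(r1_{g^{-1}})=r1_g\ \forall g\in G\}$. The extension $R\supseteq R^\alpha$ is $\alpha$-partial Galois if there are $m\in\mathbb N$ and $x_i,y_i\in R$ ($1\le i\le m$) with $\sum_i x_i\alpha_g(y_i1_{g^{-1}})=\delta_{1,g}$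 for all $g\in G$. $\mathbf{PicS}_{R^\alpha}(R)$ is the monoid, under $[P][Q]=[P\otimes_RQ]$, of isomorphism classes of $R$-$R$-bimodules $P$ that are central over $R^\alpha$, finitely generated projective as left $R$-modules, and admit a surjective $R^\alpha$-algebra homomorphism $R^{\mathrm{op}}\to\mathrm{End}_R(P)$ (endomorphisms of the left module). $\mathbf{PicS}(R)=\mathbf{PicS}_R(R)$ is its (commutative) submonoid of classes of central $R$-$R$-bimodules; modules over $R$ are viewed as central bimodules. $X_g=[D_g]\mathbf{PicS}(R)=\{[E]\in\mathbf{PicS}(R):E=1_gE\}$ is an ideal of $\mathbf{PicS}(R)$ with identity $[D_g]$. For $[E]\in X_{g^{-1}}$, $E_g$ is the abelian group $E$ with the central $R$-action $r\bullet x=\alpha_{g^{-1}}(r1_g)x$, and $\alpha_g^*\colon X_{g^{-1}}\to X_g$, $[E]\mapsto[E_g]$; these form a partial action $\alpha^*$ of $G$ on $\mathbf{PicS}(R)$. $Z^1(G,\alpha^*,\mathbf{PicS}(R))$ is the set of maps $f\colon G\to\mathbf{PicS}(R)$ with $f(g)\in\mathcal U(X_g)$ and $f(gh)[D_g]=f(g)\,\alpha_g^*(f(h)[D_{g^{-1}}])$ for all $g,h\in G$. ${}_g(D_{g^{-1}})_I$ is $D_{g^{-1}}$ with the $R$-$R$-bimodule structure $r*d=\alpha_{g^{-1}}(r1_g)d$, $d*r=dr$. A (unital) partial representation of $G$ in a monoid $S$ is a map $\Phi\colon G\to S$ such that $\Phi(g^{-1})\Phi(g)\Phi(h)=\Phi(g^{-1})\Phi(gh)$,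 $\Phi(g)\Phi(h)\Phi(h^{-1})=\Phi(gh)\Phi(h^{-1})$ and $\Phi(1_G)=1_S$ for all $g,h\in G$. $\mathrm{End}_{D_g}(J_g)$ denotes endomorphisms of $J_g$ as a left $D_g$-module. *)

theory Defs
  imports
    "HOL-Algebra.Module"
    "HOL-Algebra.QuotRing"
    "HOL-Algebra.Ideal_Product"
    "HOL-Algebra.Free_Abelian_Groups"
begin

section \<open>Bimodules over a commutative ring\<close>

text \<open>
  A bimodule record extends the library's module record by a right action, so that
  \<open>module R P\<close> speaks about its left module. As for library modules, the fields
  \<open>mult\<close> and \<open>one\<close> carry no information.
\<close>

record ('a, 'b) bimodule = "('a, 'b) module" +
  ract :: "'b \<Rightarrow> 'a \<Rightarrow> 'b"  (infixl \<open>\<triangleleft>\<index>\<close> 70)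

locale bimodule = module R P
  for R :: "('a, 'r) ring_scheme" (structure) and P :: "('a, 'b, 'm) bimodule_scheme" (structure) +
  assumes ract_closed: "\<lbrakk>x \<in> carrier P; r \<in> carrier R\<rbrakk> \<Longrightarrow> x \<triangleleft>\<^bsub>P\<^esub> r \<in> carrier P"
    and ract_add_scalar: "\<lbrakk>x \<in> carrier P; r \<in> carrier R; s \<in> carrier R\<rbrakk>
      \<Longrightarrow> x \<triangleleft>\<^bsub>P\<^esub> (r \<oplus>\<^bsub>R\<^esub> s) = x \<triangleleft>\<^bsub>P\<^esub> r \<oplus>\<^bsub>P\<^esub> x \<triangleleft>\<^bsub>P\<^esub> s"
    and ract_add: "\<lbrakk>x \<in> carrier P; y \<in> carrier P; r \<in> carrier R\<rbrakk>
      \<Longrightarrow> (x \<oplus>\<^bsub>P\<^esub> y) \<triangleleft>\<^bsub>P\<^esub> r = x \<triangleleft>\<^bsub>P\<^esub> r \<oplus>\<^bsub>P\<^esub> y \<triangleleft>\<^bsub>P\<^esub> r"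
    and ract_assoc: "\<lbrakk>x \<in> carrier P; r \<in> carrier R; s \<in> carrier R\<rbrakk>
      \<Longrightarrow> x \<triangleleft>\<^bsub>P\<^esub> (r \<otimes>\<^bsub>R\<^esub> s) = (x \<triangleleft>\<^bsub>P\<^esub> r) \<triangleleft>\<^bsub>P\<^esub> s"
    and ract_one: "x \<in> carrier P \<Longrightarrow> x \<triangleleft>\<^bsub>P\<^esub> \<one>\<^bsub>R\<^esub> = x"
    and lact_ract: "\<lbrakk>r \<in> carrier R; x \<in> carrier P; s \<in> carrier R\<rbrakk>
      \<Longrightarrow> (r \<odot>\<^bsub>P\<^esub> x) \<triangleleft>\<^bsub>P\<^esub> s = r \<odot>\<^bsub>P\<^esub> (x \<triangleleft>\<^bsub>P\<^esub> s)"

definition make_bimodule ::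
    "'b set \<Rightarrow> 'b \<Rightarrow> ('b \<Rightarrow> 'b \<Rightarrow> 'b) \<Rightarrow> ('a \<Rightarrow> 'b \<Rightarrow> 'b) \<Rightarrow> ('b \<Rightarrow> 'a \<Rightarrow> 'b) \<Rightarrow> ('a, 'b) bimodule"
  where "make_bimodule C z pl l r =
    \<lparr>carrier = C, monoid.mult = undefined, monoid.one = undefined, ring.zero = z, add = pl, smult = l, ract = r\<rparr>"

definition central_over :: "'a set \<Rightarrow> ('a, 'b, 'm) bimodule_scheme \<Rightarrow> bool"
  where "central_over K P \<longleftrightarrow> (\<forall>k\<in>K. \<forall>x\<in>carrier P. k \<odot>\<^bsub>P\<^esub> x = x \<triangleleft>\<^bsub>P\<^esub> k)"

definition linear_maps ::
    "'a set \<Rightarrow> ('a, 'b, 'm) module_scheme \<Rightarrow> ('a, 'c, 'n) module_scheme \<Rightarrow> ('b \<Rightarrow> 'c) set"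
  where "linear_maps S M N =
    {h \<in> carrier M \<rightarrow> carrier N.
       (\<forall>x\<in>carrier M. \<forall>y\<in>carrier M. h (x \<oplus>\<^bsub>M\<^esub> y) = h x \<oplus>\<^bsub>N\<^esub> h y) \<and>
       (\<forall>s\<in>S. \<forall>x\<in>carrier M. h (s \<odot>\<^bsub>M\<^esub> x) = s \<odot>\<^bsub>N\<^esub> h x)}"

definition bimodule_iso ::
    "('a, 'r) ring_scheme \<Rightarrow> ('a, 'b, 'm) bimodule_scheme \<Rightarrow> ('a, 'c, 'n) bimodule_scheme \<Rightarrow> ('b \<Rightarrow> 'c) set"
  where "bimodule_iso R P Q =
    {h \<in> linear_maps (carrier R) P Q.
       bij_betw h (carrier P) (carrier Q) \<and>
       (\<forall>x\<in>carrier P. \<forall>r\<in>carrier R. h (x \<triangleleft>\<^bsub>P\<^esub> r) = h x \<triangleleft>\<^bsub>Q\<^esub> r)}"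

definition free_module :: "('a, 'r) ring_scheme \<Rightarrow> nat \<Rightarrow> ('a, nat \<Rightarrow> 'a) module"
  where "free_module R n =
    \<lparr>carrier = {..<n} \<rightarrow>\<^sub>E carrier R, monoid.mult = undefined, monoid.one = undefined,
     ring.zero = (\<lambda>i\<in>{..<n}. \<zero>\<^bsub>R\<^esub>), add = (\<lambda>u v. \<lambda>i\<in>{..<n}. u i \<oplus>\<^bsub>R\<^esub> v i),
     smult = (\<lambda>r u. \<lambda>i\<in>{..<n}. r \<otimes>\<^bsub>R\<^esub> u i)\<rparr>"

text \<open>Finitely generated projective: a direct summand (linear retract) of some \<open>R\<^sup>n\<close>.\<close>

definition fg_projective :: "('a, 'r) ring_scheme \<Rightarrow> ('a, 'b, 'm) module_scheme \<Rightarrow> bool"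
  where "fg_projective R M \<longleftrightarrow> module R M \<and>
    (\<exists>n. \<exists>\<iota>\<in>linear_maps (carrier R) M (free_module R n).
         \<exists>\<pi>\<in>linear_maps (carrier R) (free_module R n) M.
           \<forall>x\<in>carrier M. \<pi> (\<iota> x) = x)"


section \<open>Algebras of endomorphisms\<close>

text \<open>
  Endomorphisms of \<open>M\<close> that are additive and commute with the scalars in \<open>S\<close>;
  maps are taken to be \<open>undefined\<close> outside the carrier, so that equality of endomorphisms is
  equality of functions.
\<close>

definition End_algebra :: "'a set \<Rightarrow> ('a, 'b, 'm) module_scheme \<Rightarrow> ('a, 'b \<Rightarrow> 'b) module"
  where "End_algebra S M =
    \<lparr>carrier = linear_maps S M M \<inter> extensional (carrier M),
     monoid.mult = compose (carrier M),
     one = (\<lambda>x\<in>carrier M. x),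
     ring.zero = (\<lambda>x\<in>carrier M. \<zero>\<^bsub>M\<^esub>),
     add = (\<lambda>\<phi> \<psi>. \<lambda>x\<in>carrier M. \<phi> x \<oplus>\<^bsub>M\<^esub> \<psi> x),
     smult = (\<lambda>r \<phi>. \<lambda>x\<in>carrier M. r \<odot>\<^bsub>M\<^esub> \<phi> x)\<rparr>"

definition op_algebra :: "('a, 'r) ring_scheme \<Rightarrow> ('a, 'a) module"
  where "op_algebra R =
    \<lparr>carrier = carrier R, monoid.mult = (\<lambda>x y. y \<otimes>\<^bsub>R\<^esub> x), one = \<one>\<^bsub>R\<^esub>,
     ring.zero = \<zero>\<^bsub>R\<^esub>, add = add R, smult = monoid.mult R\<rparr>"

definition algebra_hom ::
    "'a set \<Rightarrow> ('a, 'b, 'm) module_scheme \<Rightarrow> ('a, 'c, 'n) module_scheme \<Rightarrow> ('b \<Rightarrow> 'c) set"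
  where "algebra_hom K A B =
    {\<theta> \<in> ring_hom A B. \<forall>k\<in>K. \<forall>x\<in>carrier A. \<theta> (k \<odot>\<^bsub>A\<^esub> x) = k \<odot>\<^bsub>B\<^esub> \<theta> x}"

definition algebra_iso ::
    "'a set \<Rightarrow> ('a, 'b, 'm) module_scheme \<Rightarrow> ('a, 'c, 'n) module_scheme \<Rightarrow> ('b \<Rightarrow> 'c) set"
  where "algebra_iso K A B = {\<theta> \<in> algebra_hom K A B. bij_betw \<theta> (carrier A) (carrier B)}"


section \<open>Tensor products\<close>

text \<open>
  The relations of \<open>P \<otimes>\<^sub>R Q\<close> inside the free abelian group on \<open>P \<times> Q\<close>; the elements of
  the tensor product are cosets of the subgroup they generate. A scalar acts on a coset \<open>C\<close>
  by acting on all members of \<open>C\<close> and saturating the image to a full coset.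
\<close>

definition tensor_relations ::
    "('a, 'r) ring_scheme \<Rightarrow> ('a, 'b, 'm) bimodule_scheme \<Rightarrow> ('a, 'c, 'n) bimodule_scheme
     \<Rightarrow> ('b \<times> 'c \<Rightarrow>\<^sub>0 int) set"
  where "tensor_relations R P Q =
    {frag_of (p \<oplus>\<^bsub>P\<^esub> p', q) - frag_of (p, q) - frag_of (p', q) | p p' q.
       p \<in> carrier P \<and> p' \<in> carrier P \<and> q \<in> carrier Q} \<union>
    {frag_of (p, q \<oplus>\<^bsub>Q\<^esub> q') - frag_of (p, q) - frag_of (p, q') | p q q'.
       p \<in> carrier P \<and> q \<in> carrier Q \<and> q' \<in> carrier Q} \<union>
    {frag_of (p \<triangleleft>\<^bsub>P\<^esub> r, q) - frag_of (p, r \<odot>\<^bsub>Q\<^esub> q) | p r q.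
       p \<in> carrier P \<and> r \<in> carrier R \<and> q \<in> carrier Q}"

definition tensor ::
    "('a, 'r) ring_scheme \<Rightarrow> ('a, 'b, 'm) bimodule_scheme \<Rightarrow> ('a, 'c, 'n) bimodule_scheme
     \<Rightarrow> ('a, ('b \<times> 'c \<Rightarrow>\<^sub>0 int) set) bimodule"
  where "tensor R P Q =
    (let F = free_Abelian_group (carrier P \<times> carrier Q);
         N = generate F (tensor_relations R P Q)
     in make_bimodule (carrier (F Mod N)) \<one>\<^bsub>F Mod N\<^esub> (monoid.mult (F Mod N))
          (\<lambda>r C. N <#>\<^bsub>F\<^esub> frag_extend (\<lambda>(p, q). frag_of (r \<odot>\<^bsub>P\<^esub> p, q)) ` C)
          (\<lambda>C r. N <#>\<^bsub>F\<^esub> frag_extend (\<lambda>(p, q). frag_of (p, q \<triangleleft>\<^bsub>Q\<^esub> r)) ` C))"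


section \<open>The monoids PicS\<close>

text \<open>
  Every \<open>R\<close>-\<open>R\<close>-bimodule that is finitely generated as a left module is isomorphic to one whose
  elements are subsets of \<open>nat \<Rightarrow> 'a\<close>: an element corresponds to the set of its coordinate
  vectors with respect to a finite generating family. So \<open>'a ubimodule\<close> contains a copy of every
  bimodule considered here, and the isomorphism class of a bimodule \<open>P\<close> of arbitrary type is
  represented by the set of its copies in \<open>'a ubimodule\<close>. The class is nonempty when the left
  module of \<open>P\<close> is finitely generated, and then determines \<open>P\<close> up to isomorphism.
\<close>

type_synonym 'a ubimodule = "('a, (nat \<Rightarrow> 'a) set) bimodule"

definition bimodule_class ::
    "('a, 'r) ring_scheme \<Rightarrow> ('a, 'b, 'm) bimodule_scheme \<Rightarrow> 'a ubimodule set"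
  where "bimodule_class R P = {B. bimodule R B \<and> bimodule_iso R P B \<noteq> {}}"

text \<open>The bimodule \<open>I\<close>, for an ideal \<open>I\<close> of \<open>R\<close>; in particular \<open>R\<close> itself.\<close>

definition ideal_bimodule :: "('a, 'r) ring_scheme \<Rightarrow> 'a set \<Rightarrow> ('a, 'a) bimodule"
  where "ideal_bimodule R I =
    make_bimodule I \<zero>\<^bsub>R\<^esub> (add R) (monoid.mult R) (monoid.mult R)"

definition picS_bimodule ::
    "('a, 'r) ring_scheme \<Rightarrow> 'a set \<Rightarrow> ('a, 'b, 'm) bimodule_scheme \<Rightarrow> bool"
  where "picS_bimodule R K P \<longleftrightarrow>
    bimodule R P \<and> central_over K P \<and> fg_projective R P \<and>
    (\<exists>\<theta>\<in>algebra_hom K (op_algebra R) (End_algebra (carrier R) P).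
        \<theta> ` carrier R = carrier (End_algebra (carrier R) P))"

text \<open>\<open>PicS R K\<close> is the monoid with base ring \<open>K \<subseteq> R\<close>; \<open>PicS R (carrier R)\<close> is the
  submonoid of classes of central bimodules.\<close>

definition PicS :: "('a, 'r) ring_scheme \<Rightarrow> 'a set \<Rightarrow> 'a ubimodule set monoid"
  where "PicS R K =
    \<lparr>carrier = {bimodule_class R P | P :: 'a ubimodule. picS_bimodule R K P},
     monoid.mult = (\<lambda>A B. \<Union>P\<in>A. \<Union>Q\<in>B. bimodule_class R (tensor R P Q)),
     one = bimodule_class R (ideal_bimodule R (carrier R))\<rparr>"


section \<open>Unital partial actions\<close>

text \<open>In what follows \<open>e g\<close> is the idempotent \<open>1\<^sub>g\<close>.\<close>

definition pdom :: "('a, 'r) ring_scheme \<Rightarrow> ('g \<Rightarrow> 'a) \<Rightarrow> 'g \<Rightarrow> 'a set"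
  where "pdom R e g = PIdl\<^bsub>R\<^esub> (e g)"

definition pdom_ring :: "('a, 'r) ring_scheme \<Rightarrow> ('g \<Rightarrow> 'a) \<Rightarrow> 'g \<Rightarrow> ('a, 'r) ring_scheme"
  where "pdom_ring R e g = R\<lparr>carrier := pdom R e g, one := e g\<rparr>"

definition pdom_algebra :: "('a, 'r) ring_scheme \<Rightarrow> ('g \<Rightarrow> 'a) \<Rightarrow> 'g \<Rightarrow> ('a, 'a) module"
  where "pdom_algebra R e g =
    \<lparr>carrier = pdom R e g, monoid.mult = monoid.mult R, one = e g,
     ring.zero = \<zero>\<^bsub>R\<^esub>, add = add R, smult = monoid.mult R\<rparr>"

locale unital_partial_action = group G + cring R
  for G :: "('g, 'm) monoid_scheme" and R :: "('a, 'r) ring_scheme"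
    and e :: "'g \<Rightarrow> 'a" and \<alpha> :: "'g \<Rightarrow> 'a \<Rightarrow> 'a" +
  assumes e_closed: "g \<in> carrier G \<Longrightarrow> e g \<in> carrier R"
    and e_idem: "g \<in> carrier G \<Longrightarrow> e g \<otimes>\<^bsub>R\<^esub> e g = e g"
    and act_iso: "g \<in> carrier G
      \<Longrightarrow> \<alpha> g \<in> ring_iso (pdom_ring R e (inv\<^bsub>G\<^esub> g)) (pdom_ring R e g)"
    and pdom_unit: "pdom R e \<one>\<^bsub>G\<^esub> = carrier R"
    and act_unit: "r \<in> carrier R \<Longrightarrow> \<alpha> \<one>\<^bsub>G\<^esub> r = r"
    and act_pdom: "\<lbrakk>g \<in> carrier G; h \<in> carrier G\<rbrakk>
      \<Longrightarrow> \<alpha> g ` (pdom R e (inv\<^bsub>G\<^esub> g) \<cdot>\<^bsub>R\<^esub> pdom R e h)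
          = pdom R e g \<cdot>\<^bsub>R\<^esub> pdom R e (g \<otimes>\<^bsub>G\<^esub> h)"
    and act_act: "\<lbrakk>g \<in> carrier G; h \<in> carrier G;
        t \<in> pdom R e (inv\<^bsub>G\<^esub> h) \<cdot>\<^bsub>R\<^esub> pdom R e (inv\<^bsub>G\<^esub> (g \<otimes>\<^bsub>G\<^esub> h))\<rbrakk>
      \<Longrightarrow> \<alpha> g (\<alpha> h t) = \<alpha> (g \<otimes>\<^bsub>G\<^esub> h) t"

definition invariants ::
    "('g, 'm) monoid_scheme \<Rightarrow> ('a, 'r) ring_scheme \<Rightarrow> ('g \<Rightarrow> 'a) \<Rightarrow> ('g \<Rightarrow> 'a \<Rightarrow> 'a) \<Rightarrow> 'a set"
  where "invariants G R e \<alpha> =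
    {r \<in> carrier R. \<forall>g\<in>carrier G. \<alpha> g (r \<otimes>\<^bsub>R\<^esub> e (inv\<^bsub>G\<^esub> g)) = r \<otimes>\<^bsub>R\<^esub> e g}"

definition partial_Galois ::
    "('g, 'm) monoid_scheme \<Rightarrow> ('a, 'r) ring_scheme \<Rightarrow> ('g \<Rightarrow> 'a) \<Rightarrow> ('g \<Rightarrow> 'a \<Rightarrow> 'a) \<Rightarrow> bool"
  where "partial_Galois G R e \<alpha> \<longleftrightarrow>
    (\<exists>(m::nat) x y. x \<in> {1..m} \<rightarrow> carrier R \<and> y \<in> {1..m} \<rightarrow> carrier R \<and>
       (\<forall>g\<in>carrier G.
          (\<Oplus>\<^bsub>R\<^esub>i\<in>{1..m}. x i \<otimes>\<^bsub>R\<^esub> \<alpha> g (y i \<otimes>\<^bsub>R\<^esub> e (inv\<^bsub>G\<^esub> g)))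
          = (if g = \<one>\<^bsub>G\<^esub> then \<one>\<^bsub>R\<^esub> else \<zero>\<^bsub>R\<^esub>)))"


section \<open>The induced action on PicS and its 1-cocycles\<close>

definition pdom_class :: "('a, 'r) ring_scheme \<Rightarrow> ('g \<Rightarrow> 'a) \<Rightarrow> 'g \<Rightarrow> 'a ubimodule set"
  where "pdom_class R e g = bimodule_class R (ideal_bimodule R (pdom R e g))"

definition PicS_ideal :: "('a, 'r) ring_scheme \<Rightarrow> ('g \<Rightarrow> 'a) \<Rightarrow> 'g \<Rightarrow> 'a ubimodule set monoid"
  where "PicS_ideal R e g =
    \<lparr>carrier = {pdom_class R e g \<otimes>\<^bsub>PicS R (carrier R)\<^esub> A | A. A \<in> carrier (PicS R (carrier R))},
     monoid.mult = monoid.mult (PicS R (carrier R)),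
     one = pdom_class R e g\<rparr>"

definition twist ::
    "('g, 'm) monoid_scheme \<Rightarrow> ('a, 'r) ring_scheme \<Rightarrow> ('g \<Rightarrow> 'a) \<Rightarrow> ('g \<Rightarrow> 'a \<Rightarrow> 'a) \<Rightarrow> 'g
     \<Rightarrow> ('a, 'b, 'n) bimodule_scheme \<Rightarrow> ('a, 'b, 'n) bimodule_scheme"
  where "twist G R e \<alpha> g E =
    E\<lparr>smult := (\<lambda>r x. \<alpha> (inv\<^bsub>G\<^esub> g) (r \<otimes>\<^bsub>R\<^esub> e g) \<odot>\<^bsub>E\<^esub> x),
      ract := (\<lambda>x r. \<alpha> (inv\<^bsub>G\<^esub> g) (r \<otimes>\<^bsub>R\<^esub> e g) \<odot>\<^bsub>E\<^esub> x)\<rparr>"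

definition act_star ::
    "('g, 'm) monoid_scheme \<Rightarrow> ('a, 'r) ring_scheme \<Rightarrow> ('g \<Rightarrow> 'a) \<Rightarrow> ('g \<Rightarrow> 'a \<Rightarrow> 'a) \<Rightarrow> 'g
     \<Rightarrow> 'a ubimodule set \<Rightarrow> 'a ubimodule set"
  where "act_star G R e \<alpha> g A = (\<Union>E\<in>A. bimodule_class R (twist G R e \<alpha> g E))"

definition cocycles ::
    "('g, 'm) monoid_scheme \<Rightarrow> ('a, 'r) ring_scheme \<Rightarrow> ('g \<Rightarrow> 'a) \<Rightarrow> ('g \<Rightarrow> 'a \<Rightarrow> 'a)
     \<Rightarrow> ('g \<Rightarrow> 'a ubimodule set) set"
  where "cocycles G R e \<alpha> =
    {f. (\<forall>g\<in>carrier G. f g \<in> Units (PicS_ideal R e g)) \<and>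
        (\<forall>g\<in>carrier G. \<forall>h\<in>carrier G.
           f (g \<otimes>\<^bsub>G\<^esub> h) \<otimes>\<^bsub>PicS R (carrier R)\<^esub> pdom_class R e g
           = f g \<otimes>\<^bsub>PicS R (carrier R)\<^esub>
             act_star G R e \<alpha> g (f h \<otimes>\<^bsub>PicS R (carrier R)\<^esub> pdom_class R e (inv\<^bsub>G\<^esub> g)))}"


section \<open>Partial representations\<close>

locale partial_representation = G: group G + S: monoid S
  for G :: "('g, 'm) monoid_scheme" and S :: "('s, 'n) monoid_scheme" and \<Phi> :: "'g \<Rightarrow> 's" +
  assumes rep_closed: "\<Phi> \<in> carrier G \<rightarrow> carrier S"
    and rep_left: "\<lbrakk>g \<in> carrier G; h \<in> carrier G\<rbrakk>
      \<Longrightarrow> \<Phi> (inv\<^bsub>G\<^esub> g) \<otimes>\<^bsub>S\<^esub> \<Phi> g \<otimes>\<^bsub>S\<^esub> \<Phi> h = \<Phi> (inv\<^bsub>G\<^esub> g) \<otimes>\<^bsub>S\<^esub> \<Phi> (g \<otimes>\<^bsub>G\<^esub> h)"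
    and rep_right: "\<lbrakk>g \<in> carrier G; h \<in> carrier G\<rbrakk>
      \<Longrightarrow> \<Phi> g \<otimes>\<^bsub>S\<^esub> \<Phi> h \<otimes>\<^bsub>S\<^esub> \<Phi> (inv\<^bsub>G\<^esub> h) = \<Phi> (g \<otimes>\<^bsub>G\<^esub> h) \<otimes>\<^bsub>S\<^esub> \<Phi> (inv\<^bsub>G\<^esub> h)"
    and rep_unit: "\<Phi> \<one>\<^bsub>G\<^esub> = \<one>\<^bsub>S\<^esub>"

text \<open>The bimodule \<open>\<^sub>g(D\<^bsub>g\<inverse>\<^esub>)\<^sub>I\<close>, its class, and \<open>\<Phi>\<^sub>f = f \<Phi>\<^sub>0\<close>.\<close>

definition twisted_pdom ::
    "('g, 'm) monoid_scheme \<Rightarrow> ('a, 'r) ring_scheme \<Rightarrow> ('g \<Rightarrow> 'a) \<Rightarrow> ('g \<Rightarrow> 'a \<Rightarrow> 'a) \<Rightarrow> 'g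
     \<Rightarrow> ('a, 'a) bimodule"
  where "twisted_pdom G R e \<alpha> g =
    make_bimodule (pdom R e (inv\<^bsub>G\<^esub> g)) \<zero>\<^bsub>R\<^esub> (add R)
      (\<lambda>r d. \<alpha> (inv\<^bsub>G\<^esub> g) (r \<otimes>\<^bsub>R\<^esub> e g) \<otimes>\<^bsub>R\<^esub> d) (monoid.mult R)"

definition Phi0 ::
    "('g, 'm) monoid_scheme \<Rightarrow> ('a, 'r) ring_scheme \<Rightarrow> ('g \<Rightarrow> 'a) \<Rightarrow> ('g \<Rightarrow> 'a \<Rightarrow> 'a) \<Rightarrow> 'g
     \<Rightarrow> 'a ubimodule set"
  where "Phi0 G R e \<alpha> g = bimodule_class R (twisted_pdom G R e \<alpha> g)"

definition Phi ::
    "('g, 'm) monoid_scheme \<Rightarrow> ('a, 'r) ring_scheme \<Rightarrow> ('g \<Rightarrow> 'a) \<Rightarrow> ('g \<Rightarrow> 'a \<Rightarrow> 'a)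
     \<Rightarrow> ('g \<Rightarrow> 'a ubimodule set) \<Rightarrow> 'g \<Rightarrow> 'a ubimodule set"
  where "Phi G R e \<alpha> f g =
    f g \<otimes>\<^bsub>PicS R (invariants G R e \<alpha>)\<^esub> Phi0 G R e \<alpha> g"

end

theory Submission
  imports Defs
begin

text \<open>
  Write \<open>A\<^sub>g\<close> for the twisted ideal whose class is \<open>\<Phi>\<^sub>0(g)\<close>. The heart of the matter is the identity
  \<open>\<Phi>(g) \<Phi>(h) = [D\<^sub>g] \<Phi>(g h)\<close> (lemma \<open>Phi_mult\<close>). Together with \<open>\<Phi>(1) = 1\<close> and
  \<open>\<Phi>(g) [D\<^sub>h] = [D\<^bsub>g h\<^esub>] \<Phi>(g)\<close> it contains both laws of a partial representation, and it
  specialises to \<open>\<Phi>(g) \<Phi>(g\<inverse>) = [D\<^sub>g]\<close>. The identity follows from the cocycle identity and from the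
  isomorphisms \<open>A\<^sub>g \<otimes> A\<^sub>h \<cong> D\<^sub>g \<otimes> A\<^bsub>g h\<^esub>\<close>, \<open>D\<^sub>g \<otimes> E \<cong> E \<otimes> D\<^sub>g\<close> and
  \<open>A\<^sub>g \<otimes> E \<cong> E' \<otimes> A\<^sub>g\<close> for central \<open>E\<close>, where \<open>[E'] = \<alpha>\<^sup>*\<^sub>g ([E] [D\<^bsub>g\<inverse>\<^esub>])\<close>: carrying a central
  bimodule past \<open>A\<^sub>g\<close> is the action \<open>\<alpha>\<^sup>*\<close>.

  For the last claim the isomorphism is \<open>d \<mapsto> (x \<mapsto> d x)\<close>. The idempotent \<open>1\<^sub>g\<close> acts on \<open>J\<close> as
  the identity because \<open>[D\<^sub>g] \<Phi>(g) = \<Phi>(g)\<close>; the map is injective because an element of \<open>D\<^sub>g\<close> that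
  kills \<open>J\<close> also kills \<open>J \<otimes> J' \<cong> D\<^sub>g\<close>, where \<open>[J'] = \<Phi>(g\<inverse>)\<close>; it is onto because \<open>J\<close> has
  rank at most one.

  Two reformulations keep the argument elementary. A bimodule belongs to a monoid \<open>PicS\<close> iff it is
  central, finitely generated projective on the left, and satisfies \<open>\<phi>(x) y = \<phi>(y) x\<close> for all
  left linear \<open>\<phi> : P \<rightarrow> R\<close> (lemma \<open>picS_bimodule_iff\<close>): an algebra map from the commutative ring
  \<open>R\<close> onto the endomorphism ring makes that ring commutative, and this forces rank at most one.
  The identity passes to tensor products and to twists by short computations with dual bases.
  And when \<open>Q\<close> is finitely generated projective, \<open>P \<otimes> Q\<close> is characterised by its contractions
  \<open>p \<otimes> q \<mapsto> p \<psi>(q)\<close>, one for each left linear \<open>\<psi> : Q \<rightarrow> R\<close> (locale \<open>tensor_product\<close>). So an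
  isomorphism such as \<open>A\<^sub>g \<otimes> A\<^sub>h \<cong> D\<^sub>g \<otimes> A\<^bsub>g h\<^esub>\<close> is proved by exhibiting a single bimodule as a
  tensor product in two ways.
\<close>

section \<open>Linear maps, isomorphisms and sub-bimodules\<close>

lemma linear_mapsI:
  assumes "\<And>x. x \<in> carrier M \<Longrightarrow> h x \<in> carrier N"
    and "\<And>x y. \<lbrakk>x \<in> carrier M; y \<in> carrier M\<rbrakk> \<Longrightarrow> h (x \<oplus>\<^bsub>M\<^esub> y) = h x \<oplus>\<^bsub>N\<^esub> h y"
    and "\<And>s x. \<lbrakk>s \<in> S; x \<in> carrier M\<rbrakk> \<Longrightarrow> h (s \<odot>\<^bsub>M\<^esub> x) = s \<odot>\<^bsub>N\<^esub> h x"
  shows "h \<in> linear_maps S M N"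
  using assms by (auto simp: linear_maps_def)

lemma linear_mapsD:
  assumes "h \<in> linear_maps S M N"
  shows "x \<in> carrier M \<Longrightarrow> h x \<in> carrier N"
    and "\<lbrakk>x \<in> carrier M; y \<in> carrier M\<rbrakk> \<Longrightarrow> h (x \<oplus>\<^bsub>M\<^esub> y) = h x \<oplus>\<^bsub>N\<^esub> h y"
    and "\<lbrakk>s \<in> S; x \<in> carrier M\<rbrakk> \<Longrightarrow> h (s \<odot>\<^bsub>M\<^esub> x) = s \<odot>\<^bsub>N\<^esub> h x"
  using assms by (auto simp: linear_maps_def)

lemma linear_maps_comp:
  "\<lbrakk>h \<in> linear_maps S M N; k \<in> linear_maps S N L\<rbrakk> \<Longrightarrow> (\<lambda>x. k (h x)) \<in> linear_maps S M L"
  by (auto simp: linear_maps_def Pi_iff)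

lemma linear_maps_additive: "h \<in> linear_maps S M N \<Longrightarrow> h \<in> linear_maps {} M N"
  by (auto simp: linear_maps_def)

lemma additive_zero:
  assumes h: "h \<in> linear_maps S M N" and M: "abelian_group M" and N: "abelian_group N"
  shows "h \<zero>\<^bsub>M\<^esub> = \<zero>\<^bsub>N\<^esub>"
proof -
  interpret M: abelian_group M by fact
  interpret N: abelian_group N by fact
  note [simp] = linear_mapsD[OF h]
  have "h \<zero>\<^bsub>M\<^esub> \<oplus>\<^bsub>N\<^esub> h \<zero>\<^bsub>M\<^esub> = h \<zero>\<^bsub>M\<^esub>"
    by (metis M.r_zero M.zero_closed linear_mapsD(2)[OF h])
  then show ?thesis by (simp add: N.add.r_cancel_one')
qed

lemma additive_finsum:
  assumes h: "h \<in> linear_maps S M N" and M: "abelian_group M" and N: "abelian_group N"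
    and f: "\<And>i. i \<in> I \<Longrightarrow> f i \<in> carrier M"
  shows "h (finsum M f I) = finsum N (\<lambda>i. h (f i)) I"
proof -
  interpret M: abelian_group M by fact
  interpret N: abelian_group N by fact
  show ?thesis
  proof (cases "finite I")
    case True
    then show ?thesis using f
      by (induction I rule: finite_induct)
        (simp_all add: additive_zero[OF h M N] linear_mapsD[OF h] Pi_iff)
  next
    case False
    then show ?thesis by (simp add: M.finsum_infinite N.finsum_infinite additive_zero[OF h M N])
  qed
qed

text \<open>A map out of a tensor product is built below as such a sum, with one summand for each member of
  a dual basis.\<close>

lemma finsum_additive:
  assumes N: "abelian_group N" and h: "\<And>i. i \<in> I \<Longrightarrow> h i \<in> linear_maps {} M N"
  shows "(\<lambda>x. finsum N (\<lambda>i. h i x) I) \<in> linear_maps {} M N"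
proof -
  interpret N: abelian_group N by fact
  show ?thesis
  proof (rule linear_mapsI)
    fix x y assume x: "x \<in> carrier M" and y: "y \<in> carrier M"
    have "finsum N (\<lambda>i. h i (x \<oplus>\<^bsub>M\<^esub> y)) I = finsum N (\<lambda>i. h i x \<oplus>\<^bsub>N\<^esub> h i y) I"
      using x y by (intro N.finsum_cong') (auto simp: linear_mapsD[OF h])
    also have "\<dots> = finsum N (\<lambda>i. h i x) I \<oplus>\<^bsub>N\<^esub> finsum N (\<lambda>i. h i y) I"
      using x y by (intro N.finsum_addf) (auto simp: linear_mapsD[OF h])
    finally show "finsum N (\<lambda>i. h i (x \<oplus>\<^bsub>M\<^esub> y)) I
        = finsum N (\<lambda>i. h i x) I \<oplus>\<^bsub>N\<^esub> finsum N (\<lambda>i. h i y) I" .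
  qed (auto intro!: N.finsum_closed simp: linear_mapsD[OF h])
qed

lemma bimodule_isoD:
  assumes "h \<in> bimodule_iso R P Q"
  shows "h \<in> linear_maps (carrier R) P Q" "bij_betw h (carrier P) (carrier Q)"
    "\<lbrakk>x \<in> carrier P; r \<in> carrier R\<rbrakk> \<Longrightarrow> h (x \<triangleleft>\<^bsub>P\<^esub> r) = h x \<triangleleft>\<^bsub>Q\<^esub> r"
  using assms by (auto simp: bimodule_iso_def)

lemma bimodule_isoI:
  assumes "h \<in> linear_maps (carrier R) P Q" "bij_betw h (carrier P) (carrier Q)"
    "\<And>x r. \<lbrakk>x \<in> carrier P; r \<in> carrier R\<rbrakk> \<Longrightarrow> h (x \<triangleleft>\<^bsub>P\<^esub> r) = h x \<triangleleft>\<^bsub>Q\<^esub> r"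
  shows "h \<in> bimodule_iso R P Q"
  using assms by (auto simp: bimodule_iso_def)

lemma bimodule_iso_comp:
  assumes h: "h \<in> bimodule_iso R P Q" and k: "k \<in> bimodule_iso R Q S"
  shows "(\<lambda>x. k (h x)) \<in> bimodule_iso R P S"
  using linear_maps_comp[OF bimodule_isoD(1)[OF h] bimodule_isoD(1)[OF k]]
    bij_betw_trans[OF bimodule_isoD(2)[OF h] bimodule_isoD(2)[OF k]]
    bimodule_isoD(3)[OF h] bimodule_isoD(3)[OF k] linear_mapsD(1)[OF bimodule_isoD(1)[OF h]]
  by (auto intro!: bimodule_isoI simp: comp_def)

lemma bimodule_iso_inv:
  assumes P: "bimodule R P" and h: "h \<in> bimodule_iso R P Q"
  shows "inv_into (carrier P) h \<in> bimodule_iso R Q P"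
proof -
  interpret P: bimodule R P by fact
  let ?k = "inv_into (carrier P) h"
  note hD = linear_mapsD[OF bimodule_isoD(1)[OF h]] bimodule_isoD(3)[OF h]
  have bij: "bij_betw h (carrier P) (carrier Q)" using h by (rule bimodule_isoD)
  have k: "?k y \<in> carrier P" "h (?k y) = y" if "y \<in> carrier Q" for y
    using bij that by (auto simp: bij_betw_def inv_into_into f_inv_into_f)
  have eq: "?k y = x" if "x \<in> carrier P" "h x = y" for x y
    using bij that by (auto simp: bij_betw_def inv_into_f_f)
  show ?thesis
    by (intro bimodule_isoI linear_mapsI bij_betw_inv_into[OF bij] eq)
      (auto simp: hD k P.ract_closed)
qed

definition isomorphic_bimodules where
  "isomorphic_bimodules R P Q \<longleftrightarrow> bimodule_iso R P Q \<noteq> {}"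

lemma isomorphic_trans:
  "\<lbrakk>isomorphic_bimodules R P Q; isomorphic_bimodules R Q S\<rbrakk> \<Longrightarrow> isomorphic_bimodules R P S"
  unfolding isomorphic_bimodules_def using bimodule_iso_comp by fast

lemma isomorphic_sym:
  "\<lbrakk>bimodule R P; isomorphic_bimodules R P Q\<rbrakk> \<Longrightarrow> isomorphic_bimodules R Q P"
  unfolding isomorphic_bimodules_def using bimodule_iso_inv by fast

lemma bimodule_class_iff:
  "B \<in> bimodule_class R P \<longleftrightarrow> bimodule R B \<and> isomorphic_bimodules R P B"
  by (auto simp: bimodule_class_def isomorphic_bimodules_def)

lemma bimodule_class_cong:
  fixes R :: "('a, 'r) ring_scheme"
  assumes "bimodule R P" "isomorphic_bimodules R P Q"
  shows "bimodule_class R P = bimodule_class R Q"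
proof -
  have "isomorphic_bimodules R P B \<longleftrightarrow> isomorphic_bimodules R Q B" for B :: "'a ubimodule"
    using assms isomorphic_sym isomorphic_trans by metis
  then show ?thesis by (auto simp: bimodule_class_iff)
qed

lemma make_bimodule_simps [simp]:
  "carrier (make_bimodule C z pl l r) = C"
  "\<zero>\<^bsub>make_bimodule C z pl l r\<^esub> = z"
  "x \<oplus>\<^bsub>make_bimodule C z pl l r\<^esub> y = pl x y"
  "a \<odot>\<^bsub>make_bimodule C z pl l r\<^esub> x = l a x"
  "x \<triangleleft>\<^bsub>make_bimodule C z pl l r\<^esub> a = r x a"
  by (simp_all add: make_bimodule_def)

lemma ideal_bimodule_simps [simp]:
  "carrier (ideal_bimodule R I) = I"
  "\<zero>\<^bsub>ideal_bimodule R I\<^esub> = \<zero>\<^bsub>R\<^esub>"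
  "x \<oplus>\<^bsub>ideal_bimodule R I\<^esub> y = x \<oplus>\<^bsub>R\<^esub> y"
  "a \<odot>\<^bsub>ideal_bimodule R I\<^esub> x = a \<otimes>\<^bsub>R\<^esub> x"
  "x \<triangleleft>\<^bsub>ideal_bimodule R I\<^esub> a = x \<otimes>\<^bsub>R\<^esub> a"
  by (simp_all add: ideal_bimodule_def)

lemma bimoduleI:
  assumes "cring R" "abelian_group P"
    and "\<And>r x. \<lbrakk>r \<in> carrier R; x \<in> carrier P\<rbrakk> \<Longrightarrow> r \<odot>\<^bsub>P\<^esub> x \<in> carrier P"
    and "\<And>r s x. \<lbrakk>r \<in> carrier R; s \<in> carrier R; x \<in> carrier P\<rbrakk>
      \<Longrightarrow> (r \<oplus>\<^bsub>R\<^esub> s) \<odot>\<^bsub>P\<^esub> x = r \<odot>\<^bsub>P\<^esub> x \<oplus>\<^bsub>P\<^esub> s \<odot>\<^bsub>P\<^esub> x"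
    and "\<And>r x y. \<lbrakk>r \<in> carrier R; x \<in> carrier P; y \<in> carrier P\<rbrakk>
      \<Longrightarrow> r \<odot>\<^bsub>P\<^esub> (x \<oplus>\<^bsub>P\<^esub> y) = r \<odot>\<^bsub>P\<^esub> x \<oplus>\<^bsub>P\<^esub> r \<odot>\<^bsub>P\<^esub> y"
    and "\<And>r s x. \<lbrakk>r \<in> carrier R; s \<in> carrier R; x \<in> carrier P\<rbrakk>
      \<Longrightarrow> (r \<otimes>\<^bsub>R\<^esub> s) \<odot>\<^bsub>P\<^esub> x = r \<odot>\<^bsub>P\<^esub> (s \<odot>\<^bsub>P\<^esub> x)"
    and "\<And>x. x \<in> carrier P \<Longrightarrow> \<one>\<^bsub>R\<^esub> \<odot>\<^bsub>P\<^esub> x = x"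
    and "\<And>x r. \<lbrakk>x \<in> carrier P; r \<in> carrier R\<rbrakk> \<Longrightarrow> x \<triangleleft>\<^bsub>P\<^esub> r \<in> carrier P"
    and "\<And>x r s. \<lbrakk>x \<in> carrier P; r \<in> carrier R; s \<in> carrier R\<rbrakk>
      \<Longrightarrow> x \<triangleleft>\<^bsub>P\<^esub> (r \<oplus>\<^bsub>R\<^esub> s) = x \<triangleleft>\<^bsub>P\<^esub> r \<oplus>\<^bsub>P\<^esub> x \<triangleleft>\<^bsub>P\<^esub> s"
    and "\<And>x y r. \<lbrakk>x \<in> carrier P; y \<in> carrier P; r \<in> carrier R\<rbrakk>
      \<Longrightarrow> (x \<oplus>\<^bsub>P\<^esub> y) \<triangleleft>\<^bsub>P\<^esub> r = x \<triangleleft>\<^bsub>P\<^esub> r \<oplus>\<^bsub>P\<^esub> y \<triangleleft>\<^bsub>P\<^esub> r"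
    and "\<And>x r s. \<lbrakk>x \<in> carrier P; r \<in> carrier R; s \<in> carrier R\<rbrakk>
      \<Longrightarrow> x \<triangleleft>\<^bsub>P\<^esub> (r \<otimes>\<^bsub>R\<^esub> s) = (x \<triangleleft>\<^bsub>P\<^esub> r) \<triangleleft>\<^bsub>P\<^esub> s"
    and "\<And>x. x \<in> carrier P \<Longrightarrow> x \<triangleleft>\<^bsub>P\<^esub> \<one>\<^bsub>R\<^esub> = x"
    and "\<And>r x s. \<lbrakk>r \<in> carrier R; x \<in> carrier P; s \<in> carrier R\<rbrakk>
      \<Longrightarrow> (r \<odot>\<^bsub>P\<^esub> x) \<triangleleft>\<^bsub>P\<^esub> s = r \<odot>\<^bsub>P\<^esub> (x \<triangleleft>\<^bsub>P\<^esub> s)"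
  shows "bimodule R P"
  using assms by (auto intro!: bimodule.intro bimodule_axioms.intro moduleI)

lemma bimodule_imp_abelian_group: "bimodule R P \<Longrightarrow> abelian_group P"
  by (simp add: bimodule_def module_def)

lemma bimodule_imp_cring: "bimodule R P \<Longrightarrow> cring R"
  by (simp add: bimodule_def module_def)

lemma bimodule_imp_module: "bimodule R P \<Longrightarrow> module R P"
  by (simp add: bimodule_def)

text \<open>\<open>Q\<close> is not known to be a group beforehand, so its zero has to be matched explicitly.\<close>

lemma bimodule_transport:
  assumes P: "bimodule R P" and bij: "bij_betw h (carrier P) (carrier Q)"
    and zero: "h \<zero>\<^bsub>P\<^esub> = \<zero>\<^bsub>Q\<^esub>"
    and h: "\<And>x y. \<lbrakk>x \<in> carrier P; y \<in> carrier P\<rbrakk> \<Longrightarrow> h x \<oplus>\<^bsub>Q\<^esub> h y = h (x \<oplus>\<^bsub>P\<^esub> y)"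
      "\<And>r x. \<lbrakk>r \<in> carrier R; x \<in> carrier P\<rbrakk> \<Longrightarrow> r \<odot>\<^bsub>Q\<^esub> h x = h (r \<odot>\<^bsub>P\<^esub> x)"
      "\<And>r x. \<lbrakk>r \<in> carrier R; x \<in> carrier P\<rbrakk> \<Longrightarrow> h x \<triangleleft>\<^bsub>Q\<^esub> r = h (x \<triangleleft>\<^bsub>P\<^esub> r)"
  shows "bimodule R Q" and "h \<in> bimodule_iso R P Q"
proof -
  interpret P: bimodule R P by fact
  have Q: "carrier Q = h ` carrier P" using bij by (simp add: bij_betw_def)
  have "abelian_group Q"
  proof (rule abelian_groupI)
    fix y assume "y \<in> carrier Q"
    then obtain x where "x \<in> carrier P" "y = h x" unfolding Q by blast
    then have "h (\<ominus>\<^bsub>P\<^esub> x) \<oplus>\<^bsub>Q\<^esub> y = \<zero>\<^bsub>Q\<^esub>" by (simp add: h P.l_neg zero)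
    then show "\<exists>z\<in>carrier Q. z \<oplus>\<^bsub>Q\<^esub> y = \<zero>\<^bsub>Q\<^esub>" using \<open>x \<in> carrier P\<close> unfolding Q by blast
  qed (auto simp: Q h P.a_ac simp flip: zero)
  then show "bimodule R Q"
    using P.R.is_cring
    by (intro bimoduleI)
      (auto simp: Q h P.ract_closed P.smult_l_distr P.smult_r_distr P.smult_assoc1 P.ract_add
        P.ract_add_scalar P.ract_assoc P.ract_one P.lact_ract)
  show "h \<in> bimodule_iso R P Q"
    using bij by (intro bimodule_isoI linear_mapsI) (auto simp: Q h)
qed

text \<open>Negatives are multiples by \<open>- 1\<close>.\<close>

lemma subbimodule:
  assumes P: "bimodule R P" and C: "C \<subseteq> carrier P" "\<zero>\<^bsub>P\<^esub> \<in> C"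
    "\<And>x y. \<lbrakk>x \<in> C; y \<in> C\<rbrakk> \<Longrightarrow> x \<oplus>\<^bsub>P\<^esub> y \<in> C"
    "\<And>r x. \<lbrakk>r \<in> carrier R; x \<in> C\<rbrakk> \<Longrightarrow> r \<odot>\<^bsub>P\<^esub> x \<in> C"
    "\<And>r x. \<lbrakk>r \<in> carrier R; x \<in> C\<rbrakk> \<Longrightarrow> x \<triangleleft>\<^bsub>P\<^esub> r \<in> C"
  shows "bimodule R (P\<lparr>carrier := C\<rparr>)"
proof -
  interpret P: bimodule R P by fact
  have in_P: "x \<in> C \<Longrightarrow> x \<in> carrier P" for x using C by auto
  have neg: "\<ominus>\<^bsub>P\<^esub> x \<in> C" if "x \<in> C" for x
    using C(4)[of "\<ominus>\<^bsub>R\<^esub> \<one>\<^bsub>R\<^esub>" x] that by (simp add: in_P P.smult_l_minus)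
  have "abelian_group (P\<lparr>carrier := C\<rparr>)"
  proof (rule abelian_groupI)
    fix x assume "x \<in> carrier (P\<lparr>carrier := C\<rparr>)"
    then show "\<exists>z\<in>carrier (P\<lparr>carrier := C\<rparr>). z \<oplus>\<^bsub>P\<lparr>carrier := C\<rparr>\<^esub> x = \<zero>\<^bsub>P\<lparr>carrier := C\<rparr>\<^esub>"
      using neg[of x] by (auto intro!: bexI[of _ "\<ominus>\<^bsub>P\<^esub> x"] simp: in_P P.l_neg)
  qed (auto simp: C in_P P.a_ac)
  then show ?thesis
    using P.R.is_cring
    by (intro bimoduleI)
      (auto simp: C in_P P.smult_l_distr P.smult_r_distr P.smult_assoc1 P.ract_add
        P.ract_add_scalar P.ract_assoc P.ract_one P.lact_ract)
qed

lemma ring_bimodule: "cring R \<Longrightarrow> bimodule R (ideal_bimodule R (carrier R))"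
proof -
  assume "cring R"
  then interpret cring R .
  have "abelian_group (ideal_bimodule R (carrier R))"
  proof (rule abelian_groupI)
    fix x assume "x \<in> carrier (ideal_bimodule R (carrier R))"
    then show "\<exists>z\<in>carrier (ideal_bimodule R (carrier R)).
        z \<oplus>\<^bsub>ideal_bimodule R (carrier R)\<^esub> x = \<zero>\<^bsub>ideal_bimodule R (carrier R)\<^esub>"
      by (auto intro!: bexI[of _ "\<ominus>\<^bsub>R\<^esub> x"] simp: l_neg)
  qed (auto simp: a_ac)
  then show ?thesis using \<open>cring R\<close>
    by (intro bimoduleI) (auto simp: l_distr r_distr m_assoc)
qed

section \<open>Dual bases and modules of rank at most one\<close>

abbreviation functionals where
  "functionals R M \<equiv> linear_maps (carrier R) M (ideal_bimodule R (carrier R))"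

lemma functionalD:
  assumes "\<phi> \<in> functionals R M"
  shows "x \<in> carrier M \<Longrightarrow> \<phi> x \<in> carrier R"
    and "\<lbrakk>x \<in> carrier M; y \<in> carrier M\<rbrakk> \<Longrightarrow> \<phi> (x \<oplus>\<^bsub>M\<^esub> y) = \<phi> x \<oplus>\<^bsub>R\<^esub> \<phi> y"
    and "\<lbrakk>s \<in> carrier R; x \<in> carrier M\<rbrakk> \<Longrightarrow> \<phi> (s \<odot>\<^bsub>M\<^esub> x) = s \<otimes>\<^bsub>R\<^esub> \<phi> x"
  using linear_mapsD[OF assms] by simp_all

definition dual_basis where
  "dual_basis R M n x \<phi> \<longleftrightarrow>
    (\<forall>i<(n::nat). x i \<in> carrier M \<and> \<phi> i \<in> functionals R M) \<and>
    (\<forall>v\<in>carrier M. v = finsum M (\<lambda>i. \<phi> i v \<odot>\<^bsub>M\<^esub> x i) {..<n})"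

lemma dual_basisD:
  assumes "dual_basis R M n x \<phi>"
  shows "i < n \<Longrightarrow> x i \<in> carrier M" "i < n \<Longrightarrow> \<phi> i \<in> functionals R M"
    "v \<in> carrier M \<Longrightarrow> finsum M (\<lambda>i. \<phi> i v \<odot>\<^bsub>M\<^esub> x i) {..<n} = v"
  using assms unfolding dual_basis_def by auto

lemma free_module_simps [simp]:
  "carrier (free_module R n) = {..<n} \<rightarrow>\<^sub>E carrier R"
  "u \<oplus>\<^bsub>free_module R n\<^esub> v = (\<lambda>i\<in>{..<n}. u i \<oplus>\<^bsub>R\<^esub> v i)"
  "r \<odot>\<^bsub>free_module R n\<^esub> u = (\<lambda>i\<in>{..<n}. r \<otimes>\<^bsub>R\<^esub> u i)"
  by (simp_all add: free_module_def)

text \<open>Induction on the number \<open>k\<close> of leading coordinates that are kept; the other coordinates are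
  replaced by zero.\<close>

lemma linear_map_free_module:
  assumes M: "module R M" and \<pi>: "\<pi> \<in> linear_maps (carrier R) (free_module R n) M"
    and u: "u \<in> carrier (free_module R n)"
  shows "\<pi> u = finsum M (\<lambda>i. u i \<odot>\<^bsub>M\<^esub> \<pi> (\<lambda>j\<in>{..<n}. if j = i then \<one>\<^bsub>R\<^esub> else \<zero>\<^bsub>R\<^esub>)) {..<n}"
proof -
  interpret module R M by fact
  define d where "d = (\<lambda>i. \<lambda>j\<in>{..<n}. if j = i then \<one>\<^bsub>R\<^esub> else \<zero>\<^bsub>R\<^esub>)"
  define u' where "u' = (\<lambda>k. \<lambda>j\<in>{..<n}. if j < k then u j else \<zero>\<^bsub>R\<^esub>)"
  have u_in: "i < n \<Longrightarrow> u i \<in> carrier R" for i using u by auto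
  have d_in: "d i \<in> carrier (free_module R n)" for i by (auto simp: d_def)
  have u'_in: "u' k \<in> carrier (free_module R n)" for k using u_in by (auto simp: u'_def)
  note \<pi>D = linear_mapsD[OF \<pi>]
  have zero: "\<pi> (u' 0) = \<zero>\<^bsub>M\<^esub>"
  proof -
    have "u' 0 \<oplus>\<^bsub>free_module R n\<^esub> u' 0 = u' 0" by (auto simp: fun_eq_iff u'_def)
    then have "\<pi> (u' 0) \<oplus>\<^bsub>M\<^esub> \<pi> (u' 0) = \<pi> (u' 0)"
      using \<pi>D(2)[OF u'_in u'_in, of 0 0] by simp
    then show ?thesis using \<pi>D(1)[OF u'_in, of 0] by (simp add: M.add.r_cancel_one)
  qed
  have step: "\<pi> (u' (Suc k)) = u k \<odot>\<^bsub>M\<^esub> \<pi> (d k) \<oplus>\<^bsub>M\<^esub> \<pi> (u' k)" if k: "k < n" for k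
  proof -
    have "u' (Suc k) = (u k \<odot>\<^bsub>free_module R n\<^esub> d k) \<oplus>\<^bsub>free_module R n\<^esub> u' k"
      using k u_in by (auto simp: fun_eq_iff less_Suc_eq u'_def d_def)
    moreover have "u k \<odot>\<^bsub>free_module R n\<^esub> d k \<in> carrier (free_module R n)"
      using k u_in by (auto simp: d_def)
    ultimately show ?thesis
      by (simp only: \<pi>D(2)[OF _ u'_in] \<pi>D(3)[OF u_in[OF k] d_in])
  qed
  have "k \<le> n \<Longrightarrow> \<pi> (u' k) = finsum M (\<lambda>i. u i \<odot>\<^bsub>M\<^esub> \<pi> (d i)) {..<k}" for k
  proof (induction k)
    case 0
    show ?case by (simp add: zero)
  next
    case (Suc k)
    then show ?case
      using u_in \<pi>D(1)[OF d_in] by (simp add: step lessThan_Suc M.finsum_insert Pi_iff)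
  qed
  from this[of n] have "\<pi> (u' n) = finsum M (\<lambda>i. u i \<odot>\<^bsub>M\<^esub> \<pi> (d i)) {..<n}" by simp
  moreover have "u' n = u" using u by (auto simp: fun_eq_iff PiE_def extensional_def u'_def)
  ultimately show ?thesis by (simp add: d_def)
qed

text \<open>For a retract \<open>M \<rightarrow> R\<^sup>n \<rightarrow> M\<close> the \<open>x\<^sub>i\<close> are the images of the unit vectors and the \<open>\<phi>\<^sub>i\<close> the
  coordinates of the inclusion.\<close>

lemma fg_projective_iff_dual_basis:
  assumes M: "module R M"
  shows "fg_projective R M \<longleftrightarrow> (\<exists>n x \<phi>. dual_basis R M n x \<phi>)"
proof
  interpret module R M by fact
  assume "fg_projective R M"
  then obtain n \<iota> \<pi> where \<iota>: "\<iota> \<in> linear_maps (carrier R) M (free_module R n)"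
    and \<pi>: "\<pi> \<in> linear_maps (carrier R) (free_module R n) M"
    and id: "\<And>x. x \<in> carrier M \<Longrightarrow> \<pi> (\<iota> x) = x" unfolding fg_projective_def by blast
  have \<iota>_in: "x \<in> carrier M \<Longrightarrow> i < n \<Longrightarrow> \<iota> x i \<in> carrier R" for x i
    using linear_mapsD(1)[OF \<iota>, of x] by auto
  have "dual_basis R M n (\<lambda>i. \<pi> (\<lambda>j\<in>{..<n}. if j = i then \<one>\<^bsub>R\<^esub> else \<zero>\<^bsub>R\<^esub>)) (\<lambda>i v. \<iota> v i)"
    unfolding dual_basis_def
  proof (intro conjI allI impI ballI)
    fix v assume "v \<in> carrier M"
    then show "v = finsum M (\<lambda>i. \<iota> v i \<odot>\<^bsub>M\<^esub> \<pi> (\<lambda>j\<in>{..<n}. if j = i then \<one>\<^bsub>R\<^esub> else \<zero>\<^bsub>R\<^esub>)) {..<n}"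
      by (intro trans[OF id[symmetric] linear_map_free_module[OF M \<pi> linear_mapsD(1)[OF \<iota>]]])
  qed (auto intro!: linear_mapsI linear_mapsD(1)[OF \<pi>] simp: \<iota>_in linear_mapsD[OF \<iota>])
  then show "\<exists>n x \<phi>. dual_basis R M n x \<phi>" by blast
next
  interpret module R M by fact
  assume "\<exists>n x \<phi>. dual_basis R M n x \<phi>"
  then obtain n x \<phi> where db: "dual_basis R M n x \<phi>" by blast
  note [simp] = dual_basisD(1)[OF db] functionalD[OF dual_basisD(2)[OF db]]
  have \<iota>: "(\<lambda>v. \<lambda>i\<in>{..<n}. \<phi> i v) \<in> linear_maps (carrier R) M (free_module R n)"
    by (intro linear_mapsI) (auto simp: fun_eq_iff)
  have \<pi>: "(\<lambda>u. finsum M (\<lambda>i. u i \<odot>\<^bsub>M\<^esub> x i) {..<n}) \<in> linear_maps (carrier R) (free_module R n) M"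
  proof (intro linear_mapsI)
    fix u v assume uv: "u \<in> carrier (free_module R n)" "v \<in> carrier (free_module R n)"
    then have "finsum M (\<lambda>i. (u \<oplus>\<^bsub>free_module R n\<^esub> v) i \<odot>\<^bsub>M\<^esub> x i) {..<n}
        = finsum M (\<lambda>i. u i \<odot>\<^bsub>M\<^esub> x i \<oplus>\<^bsub>M\<^esub> v i \<odot>\<^bsub>M\<^esub> x i) {..<n}"
      by (intro M.finsum_cong') (auto simp: Pi_iff PiE_iff smult_l_distr)
    also have "\<dots> = finsum M (\<lambda>i. u i \<odot>\<^bsub>M\<^esub> x i) {..<n} \<oplus>\<^bsub>M\<^esub> finsum M (\<lambda>i. v i \<odot>\<^bsub>M\<^esub> x i) {..<n}"
      using uv by (intro M.finsum_addf) (auto simp: Pi_iff PiE_iff)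
    finally show "finsum M (\<lambda>i. (u \<oplus>\<^bsub>free_module R n\<^esub> v) i \<odot>\<^bsub>M\<^esub> x i) {..<n}
      = finsum M (\<lambda>i. u i \<odot>\<^bsub>M\<^esub> x i) {..<n} \<oplus>\<^bsub>M\<^esub> finsum M (\<lambda>i. v i \<odot>\<^bsub>M\<^esub> x i) {..<n}" .
  next
    fix r u assume ru: "r \<in> carrier R" "u \<in> carrier (free_module R n)"
    then have "finsum M (\<lambda>i. (r \<odot>\<^bsub>free_module R n\<^esub> u) i \<odot>\<^bsub>M\<^esub> x i) {..<n}
        = finsum M (\<lambda>i. r \<odot>\<^bsub>M\<^esub> (u i \<odot>\<^bsub>M\<^esub> x i)) {..<n}"
      by (intro M.finsum_cong') (auto simp: Pi_iff PiE_iff smult_assoc1)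
    also have "\<dots> = r \<odot>\<^bsub>M\<^esub> finsum M (\<lambda>i. u i \<odot>\<^bsub>M\<^esub> x i) {..<n}"
      using ru by (intro finsum_smult_ldistr[symmetric]) (auto simp: Pi_iff PiE_iff)
    finally show "finsum M (\<lambda>i. (r \<odot>\<^bsub>free_module R n\<^esub> u) i \<odot>\<^bsub>M\<^esub> x i) {..<n}
      = r \<odot>\<^bsub>M\<^esub> finsum M (\<lambda>i. u i \<odot>\<^bsub>M\<^esub> x i) {..<n}" .
  qed (auto intro!: M.finsum_closed simp: PiE_iff)
  have id: "finsum M (\<lambda>i. (\<lambda>i\<in>{..<n}. \<phi> i v) i \<odot>\<^bsub>M\<^esub> x i) {..<n} = v" if "v \<in> carrier M" for v
  proof -
    have "finsum M (\<lambda>i. (\<lambda>i\<in>{..<n}. \<phi> i v) i \<odot>\<^bsub>M\<^esub> x i) {..<n}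
        = finsum M (\<lambda>i. \<phi> i v \<odot>\<^bsub>M\<^esub> x i) {..<n}"
      using that by (intro M.finsum_cong') auto
    then show ?thesis using dual_basisD(3)[OF db that] by simp
  qed
  show "fg_projective R M" unfolding fg_projective_def
    by (intro conjI M exI[of _ n] bexI[OF _ \<iota>] bexI[OF _ \<pi>] ballI id)
qed

text \<open>A condition on finitely generated projective modules that says that the rank is at most one at
  every prime: in \<open>S\<^sup>n\<close>, for a local ring \<open>S\<close>, the identity holds exactly if \<open>n \<le> 1\<close>.\<close>

definition rank_le_one where
  "rank_le_one R M \<longleftrightarrow>
    (\<forall>\<phi>\<in>functionals R M. \<forall>x\<in>carrier M. \<forall>y\<in>carrier M. \<phi> x \<odot>\<^bsub>M\<^esub> y = \<phi> y \<odot>\<^bsub>M\<^esub> x)"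

lemma rank_le_oneD:
  "\<lbrakk>rank_le_one R M; \<phi> \<in> functionals R M; x \<in> carrier M; y \<in> carrier M\<rbrakk>
    \<Longrightarrow> \<phi> x \<odot>\<^bsub>M\<^esub> y = \<phi> y \<odot>\<^bsub>M\<^esub> x"
  unfolding rank_le_one_def by blast

lemma finsum_smult_rdistr:
  assumes M: "module R M" and v: "v \<in> carrier M" and a: "\<And>i. i \<in> I \<Longrightarrow> a i \<in> carrier R"
  shows "finsum R a I \<odot>\<^bsub>M\<^esub> v = finsum M (\<lambda>i. a i \<odot>\<^bsub>M\<^esub> v) I"
proof -
  interpret module R M by fact
  show ?thesis
  proof (cases "finite I")
    case True
    then show ?thesis using a v
      by (induction I rule: finite_induct) (simp_all add: smult_l_distr Pi_iff)
  next
    case False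
    then show ?thesis using v by (simp add: R.finsum_infinite M.finsum_infinite)
  qed
qed

text \<open>The scalar is the trace of \<open>h\<close>: \<open>h v = \<Sum> \<phi>\<^sub>i(v) h(x\<^sub>i) = \<Sum> \<phi>\<^sub>i(h(x\<^sub>i)) v\<close>.\<close>

lemma rank_le_one_endomorphism_scalar:
  assumes M: "module R M" and db: "dual_basis R M n x \<phi>" and rk: "rank_le_one R M"
    and h: "h \<in> linear_maps (carrier R) M M"
  shows "\<exists>r\<in>carrier R. \<forall>v\<in>carrier M. h v = r \<odot>\<^bsub>M\<^esub> v"
proof
  interpret module R M by fact
  note [simp] = dual_basisD(1)[OF db] functionalD[OF dual_basisD(2)[OF db]] linear_mapsD[OF h]
  let ?r = "finsum R (\<lambda>i. \<phi> i (h (x i))) {..<n}"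
  show "?r \<in> carrier R" by (auto intro!: R.finsum_closed)
  show "\<forall>v\<in>carrier M. h v = ?r \<odot>\<^bsub>M\<^esub> v"
  proof
    fix v assume v: "v \<in> carrier M"
    have "h v = h (finsum M (\<lambda>i. \<phi> i v \<odot>\<^bsub>M\<^esub> x i) {..<n})"
      using dual_basisD(3)[OF db v] by simp
    also have "\<dots> = finsum M (\<lambda>i. h (\<phi> i v \<odot>\<^bsub>M\<^esub> x i)) {..<n}"
      using v by (intro additive_finsum[OF h]) (auto simp: M.abelian_group_axioms)
    also have "\<dots> = finsum M (\<lambda>i. \<phi> i v \<odot>\<^bsub>M\<^esub> h (x i)) {..<n}"
      using v by (intro M.finsum_cong') auto
    also have "\<dots> = finsum M (\<lambda>i. \<phi> i (h (x i)) \<odot>\<^bsub>M\<^esub> v) {..<n}"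
      using v rank_le_oneD[OF rk dual_basisD(2)[OF db]] by (intro M.finsum_cong') auto
    also have "\<dots> = ?r \<odot>\<^bsub>M\<^esub> v"
      using v by (intro finsum_smult_rdistr[OF M, symmetric]) auto
    finally show "h v = ?r \<odot>\<^bsub>M\<^esub> v" .
  qed
qed

lemma rank_one_map:
  assumes M: "module R M" and \<phi>: "\<phi> \<in> functionals R M" and y: "y \<in> carrier M"
  shows "(\<lambda>v. \<phi> v \<odot>\<^bsub>M\<^esub> y) \<in> linear_maps (carrier R) M M"
proof -
  interpret module R M by fact
  show ?thesis using y
    by (intro linear_mapsI) (simp_all add: functionalD[OF \<phi>] smult_l_distr smult_assoc1)
qed

text \<open>Commuting the endomorphisms \<open>v \<mapsto> \<phi>\<^sub>i(v) y\<close> and \<open>v \<mapsto> \<psi>(v) x\<^sub>i\<close> and summing over \<open>i\<close> gives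
  \<open>\<psi>(y) v = t \<psi>(v) y\<close>, where \<open>t = \<Sum> \<phi>\<^sub>i(x\<^sub>i)\<close> is the trace of the identity. It remains to see that
  \<open>t\<close> acts as the identity on \<open>M\<close>; a priori it is only an involution. Let \<open>A\<close> be the ideal of all
  \<open>r\<close> with \<open>t r = r\<close> on \<open>M\<close>, and put \<open>a\<^sub>i = \<phi>\<^sub>i(x\<^sub>i)\<close>. Then \<open>a\<^sub>i\<^sup>2 \<in> A\<close> for every \<open>i\<close>. If \<open>r a\<^sub>i \<in> A\<close> for
  all \<open>i\<close>, then \<open>r t \<in> A\<close>, hence \<open>r \<in> A\<close> because \<open>t\<close> is invertible on \<open>M\<close>. In other words, \<open>t\<close> is
  a sum of elements that are nilpotent modulo \<open>A\<close>, and a unit modulo \<open>A\<close>, so \<open>1 \<in> A\<close>.\<close>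

lemma commuting_endomorphisms_rank_le_one:
  assumes M: "module R M" and db: "dual_basis R M n x \<phi>"
    and comm: "\<And>h k v. \<lbrakk>h \<in> linear_maps (carrier R) M M; k \<in> linear_maps (carrier R) M M; v \<in> carrier M\<rbrakk>
      \<Longrightarrow> h (k v) = k (h v)"
  shows "rank_le_one R M"
proof -
  interpret module R M by fact
  have x: "i < n \<Longrightarrow> x i \<in> carrier M" and \<phi>: "i < n \<Longrightarrow> \<phi> i \<in> functionals R M" for i
    using dual_basisD[OF db] by auto
  note [simp] = functionalD[OF \<phi>] x
  define t where "t = finsum R (\<lambda>i. \<phi> i (x i)) {..<n}"
  have t [simp]: "t \<in> carrier R" unfolding t_def by (auto intro!: R.finsum_closed)
  have swap: "\<psi> y \<odot>\<^bsub>M\<^esub> v = t \<odot>\<^bsub>M\<^esub> (\<psi> v \<odot>\<^bsub>M\<^esub> y)"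
    if \<psi>: "\<psi> \<in> functionals R M" and y: "y \<in> carrier M" and v: "v \<in> carrier M" for \<psi> y v
  proof -
    note [simp] = functionalD[OF \<psi>] y v
    have *: "\<phi> i (x i) \<odot>\<^bsub>M\<^esub> (\<psi> v \<odot>\<^bsub>M\<^esub> y) = \<psi> y \<odot>\<^bsub>M\<^esub> (\<phi> i v \<odot>\<^bsub>M\<^esub> x i)" if i: "i < n" for i
    proof -
      have "\<phi> i (\<psi> v \<odot>\<^bsub>M\<^esub> x i) \<odot>\<^bsub>M\<^esub> y = \<psi> (\<phi> i v \<odot>\<^bsub>M\<^esub> y) \<odot>\<^bsub>M\<^esub> x i"
        using comm[OF rank_one_map[OF M \<phi>[OF i] y] rank_one_map[OF M \<psi> x[OF i]] v] .
      then show ?thesis using i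
        by (simp add: smult_assoc1[symmetric] R.m_comm)
    qed
    have "t \<odot>\<^bsub>M\<^esub> (\<psi> v \<odot>\<^bsub>M\<^esub> y) = finsum M (\<lambda>i. \<phi> i (x i) \<odot>\<^bsub>M\<^esub> (\<psi> v \<odot>\<^bsub>M\<^esub> y)) {..<n}"
      unfolding t_def by (intro finsum_smult_rdistr[OF M]) auto
    also have "\<dots> = finsum M (\<lambda>i. \<psi> y \<odot>\<^bsub>M\<^esub> (\<phi> i v \<odot>\<^bsub>M\<^esub> x i)) {..<n}"
      using * by (intro M.finsum_cong') auto
    also have "\<dots> = \<psi> y \<odot>\<^bsub>M\<^esub> finsum M (\<lambda>i. \<phi> i v \<odot>\<^bsub>M\<^esub> x i) {..<n}"
      by (intro finsum_smult_ldistr[symmetric]) auto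
    finally show ?thesis using dual_basisD(3)[OF db v] by simp
  qed
  have t2: "t \<odot>\<^bsub>M\<^esub> (t \<odot>\<^bsub>M\<^esub> y) = y" if y: "y \<in> carrier M" for y
  proof -
    have "(t \<otimes>\<^bsub>R\<^esub> t) \<odot>\<^bsub>M\<^esub> (\<phi> i y \<odot>\<^bsub>M\<^esub> x i) = \<phi> i y \<odot>\<^bsub>M\<^esub> x i" if i: "i < n" for i
      using swap[OF \<phi>[OF i] y x[OF i]] swap[OF \<phi>[OF i] x[OF i] y] i y by (simp add: smult_assoc1)
    then have "finsum M (\<lambda>i. \<phi> i y \<odot>\<^bsub>M\<^esub> x i) {..<n}
        = finsum M (\<lambda>i. (t \<otimes>\<^bsub>R\<^esub> t) \<odot>\<^bsub>M\<^esub> (\<phi> i y \<odot>\<^bsub>M\<^esub> x i)) {..<n}"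
      using y by (intro M.finsum_cong') auto
    also have "\<dots> = (t \<otimes>\<^bsub>R\<^esub> t) \<odot>\<^bsub>M\<^esub> finsum M (\<lambda>i. \<phi> i y \<odot>\<^bsub>M\<^esub> x i) {..<n}"
      using y by (intro finsum_smult_ldistr[symmetric]) auto
    finally show ?thesis using dual_basisD(3)[OF db y] y by (simp add: smult_assoc1)
  qed
  define A where "A = {r \<in> carrier R. \<forall>y\<in>carrier M. t \<odot>\<^bsub>M\<^esub> (r \<odot>\<^bsub>M\<^esub> y) = r \<odot>\<^bsub>M\<^esub> y}"
  have A_mult: "r \<otimes>\<^bsub>R\<^esub> s \<in> A" if "r \<in> A" "s \<in> carrier R" for r s
    using that by (auto simp: A_def smult_assoc1)
  have square: "\<phi> i (x i) \<otimes>\<^bsub>R\<^esub> \<phi> i (x i) \<in> A" if i: "i < n" for i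
  proof -
    have fixed: "t \<odot>\<^bsub>M\<^esub> (\<phi> i (x i) \<odot>\<^bsub>M\<^esub> x i) = \<phi> i (x i) \<odot>\<^bsub>M\<^esub> x i"
      using swap[OF \<phi>[OF i] x[OF i] x[OF i]] by simp
    have "t \<odot>\<^bsub>M\<^esub> (\<phi> i (x i) \<odot>\<^bsub>M\<^esub> (\<phi> i (x i) \<odot>\<^bsub>M\<^esub> y)) = \<phi> i (x i) \<odot>\<^bsub>M\<^esub> (\<phi> i (x i) \<odot>\<^bsub>M\<^esub> y)"
      if y: "y \<in> carrier M" for y
    proof -
      have "\<phi> i (x i) \<odot>\<^bsub>M\<^esub> (\<phi> i (x i) \<odot>\<^bsub>M\<^esub> y) = (t \<otimes>\<^bsub>R\<^esub> \<phi> i y) \<odot>\<^bsub>M\<^esub> (\<phi> i (x i) \<odot>\<^bsub>M\<^esub> x i)"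
        using swap[OF \<phi>[OF i] x[OF i] y] i y by (simp add: smult_assoc1[symmetric] R.m_ac)
      moreover have "t \<odot>\<^bsub>M\<^esub> ((t \<otimes>\<^bsub>R\<^esub> \<phi> i y) \<odot>\<^bsub>M\<^esub> (\<phi> i (x i) \<odot>\<^bsub>M\<^esub> x i))
          = (t \<otimes>\<^bsub>R\<^esub> \<phi> i y) \<odot>\<^bsub>M\<^esub> (t \<odot>\<^bsub>M\<^esub> (\<phi> i (x i) \<odot>\<^bsub>M\<^esub> x i))"
        using i y by (simp add: smult_assoc1[symmetric] R.m_ac)
      ultimately show ?thesis using fixed by simp
    qed
    then show ?thesis using i by (simp add: A_def smult_assoc1)
  qed
  \<comment> \<open>Downward induction on the number of products \<open>r a\<^sub>i\<close> required to lie in \<open>A\<close>: the step applies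
    the hypothesis to \<open>r a\<^sub>k\<close>, whose product with \<open>a\<^sub>k\<close> is covered by \<open>square\<close>, and then to \<open>r\<close>.\<close>
  have "k \<le> n \<Longrightarrow> \<forall>r\<in>carrier R. (\<forall>i<k. r \<otimes>\<^bsub>R\<^esub> \<phi> i (x i) \<in> A) \<longrightarrow> r \<in> A" for k
  proof (induction k rule: inc_induct)
    case base
    show ?case
    proof (intro ballI impI)
      fix r assume r: "r \<in> carrier R" and rA: "\<forall>i<n. r \<otimes>\<^bsub>R\<^esub> \<phi> i (x i) \<in> A"
      have *: "t \<odot>\<^bsub>M\<^esub> (r \<odot>\<^bsub>M\<^esub> (t \<odot>\<^bsub>M\<^esub> y)) = r \<odot>\<^bsub>M\<^esub> (t \<odot>\<^bsub>M\<^esub> y)" if y: "y \<in> carrier M" for y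
      proof -
        have rt: "r \<odot>\<^bsub>M\<^esub> (t \<odot>\<^bsub>M\<^esub> y) = finsum M (\<lambda>i. r \<odot>\<^bsub>M\<^esub> (\<phi> i (x i) \<odot>\<^bsub>M\<^esub> y)) {..<n}"
        proof -
          have "t \<odot>\<^bsub>M\<^esub> y = finsum M (\<lambda>i. \<phi> i (x i) \<odot>\<^bsub>M\<^esub> y) {..<n}"
            unfolding t_def using y by (intro finsum_smult_rdistr[OF M]) auto
          then show ?thesis using y r by (simp add: finsum_smult_ldistr Pi_iff)
        qed
        have "t \<odot>\<^bsub>M\<^esub> (r \<odot>\<^bsub>M\<^esub> (t \<odot>\<^bsub>M\<^esub> y))
            = finsum M (\<lambda>i. t \<odot>\<^bsub>M\<^esub> (r \<odot>\<^bsub>M\<^esub> (\<phi> i (x i) \<odot>\<^bsub>M\<^esub> y))) {..<n}"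
          unfolding rt using y r by (intro finsum_smult_ldistr) auto
        also have "\<dots> = finsum M (\<lambda>i. r \<odot>\<^bsub>M\<^esub> (\<phi> i (x i) \<odot>\<^bsub>M\<^esub> y)) {..<n}"
          using y r rA by (intro M.finsum_cong') (auto simp: A_def smult_assoc1)
        finally show ?thesis by (simp add: rt)
      qed
      have "t \<odot>\<^bsub>M\<^esub> (r \<odot>\<^bsub>M\<^esub> y) = r \<odot>\<^bsub>M\<^esub> y" if y: "y \<in> carrier M" for y
        using *[of "t \<odot>\<^bsub>M\<^esub> y"] y t2 by simp
      with r show "r \<in> A" by (simp add: A_def)
    qed
  next
    case (step k)
    show ?case
    proof (intro ballI impI)
      fix r assume r: "r \<in> carrier R" and rA: "\<forall>i<k. r \<otimes>\<^bsub>R\<^esub> \<phi> i (x i) \<in> A"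
      have k: "\<phi> k (x k) \<in> carrier R" using step.hyps by simp
      have "r \<otimes>\<^bsub>R\<^esub> \<phi> k (x k) \<otimes>\<^bsub>R\<^esub> \<phi> i (x i) \<in> A" if "i < Suc k" for i
      proof (cases "i = k")
        case True
        then show ?thesis
          using A_mult[OF square[of k] r] step.hyps k r by (simp add: R.m_ac)
      next
        case False
        with that step.hyps have "i < k" "i < n" by auto
        then show ?thesis
          using A_mult[of "r \<otimes>\<^bsub>R\<^esub> \<phi> i (x i)" "\<phi> k (x k)"] rA k r by (simp add: R.m_ac)
      qed
      then have "r \<otimes>\<^bsub>R\<^esub> \<phi> k (x k) \<in> A" using step.IH r k by simp
      then show "r \<in> A" using step.IH r rA by (simp add: less_Suc_eq)
    qed
  qed
  from this[of 0] have "\<one>\<^bsub>R\<^esub> \<in> A" by auto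
  then have "t \<odot>\<^bsub>M\<^esub> y = y" if "y \<in> carrier M" for y using that by (auto simp: A_def)
  then show ?thesis
    unfolding rank_le_one_def using swap functionalD(1) by (metis smult_closed)
qed

text \<open>Any algebra map from \<open>R\<close> onto the endomorphisms makes them commute. Conversely the homotheties
  \<open>x \<mapsto> r x\<close> form such a map, since every endomorphism is a scalar.\<close>

lemma picS_bimodule_iff:
  assumes R: "cring R" and K: "K \<subseteq> carrier R"
  shows "picS_bimodule R K P \<longleftrightarrow>
    bimodule R P \<and> central_over K P \<and> fg_projective R P \<and> rank_le_one R P"
proof
  let ?E = "End_algebra (carrier R) P"
  assume pic: "picS_bimodule R K P"
  then have P: "bimodule R P" and c: "central_over K P" and fg: "fg_projective R P"
    by (auto simp: picS_bimodule_def)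
  interpret bimodule R P by fact
  from fg obtain n x \<phi> where db: "dual_basis R P n x \<phi>"
    using fg_projective_iff_dual_basis[OF bimodule_imp_module[OF P]] by blast
  from pic obtain \<theta> where \<theta>: "\<theta> \<in> ring_hom (op_algebra R) ?E" and onto: "\<theta> ` carrier R = carrier ?E"
    by (auto simp: picS_bimodule_def algebra_hom_def)
  have "h (k v) = k (h v)" if h: "h \<in> linear_maps (carrier R) P P"
    and k: "k \<in> linear_maps (carrier R) P P" and v: "v \<in> carrier P" for h k v
  proof -
    have res: "restrict f (carrier P) \<in> carrier ?E" if "f \<in> linear_maps (carrier R) P P" for f
      using that by (auto simp: End_algebra_def linear_maps_def)
    obtain a where a: "a \<in> carrier R" "restrict h (carrier P) = \<theta> a"
      using res[OF h] onto by (metis imageE)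
    obtain b where b: "b \<in> carrier R" "restrict k (carrier P) = \<theta> b"
      using res[OF k] onto by (metis imageE)
    have prod: "\<theta> (r \<otimes>\<^bsub>R\<^esub> s) = compose (carrier P) (\<theta> s) (\<theta> r)"
      if "r \<in> carrier R" "s \<in> carrier R" for r s
      using ring_hom_mult[OF \<theta>, of s r] that by (simp add: op_algebra_def End_algebra_def)
    have "compose (carrier P) (\<theta> a) (\<theta> b) = compose (carrier P) (\<theta> b) (\<theta> a)"
      using prod a b R.m_comm by metis
    from fun_cong[OF this, of v] show ?thesis
      using v linear_mapsD(1)[OF h v] linear_mapsD(1)[OF k v] by (simp add: compose_def flip: a(2) b(2))
  qed
  then have "rank_le_one R P"
    using commuting_endomorphisms_rank_le_one[OF bimodule_imp_module[OF P] db] by blast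
  with P c fg show "bimodule R P \<and> central_over K P \<and> fg_projective R P \<and> rank_le_one R P" by blast
next
  let ?E = "End_algebra (carrier R) P"
  assume *: "bimodule R P \<and> central_over K P \<and> fg_projective R P \<and> rank_le_one R P"
  then interpret bimodule R P by blast
  from * obtain n x \<phi> where db: "dual_basis R P n x \<phi>"
    using fg_projective_iff_dual_basis[OF bimodule_imp_module] by blast
  define \<theta> where "\<theta> = (\<lambda>r. \<lambda>v\<in>carrier P. r \<odot>\<^bsub>P\<^esub> v)"
  have \<theta>_in: "\<theta> r \<in> carrier ?E" if "r \<in> carrier R" for r
    using that
    by (auto simp: \<theta>_def End_algebra_def linear_maps_def smult_r_distr smult_assoc1[symmetric] R.m_comm)
  have "\<theta> \<in> algebra_hom K (op_algebra R) ?E"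
    using \<theta>_in K
    by (auto simp: algebra_hom_def ring_hom_def op_algebra_def End_algebra_def \<theta>_def fun_eq_iff
        compose_def restrict_def smult_l_distr smult_assoc1[symmetric] R.m_comm)
  moreover have "carrier ?E \<subseteq> \<theta> ` carrier R"
  proof
    fix h assume h: "h \<in> carrier ?E"
    then have "h \<in> linear_maps (carrier R) P P" by (simp add: End_algebra_def)
    then obtain r where "r \<in> carrier R" "\<forall>v\<in>carrier P. h v = r \<odot>\<^bsub>P\<^esub> v"
      using rank_le_one_endomorphism_scalar[OF _ db] * bimodule_imp_module by blast
    then have "h = \<theta> r" using h by (auto simp: \<theta>_def End_algebra_def extensional_def fun_eq_iff)
    then show "h \<in> \<theta> ` carrier R" using \<open>r \<in> carrier R\<close> by blast
  qed
  ultimately show "picS_bimodule R K P"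
    using * \<theta>_in unfolding picS_bimodule_def by blast
qed

section \<open>Tensor products characterised by contractions\<close>

text \<open>For finitely generated projective \<open>Q\<close> this is the universal property of \<open>P \<otimes> Q\<close>, in a form that
  does not quantify over target groups of arbitrary type: with a dual basis \<open>y, \<psi>\<close> of \<open>Q\<close> and
  contractions \<open>c\<^sub>j (p \<otimes> q) = p \<psi>\<^sub>j(q)\<close>, each element is \<open>t = \<Sum> c\<^sub>j(t) \<otimes> y\<^sub>j\<close>, so \<open>t\<close> is determined by its
  contractions. That the pure tensors span is expressed as an induction principle over additive
  submonoids; negatives are covered by \<open>- (p \<otimes> q) = (- p) \<otimes> q\<close>.\<close>

locale tensor_product = P: bimodule R P + Q: bimodule R Q + T: bimodule R T
  for R :: "('a, 'r) ring_scheme" and P :: "('a, 'b, 'm) bimodule_scheme"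
    and Q :: "('a, 'c, 'n) bimodule_scheme" and T :: "('a, 'd, 'k) bimodule_scheme"
    and b :: "'b \<Rightarrow> 'c \<Rightarrow> 'd" +
  assumes pure_closed: "\<lbrakk>p \<in> carrier P; q \<in> carrier Q\<rbrakk> \<Longrightarrow> b p q \<in> carrier T"
    and pure_add_left: "\<lbrakk>p \<in> carrier P; p' \<in> carrier P; q \<in> carrier Q\<rbrakk>
      \<Longrightarrow> b (p \<oplus>\<^bsub>P\<^esub> p') q = b p q \<oplus>\<^bsub>T\<^esub> b p' q"
    and pure_add_right: "\<lbrakk>p \<in> carrier P; q \<in> carrier Q; q' \<in> carrier Q\<rbrakk>
      \<Longrightarrow> b p (q \<oplus>\<^bsub>Q\<^esub> q') = b p q \<oplus>\<^bsub>T\<^esub> b p q'"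
    and pure_balanced: "\<lbrakk>p \<in> carrier P; r \<in> carrier R; q \<in> carrier Q\<rbrakk>
      \<Longrightarrow> b (p \<triangleleft>\<^bsub>P\<^esub> r) q = b p (r \<odot>\<^bsub>Q\<^esub> q)"
    and pure_lact: "\<lbrakk>r \<in> carrier R; p \<in> carrier P; q \<in> carrier Q\<rbrakk>
      \<Longrightarrow> b (r \<odot>\<^bsub>P\<^esub> p) q = r \<odot>\<^bsub>T\<^esub> b p q"
    and pure_ract: "\<lbrakk>p \<in> carrier P; q \<in> carrier Q; r \<in> carrier R\<rbrakk>
      \<Longrightarrow> b p (q \<triangleleft>\<^bsub>Q\<^esub> r) = b p q \<triangleleft>\<^bsub>T\<^esub> r"
    and pure_span: "\<lbrakk>\<zero>\<^bsub>T\<^esub> \<in> H; \<And>s t. \<lbrakk>s \<in> H; t \<in> H\<rbrakk> \<Longrightarrow> s \<oplus>\<^bsub>T\<^esub> t \<in> H;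
      \<And>p q. \<lbrakk>p \<in> carrier P; q \<in> carrier Q\<rbrakk> \<Longrightarrow> b p q \<in> H\<rbrakk> \<Longrightarrow> carrier T \<subseteq> H"
    and contraction: "\<psi> \<in> functionals R Q
      \<Longrightarrow> \<exists>c\<in>linear_maps {} T P. \<forall>p\<in>carrier P. \<forall>q\<in>carrier Q. c (b p q) = p \<triangleleft>\<^bsub>P\<^esub> \<psi> q"
begin

lemma tensor_induct [consumes 1, case_names zero add pure]:
  assumes t: "t \<in> carrier T"
    and "\<Psi> \<zero>\<^bsub>T\<^esub>"
    and "\<And>s t. \<lbrakk>s \<in> carrier T; t \<in> carrier T; \<Psi> s; \<Psi> t\<rbrakk> \<Longrightarrow> \<Psi> (s \<oplus>\<^bsub>T\<^esub> t)"
    and "\<And>p q. \<lbrakk>p \<in> carrier P; q \<in> carrier Q\<rbrakk> \<Longrightarrow> \<Psi> (b p q)"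
  shows "\<Psi> t"
proof -
  have "carrier T \<subseteq> {t \<in> carrier T. \<Psi> t}"
    using assms by (intro pure_span) (auto simp: pure_closed)
  then show ?thesis using t by blast
qed

lemma additive_eqI:
  assumes A: "abelian_group A" and h: "h \<in> linear_maps S T A" and k: "k \<in> linear_maps S' T A"
    and eq: "\<And>p q. \<lbrakk>p \<in> carrier P; q \<in> carrier Q\<rbrakk> \<Longrightarrow> h (b p q) = k (b p q)"
    and t: "t \<in> carrier T"
  shows "h t = k t"
  using t
  by (induction rule: tensor_induct)
    (simp_all add: eq linear_mapsD[OF h] linear_mapsD[OF k] A
      additive_zero[OF h T.abelian_group_axioms A] additive_zero[OF k T.abelian_group_axioms A])

lemma pure_left_linear: "q \<in> carrier Q \<Longrightarrow> (\<lambda>p. b p q) \<in> linear_maps (carrier R) P T"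
  by (intro linear_mapsI) (auto simp: pure_closed pure_add_left pure_lact)

lemma pure_right_additive: "p \<in> carrier P \<Longrightarrow> b p \<in> linear_maps {} Q T"
  by (intro linear_mapsI) (auto simp: pure_closed pure_add_right)

lemma contraction_linear:
  assumes \<psi>: "\<psi> \<in> functionals R Q" and c: "c \<in> linear_maps {} T P"
    and cb: "\<And>p q. \<lbrakk>p \<in> carrier P; q \<in> carrier Q\<rbrakk> \<Longrightarrow> c (b p q) = p \<triangleleft>\<^bsub>P\<^esub> \<psi> q"
  shows "c \<in> linear_maps (carrier R) T P"
proof (intro linear_mapsI)
  fix r t assume r: "r \<in> carrier R" and t: "t \<in> carrier T"
  show "c (r \<odot>\<^bsub>T\<^esub> t) = r \<odot>\<^bsub>P\<^esub> c t"
  proof (rule additive_eqI[OF P.abelian_group_axioms _ _ _ t])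
    show "(\<lambda>t. c (r \<odot>\<^bsub>T\<^esub> t)) \<in> linear_maps {} T P" "(\<lambda>t. r \<odot>\<^bsub>P\<^esub> c t) \<in> linear_maps {} T P"
      using r by (auto intro!: linear_mapsI simp: linear_mapsD[OF c] T.smult_r_distr P.smult_r_distr)
    fix p q assume pq: "p \<in> carrier P" "q \<in> carrier Q"
    then have "c (r \<odot>\<^bsub>T\<^esub> b p q) = (r \<odot>\<^bsub>P\<^esub> p) \<triangleleft>\<^bsub>P\<^esub> \<psi> q"
      using r by (simp add: cb flip: pure_lact)
    then show "c (r \<odot>\<^bsub>T\<^esub> b p q) = r \<odot>\<^bsub>P\<^esub> c (b p q)"
      using pq r by (simp add: cb P.lact_ract functionalD[OF \<psi>])
  qed
qed (auto simp: linear_mapsD[OF c])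

definition contract where
  "contract \<psi> = (SOME c. c \<in> linear_maps {} T P \<and>
    (\<forall>p\<in>carrier P. \<forall>q\<in>carrier Q. c (b p q) = p \<triangleleft>\<^bsub>P\<^esub> \<psi> q))"

lemma contract:
  assumes \<psi>: "\<psi> \<in> functionals R Q"
  shows "contract \<psi> \<in> linear_maps (carrier R) T P"
    and "\<lbrakk>p \<in> carrier P; q \<in> carrier Q\<rbrakk> \<Longrightarrow> contract \<psi> (b p q) = p \<triangleleft>\<^bsub>P\<^esub> \<psi> q"
proof -
  have "\<exists>c. c \<in> linear_maps {} T P \<and> (\<forall>p\<in>carrier P. \<forall>q\<in>carrier Q. c (b p q) = p \<triangleleft>\<^bsub>P\<^esub> \<psi> q)"
    using contraction[OF \<psi>] by blast
  from someI_ex[OF this] have c: "contract \<psi> \<in> linear_maps {} T P"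
    and cb: "\<And>p q. \<lbrakk>p \<in> carrier P; q \<in> carrier Q\<rbrakk> \<Longrightarrow> contract \<psi> (b p q) = p \<triangleleft>\<^bsub>P\<^esub> \<psi> q"
    unfolding contract_def by blast+
  show "contract \<psi> \<in> linear_maps (carrier R) T P" using contraction_linear[OF \<psi> c cb] .
  show "\<lbrakk>p \<in> carrier P; q \<in> carrier Q\<rbrakk> \<Longrightarrow> contract \<psi> (b p q) = p \<triangleleft>\<^bsub>P\<^esub> \<psi> q" by (rule cb)
qed

text \<open>The coordinates of \<open>q\<close> are carried over to \<open>p\<close>.\<close>

lemma biadditive_expansion:
  assumes db: "dual_basis R Q n y \<psi>" and A: "abelian_group A"
    and g: "\<And>p. p \<in> carrier P \<Longrightarrow> g p \<in> linear_maps {} Q A"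
    and bal: "\<And>p r q. \<lbrakk>p \<in> carrier P; r \<in> carrier R; q \<in> carrier Q\<rbrakk> \<Longrightarrow> g (p \<triangleleft>\<^bsub>P\<^esub> r) q = g p (r \<odot>\<^bsub>Q\<^esub> q)"
    and p: "p \<in> carrier P" and q: "q \<in> carrier Q"
  shows "finsum A (\<lambda>j. g (p \<triangleleft>\<^bsub>P\<^esub> \<psi> j q) (y j)) {..<n} = g p q"
proof -
  interpret A: abelian_group A by fact
  note [simp] = dual_basisD(1)[OF db] functionalD[OF dual_basisD(2)[OF db]]
  have "finsum A (\<lambda>j. g (p \<triangleleft>\<^bsub>P\<^esub> \<psi> j q) (y j)) {..<n} = finsum A (\<lambda>j. g p (\<psi> j q \<odot>\<^bsub>Q\<^esub> y j)) {..<n}"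
    using p q by (intro A.finsum_cong') (auto simp: bal linear_mapsD[OF g])
  also have "\<dots> = g p (finsum Q (\<lambda>j. \<psi> j q \<odot>\<^bsub>Q\<^esub> y j) {..<n})"
    using p q by (intro additive_finsum[OF g, symmetric]) (auto simp: A Q.abelian_group_axioms)
  finally show ?thesis using dual_basisD(3)[OF db q] by simp
qed

text \<open>The lift is \<open>t \<mapsto> \<Sum> g (c\<^sub>j t) y\<^sub>j\<close>.\<close>

lemma tensor_lift:
  assumes db: "dual_basis R Q n y \<psi>" and A: "abelian_group A"
    and g1: "\<And>p. p \<in> carrier P \<Longrightarrow> g p \<in> linear_maps {} Q A"
    and g2: "\<And>q. q \<in> carrier Q \<Longrightarrow> (\<lambda>p. g p q) \<in> linear_maps {} P A"
    and bal: "\<And>p r q. \<lbrakk>p \<in> carrier P; r \<in> carrier R; q \<in> carrier Q\<rbrakk> \<Longrightarrow> g (p \<triangleleft>\<^bsub>P\<^esub> r) q = g p (r \<odot>\<^bsub>Q\<^esub> q)"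
  shows "\<exists>h\<in>linear_maps {} T A. \<forall>p\<in>carrier P. \<forall>q\<in>carrier Q. h (b p q) = g p q"
proof
  interpret A: abelian_group A by fact
  note c = contract[OF dual_basisD(2)[OF db]]
  let ?h = "\<lambda>t. finsum A (\<lambda>j. g (contract (\<psi> j) t) (y j)) {..<n}"
  show "?h \<in> linear_maps {} T A"
    using dual_basisD(1)[OF db] linear_maps_comp[OF linear_maps_additive[OF c(1)] g2]
    by (intro finsum_additive[OF A]) auto
  have "?h (b p q) = g p q" if p: "p \<in> carrier P" and q: "q \<in> carrier Q" for p q
  proof -
    have "?h (b p q) = finsum A (\<lambda>j. g (p \<triangleleft>\<^bsub>P\<^esub> \<psi> j q) (y j)) {..<n}"
      using p q dual_basisD(1)[OF db]
      by (intro A.finsum_cong')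
        (auto simp: c P.ract_closed linear_mapsD(1)[OF g1] functionalD[OF dual_basisD(2)[OF db]])
    then show ?thesis using biadditive_expansion[OF db A g1 bal p q] by simp
  qed
  then show "\<forall>p\<in>carrier P. \<forall>q\<in>carrier Q. ?h (b p q) = g p q" by blast
qed

lemma tensor_expansion:
  assumes db: "dual_basis R Q n y \<psi>" and t: "t \<in> carrier T"
  shows "finsum T (\<lambda>j. b (contract (\<psi> j) t) (y j)) {..<n} = t"
proof (rule additive_eqI[OF T.abelian_group_axioms _ _ _ t])
  note c = contract[OF dual_basisD(2)[OF db]]
  show "(\<lambda>t. finsum T (\<lambda>j. b (contract (\<psi> j) t) (y j)) {..<n}) \<in> linear_maps {} T T"
    using dual_basisD(1)[OF db]
      linear_maps_comp[OF linear_maps_additive[OF c(1)] linear_maps_additive[OF pure_left_linear]]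
    by (intro finsum_additive[OF T.abelian_group_axioms]) auto
  show "(\<lambda>t. t) \<in> linear_maps {} T T" by (intro linear_mapsI) auto
  fix p q assume p: "p \<in> carrier P" and q: "q \<in> carrier Q"
  have "finsum T (\<lambda>j. b (contract (\<psi> j) (b p q)) (y j)) {..<n}
      = finsum T (\<lambda>j. b (p \<triangleleft>\<^bsub>P\<^esub> \<psi> j q) (y j)) {..<n}"
    using p q dual_basisD(1)[OF db]
    by (intro T.finsum_cong') (auto simp: c pure_closed P.ract_closed functionalD[OF dual_basisD(2)[OF db]])
  then show "finsum T (\<lambda>j. b (contract (\<psi> j) (b p q)) (y j)) {..<n} = b p q"
    using biadditive_expansion[OF db T.abelian_group_axioms pure_right_additive pure_balanced p q]
    by simp
qed

lemma central_tensor: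
  assumes K: "K \<subseteq> carrier R" and "central_over K P" "central_over K Q"
  shows "central_over K T"
  unfolding central_over_def
proof (intro ballI)
  fix k t assume k: "k \<in> K" and t: "t \<in> carrier T"
  then have kR: "k \<in> carrier R" using K by blast
  from t show "k \<odot>\<^bsub>T\<^esub> t = t \<triangleleft>\<^bsub>T\<^esub> k"
  proof (rule additive_eqI[OF T.abelian_group_axioms, rotated 3])
    show "(\<lambda>t. k \<odot>\<^bsub>T\<^esub> t) \<in> linear_maps {} T T" "(\<lambda>t. t \<triangleleft>\<^bsub>T\<^esub> k) \<in> linear_maps {} T T"
      using kR by (auto intro!: linear_mapsI simp: T.smult_r_distr T.ract_closed T.ract_add)
    fix p q assume p: "p \<in> carrier P" and q: "q \<in> carrier Q"
    have "k \<odot>\<^bsub>T\<^esub> b p q = b (p \<triangleleft>\<^bsub>P\<^esub> k) q"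
      using assms k kR p q by (simp add: central_over_def flip: pure_lact)
    also have "\<dots> = b p (q \<triangleleft>\<^bsub>Q\<^esub> k)"
      using assms k kR p q by (simp add: central_over_def pure_balanced)
    finally show "k \<odot>\<^bsub>T\<^esub> b p q = b p q \<triangleleft>\<^bsub>T\<^esub> k" using kR p q by (simp add: pure_ract)
  qed
qed

lemma functional_pure: "\<lbrakk>\<chi> \<in> functionals R T; q \<in> carrier Q\<rbrakk> \<Longrightarrow> (\<lambda>p. \<chi> (b p q)) \<in> functionals R P"
  using linear_maps_comp[OF pure_left_linear] by blast

text \<open>For fixed \<open>q\<close> the map \<open>p \<mapsto> \<chi>(p \<otimes> q)\<close> is a functional on \<open>P\<close>, so two first factors can be
  exchanged. The map \<open>q \<mapsto> \<chi>(p \<otimes> q)\<close> is not left linear; but expanding \<open>q\<close> in a dual basis, moving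
  its coordinates to the first factor and exchanging first factors reduces the exchange of second
  factors to the identities for the coordinate functionals of \<open>Q\<close>.\<close>

lemma rank_le_one_tensor:
  assumes db: "dual_basis R Q n y \<psi>" and P1: "rank_le_one R P" and Q1: "rank_le_one R Q"
  shows "rank_le_one R T"
  unfolding rank_le_one_def
proof (intro ballI)
  fix \<chi> s t assume \<chi>: "\<chi> \<in> functionals R T" and s: "s \<in> carrier T" and t: "t \<in> carrier T"
  note [simp] = functionalD[OF \<chi>] dual_basisD(1)[OF db] functionalD[OF dual_basisD(2)[OF db]]
    pure_closed P.ract_closed
  have first: "\<chi> (b p q) \<odot>\<^bsub>T\<^esub> b p' q' = \<chi> (b p' q) \<odot>\<^bsub>T\<^esub> b p q'"
    if "p \<in> carrier P" "p' \<in> carrier P" "q \<in> carrier Q" "q' \<in> carrier Q" for p p' q q'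
  proof -
    have "b (\<chi> (b p q) \<odot>\<^bsub>P\<^esub> p') q' = b (\<chi> (b p' q) \<odot>\<^bsub>P\<^esub> p) q'"
      using rank_le_oneD[OF P1 functional_pure[OF \<chi>]] that by simp
    then show ?thesis using that by (simp add: pure_lact)
  qed
  have expand: "\<chi> (b p' q) \<odot>\<^bsub>T\<^esub> b p q'
      = finsum T (\<lambda>j. \<chi> (b p (y j)) \<odot>\<^bsub>T\<^esub> b p' (\<psi> j q \<odot>\<^bsub>Q\<^esub> q')) {..<n}"
    if pq: "p \<in> carrier P" "p' \<in> carrier P" "q \<in> carrier Q" "q' \<in> carrier Q" for p p' q q'
  proof -
    have lin: "(\<lambda>t. \<chi> t \<odot>\<^bsub>T\<^esub> b p q') \<in> linear_maps {} T T"
      using pq by (intro linear_mapsI) (auto simp: T.smult_l_distr)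
    have "\<chi> (b p' q) \<odot>\<^bsub>T\<^esub> b p q' = finsum T (\<lambda>j. \<chi> (b (p' \<triangleleft>\<^bsub>P\<^esub> \<psi> j q) (y j)) \<odot>\<^bsub>T\<^esub> b p q') {..<n}"
      using pq
      by (subst biadditive_expansion[OF db T.abelian_group_axioms pure_right_additive pure_balanced, symmetric, of p' q])
        (auto intro!: additive_finsum[OF lin] simp: T.abelian_group_axioms)
    also have "\<dots> = finsum T (\<lambda>j. \<chi> (b p (y j)) \<odot>\<^bsub>T\<^esub> b p' (\<psi> j q \<odot>\<^bsub>Q\<^esub> q')) {..<n}"
    proof (intro T.finsum_cong')
      fix j assume "j \<in> {..<n}"
      then show "\<chi> (b (p' \<triangleleft>\<^bsub>P\<^esub> \<psi> j q) (y j)) \<odot>\<^bsub>T\<^esub> b p q'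
          = \<chi> (b p (y j)) \<odot>\<^bsub>T\<^esub> b p' (\<psi> j q \<odot>\<^bsub>Q\<^esub> q')"
        using pq first[of "p' \<triangleleft>\<^bsub>P\<^esub> \<psi> j q" p "y j" q'] pure_balanced[of p' "\<psi> j q" q'] by simp
    qed (use pq in auto)
    finally show ?thesis .
  qed
  have pure: "\<chi> (b p q) \<odot>\<^bsub>T\<^esub> b p' q' = \<chi> (b p' q') \<odot>\<^bsub>T\<^esub> b p q"
    if pq: "p \<in> carrier P" "p' \<in> carrier P" "q \<in> carrier Q" "q' \<in> carrier Q" for p p' q q'
  proof -
    have "finsum T (\<lambda>j. \<chi> (b p (y j)) \<odot>\<^bsub>T\<^esub> b p' (\<psi> j q \<odot>\<^bsub>Q\<^esub> q')) {..<n}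
        = finsum T (\<lambda>j. \<chi> (b p (y j)) \<odot>\<^bsub>T\<^esub> b p' (\<psi> j q' \<odot>\<^bsub>Q\<^esub> q)) {..<n}"
      using pq rank_le_oneD[OF Q1 dual_basisD(2)[OF db]] by (intro T.finsum_cong') auto
    then show ?thesis
      using expand[of p p' q q'] expand[of p p' q' q] first[of p p' q q'] pq by simp
  qed
  have left: "(\<lambda>t. \<chi> s \<odot>\<^bsub>T\<^esub> t) \<in> linear_maps {} T T" if "s \<in> carrier T" for s
    using that by (intro linear_mapsI) (auto simp: T.smult_r_distr)
  have right: "(\<lambda>t. \<chi> t \<odot>\<^bsub>T\<^esub> s) \<in> linear_maps {} T T" if "s \<in> carrier T" for s
    using that by (intro linear_mapsI) (auto simp: T.smult_l_distr)
  have "\<chi> (b p q) \<odot>\<^bsub>T\<^esub> t = \<chi> t \<odot>\<^bsub>T\<^esub> b p q" if "p \<in> carrier P" "q \<in> carrier Q" "t \<in> carrier T" for p q t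
    using that pure
    by (intro additive_eqI[OF T.abelian_group_axioms left[of "b p q"] right[of "b p q"] _ that(3)]) simp_all
  then show "\<chi> s \<odot>\<^bsub>T\<^esub> t = \<chi> t \<odot>\<^bsub>T\<^esub> s"
    using t by (intro additive_eqI[OF T.abelian_group_axioms right[OF t] left[OF t] _ s]) simp
qed

end

lemma finsum_Times:
  assumes A: "abelian_group A" and "finite I" "finite J"
    and f: "\<And>i j. \<lbrakk>i \<in> I; j \<in> J\<rbrakk> \<Longrightarrow> f (i, j) \<in> carrier A"
  shows "finsum A f (I \<times> J) = finsum A (\<lambda>i. finsum A (\<lambda>j. f (i, j)) J) I"
proof -
  interpret A: abelian_group A by fact
  show ?thesis using \<open>finite I\<close> f
  proof (induction I rule: finite_induct)
    case (insert i I)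
    have "finsum A f (insert i I \<times> J) = finsum A f ({i} \<times> J \<union> I \<times> J)"
      by (rule arg_cong[of _ _ "finsum A f"]) auto
    also have "\<dots> = finsum A f ({i} \<times> J) \<oplus>\<^bsub>A\<^esub> finsum A f (I \<times> J)"
      using insert \<open>finite J\<close> by (intro A.finsum_Un_disjoint) auto
    also have "finsum A f ({i} \<times> J) = finsum A f (Pair i ` J)"
      by (rule arg_cong[of _ _ "finsum A f"]) auto
    also have "\<dots> = finsum A (\<lambda>j. f (i, j)) J"
      using insert by (intro A.finsum_reindex) (auto simp: inj_on_def)
    finally show ?case
      using insert by (simp add: A.finsum_insert Pi_iff A.finsum_closed)
  qed simp
qed

lemma dual_basis_family:
  assumes M: "module R M" and I: "finite I"
    and x: "\<And>i. i \<in> I \<Longrightarrow> x i \<in> carrier M" and \<phi>: "\<And>i. i \<in> I \<Longrightarrow> \<phi> i \<in> functionals R M"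
    and sum: "\<And>v. v \<in> carrier M \<Longrightarrow> finsum M (\<lambda>i. \<phi> i v \<odot>\<^bsub>M\<^esub> x i) I = v"
  shows "fg_projective R M"
proof -
  interpret module R M by fact
  obtain \<sigma> where \<sigma>: "bij_betw \<sigma> {..<card I} I"
    using ex_bij_betw_nat_finite[OF I] by (auto simp: atLeast0LessThan)
  then have \<sigma>I: "i < card I \<Longrightarrow> \<sigma> i \<in> I" for i by (auto simp: bij_betw_def)
  have "dual_basis R M (card I) (\<lambda>i. x (\<sigma> i)) (\<lambda>i. \<phi> (\<sigma> i))"
    unfolding dual_basis_def
  proof (intro conjI allI impI ballI)
    fix v assume v: "v \<in> carrier M"
    have "finsum M (\<lambda>i. \<phi> i v \<odot>\<^bsub>M\<^esub> x i) (\<sigma> ` {..<card I})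
        = finsum M (\<lambda>i. \<phi> (\<sigma> i) v \<odot>\<^bsub>M\<^esub> x (\<sigma> i)) {..<card I}"
      using \<sigma> v x functionalD(1)[OF \<phi>] by (intro M.finsum_reindex) (auto simp: bij_betw_def)
    then show "v = finsum M (\<lambda>i. \<phi> (\<sigma> i) v \<odot>\<^bsub>M\<^esub> x (\<sigma> i)) {..<card I}"
      using sum[OF v] \<sigma> by (simp add: bij_betw_def)
  qed (auto simp: \<sigma>I x \<phi>)
  then show ?thesis using fg_projective_iff_dual_basis[OF M] by blast
qed

text \<open>A dual basis consists of the \<open>x\<^sub>i \<otimes> y\<^sub>j\<close> and the functionals \<open>t \<mapsto> \<phi>\<^sub>i(c\<^sub>j(t))\<close>.\<close>

lemma (in tensor_product) fg_projective_tensor: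
  assumes P1: "fg_projective R P" and Q1: "fg_projective R Q"
  shows "fg_projective R T"
proof -
  obtain m x \<phi> where dbP: "dual_basis R P m x \<phi>"
    using P1 fg_projective_iff_dual_basis[OF P.module_axioms] by blast
  obtain n y \<psi> where dbQ: "dual_basis R Q n y \<psi>"
    using Q1 fg_projective_iff_dual_basis[OF Q.module_axioms] by blast
  note [simp] = dual_basisD(1)[OF dbP] functionalD[OF dual_basisD(2)[OF dbP]]
    dual_basisD(1)[OF dbQ] pure_closed
  note c = contract[OF dual_basisD(2)[OF dbQ]]
  have c_in [simp]: "j < n \<Longrightarrow> t \<in> carrier T \<Longrightarrow> contract (\<psi> j) t \<in> carrier P" for j t
    using linear_mapsD(1)[OF c(1)] .
  let ?\<phi> = "\<lambda>(j, i) t. \<phi> i (contract (\<psi> j) t)" and ?x = "\<lambda>(j, i). b (x i) (y j)"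
  show ?thesis
  proof (rule dual_basis_family[OF T.module_axioms, of "{..<n} \<times> {..<m}" ?x ?\<phi>])
    fix t assume t: "t \<in> carrier T"
    have "finsum T (\<lambda>k. ?\<phi> k t \<odot>\<^bsub>T\<^esub> ?x k) ({..<n} \<times> {..<m})
        = finsum T (\<lambda>j. finsum T (\<lambda>i. \<phi> i (contract (\<psi> j) t) \<odot>\<^bsub>T\<^esub> b (x i) (y j)) {..<m}) {..<n}"
      using t by (subst finsum_Times[OF T.abelian_group_axioms]) auto
    also have "\<dots> = finsum T (\<lambda>j. b (contract (\<psi> j) t) (y j)) {..<n}"
    proof (intro T.finsum_cong')
      fix j assume "j \<in> {..<n}"
      then have j: "j < n" by simp
      have "finsum T (\<lambda>i. \<phi> i (contract (\<psi> j) t) \<odot>\<^bsub>T\<^esub> b (x i) (y j)) {..<m}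
          = finsum T (\<lambda>i. b (\<phi> i (contract (\<psi> j) t) \<odot>\<^bsub>P\<^esub> x i) (y j)) {..<m}"
        using t j by (intro T.finsum_cong') (auto simp: pure_lact)
      also have "\<dots> = b (finsum P (\<lambda>i. \<phi> i (contract (\<psi> j) t) \<odot>\<^bsub>P\<^esub> x i) {..<m}) (y j)"
        using t j by (intro additive_finsum[OF pure_left_linear, symmetric])
          (auto simp: P.abelian_group_axioms T.abelian_group_axioms)
      finally show "finsum T (\<lambda>i. \<phi> i (contract (\<psi> j) t) \<odot>\<^bsub>T\<^esub> b (x i) (y j)) {..<m}
          = b (contract (\<psi> j) t) (y j)"
        using dual_basisD(3)[OF dbP] t j by simp
    qed (use t in auto)
    finally show "finsum T (\<lambda>k. ?\<phi> k t \<odot>\<^bsub>T\<^esub> ?x k) ({..<n} \<times> {..<m}) = t"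
      using tensor_expansion[OF dbQ t] by simp
  next
    fix k assume "k \<in> {..<n} \<times> {..<m}"
    then obtain j i where k: "k = (j, i)" "j < n" "i < m" by auto
    show "?\<phi> k \<in> functionals R T"
      using linear_maps_comp[OF c(1) dual_basisD(2)[OF dbP]] k by simp
  qed auto
qed

lemma tensor_product_unique:
  assumes T: "tensor_product R P Q T b" and T': "tensor_product R P Q T' b'"
    and Q: "fg_projective R Q"
  shows "isomorphic_bimodules R T T'"
proof -
  interpret T: tensor_product R P Q T b by fact
  interpret T': tensor_product R P Q T' b' by fact
  obtain n y \<psi> where db: "dual_basis R Q n y \<psi>"
    using Q fg_projective_iff_dual_basis[OF T.Q.module_axioms] by blast
  obtain h where h: "h \<in> linear_maps {} T T'"
    and hb: "\<And>p q. \<lbrakk>p \<in> carrier P; q \<in> carrier Q\<rbrakk> \<Longrightarrow> h (b p q) = b' p q"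
    using T.tensor_lift[OF db T'.T.abelian_group_axioms T'.pure_right_additive
        linear_maps_additive[OF T'.pure_left_linear] T'.pure_balanced] by blast
  obtain k where k: "k \<in> linear_maps {} T' T"
    and kb: "\<And>p q. \<lbrakk>p \<in> carrier P; q \<in> carrier Q\<rbrakk> \<Longrightarrow> k (b' p q) = b p q"
    using T'.tensor_lift[OF db T.T.abelian_group_axioms T.pure_right_additive
        linear_maps_additive[OF T.pure_left_linear] T.pure_balanced] by blast
  note [simp] = linear_mapsD[OF h] linear_mapsD[OF k]
  have id: "(\<lambda>x. x) \<in> linear_maps {} X X" for X by (intro linear_mapsI) auto
  have kh: "k (h t) = t" if "t \<in> carrier T" for t
    by (rule T.additive_eqI[OF T.T.abelian_group_axioms linear_maps_comp[OF h k] id _ that])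
      (simp add: hb kb)
  have hk: "h (k t) = t" if "t \<in> carrier T'" for t
    by (rule T'.additive_eqI[OF T'.T.abelian_group_axioms linear_maps_comp[OF k h] id _ that])
      (simp add: hb kb)
  have "h (r \<odot>\<^bsub>T\<^esub> t) = r \<odot>\<^bsub>T'\<^esub> h t" if r: "r \<in> carrier R" and t: "t \<in> carrier T" for r t
  proof (rule T.additive_eqI[OF T'.T.abelian_group_axioms _ _ _ t])
    show "(\<lambda>t. h (r \<odot>\<^bsub>T\<^esub> t)) \<in> linear_maps {} T T'" "(\<lambda>t. r \<odot>\<^bsub>T'\<^esub> h t) \<in> linear_maps {} T T'"
      using r by (auto intro!: linear_mapsI simp: T.T.smult_r_distr T'.T.smult_r_distr)
  qed (use r in \<open>simp add: hb T'.pure_lact[symmetric] flip: T.pure_lact\<close>)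
  moreover have "h (t \<triangleleft>\<^bsub>T\<^esub> r) = h t \<triangleleft>\<^bsub>T'\<^esub> r" if r: "r \<in> carrier R" and t: "t \<in> carrier T" for r t
  proof (rule T.additive_eqI[OF T'.T.abelian_group_axioms _ _ _ t])
    show "(\<lambda>t. h (t \<triangleleft>\<^bsub>T\<^esub> r)) \<in> linear_maps {} T T'" "(\<lambda>t. h t \<triangleleft>\<^bsub>T'\<^esub> r) \<in> linear_maps {} T T'"
      using r by (auto intro!: linear_mapsI
          simp: T.T.ract_add T'.T.ract_add T.T.ract_closed T'.T.ract_closed)
  qed (use r in \<open>simp add: hb T'.pure_ract[symmetric] T.Q.ract_closed flip: T.pure_ract\<close>)
  moreover have "bij_betw h (carrier T) (carrier T')"
    by (rule bij_betw_byWitness[where f' = k]) (auto simp: kh hk)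
  ultimately have "h \<in> bimodule_iso R T T'" by (intro bimodule_isoI linear_mapsI) auto
  then show ?thesis unfolding isomorphic_bimodules_def by blast
qed

lemma tensor_product_cong:
  assumes T: "tensor_product R P' Q' T b"
    and P: "bimodule R P" and Q: "bimodule R Q"
    and h: "h \<in> bimodule_iso R P P'" and k: "k \<in> bimodule_iso R Q Q'"
  shows "tensor_product R P Q T (\<lambda>p q. b (h p) (k q))"
proof -
  interpret T: tensor_product R P' Q' T b by fact
  interpret P: bimodule R P by fact
  interpret Q: bimodule R Q by fact
  note [simp] = linear_mapsD[OF bimodule_isoD(1)[OF h]] bimodule_isoD(3)[OF h]
    linear_mapsD[OF bimodule_isoD(1)[OF k]] bimodule_isoD(3)[OF k]
  let ?h = "inv_into (carrier P) h" and ?k = "inv_into (carrier Q) k"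
  have h': "?h \<in> bimodule_iso R P' P" using bimodule_iso_inv[OF P h] .
  have k': "?k \<in> bimodule_iso R Q' Q" using bimodule_iso_inv[OF Q k] .
  have hinv: "?h (h p) = p" if "p \<in> carrier P" for p
    using bimodule_isoD(2)[OF h] that by (auto simp: bij_betw_def)
  have kinv: "?k (k q) = q" if "q \<in> carrier Q" for q
    using bimodule_isoD(2)[OF k] that by (auto simp: bij_betw_def)
  have h_onto: "\<exists>p\<in>carrier P. p' = h p" if "p' \<in> carrier P'" for p'
    using bimodule_isoD(2)[OF h] that by (auto simp: bij_betw_def)
  have k_onto: "\<exists>q\<in>carrier Q. q' = k q" if "q' \<in> carrier Q'" for q'
    using bimodule_isoD(2)[OF k] that by (auto simp: bij_betw_def)
  show ?thesis
  proof (intro tensor_product.intro tensor_product_axioms.intro)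
    show "carrier T \<subseteq> H" if "\<zero>\<^bsub>T\<^esub> \<in> H" "\<And>s t. \<lbrakk>s \<in> H; t \<in> H\<rbrakk> \<Longrightarrow> s \<oplus>\<^bsub>T\<^esub> t \<in> H"
      "\<And>p q. \<lbrakk>p \<in> carrier P; q \<in> carrier Q\<rbrakk> \<Longrightarrow> b (h p) (k q) \<in> H" for H
    proof (rule T.pure_span[OF that(1,2)])
      fix p' q' assume p': "p' \<in> carrier P'" and q': "q' \<in> carrier Q'"
      obtain p where "p \<in> carrier P" "p' = h p" using h_onto[OF p'] by blast
      moreover obtain q where "q \<in> carrier Q" "q' = k q" using k_onto[OF q'] by blast
      ultimately show "b p' q' \<in> H" using that(3) by simp
    qed
    fix \<psi> assume \<psi>: "\<psi> \<in> functionals R Q"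
    have \<psi>': "(\<lambda>q. \<psi> (?k q)) \<in> functionals R Q'"
      using linear_maps_comp[OF bimodule_isoD(1)[OF k'] \<psi>] .
    show "\<exists>c\<in>linear_maps {} T P. \<forall>p\<in>carrier P. \<forall>q\<in>carrier Q. c (b (h p) (k q)) = p \<triangleleft>\<^bsub>P\<^esub> \<psi> q"
    proof (intro bexI ballI)
      show "(\<lambda>t. ?h (T.contract (\<lambda>q. \<psi> (?k q)) t)) \<in> linear_maps {} T P"
        using linear_maps_comp[OF T.contract(1)[OF \<psi>'] bimodule_isoD(1)[OF h']]
        by (rule linear_maps_additive)
      fix p q assume pq: "p \<in> carrier P" "q \<in> carrier Q"
      show "?h (T.contract (\<lambda>q. \<psi> (?k q)) (b (h p) (k q))) = p \<triangleleft>\<^bsub>P\<^esub> \<psi> q"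
        using pq hinv[of "p \<triangleleft>\<^bsub>P\<^esub> \<psi> q"]
        by (simp add: T.contract(2)[OF \<psi>'] kinv functionalD[OF \<psi>] P.ract_closed)
    qed
  qed (simp_all add: T.pure_closed T.pure_add_left T.pure_add_right T.pure_balanced T.pure_lact
      T.pure_ract P Q T.T.bimodule_axioms P.ract_closed Q.ract_closed)
qed

text \<open>The pairing is determined by \<open>(p, q \<otimes> s) \<mapsto> (p \<otimes> q) \<otimes> s\<close>, lifted to \<open>W\<close> for each \<open>p\<close> separately.
  Its contraction along \<open>\<chi>\<close> lifts the map that sends \<open>v \<otimes> s\<close> to the contraction of \<open>v\<close> along the
  functional \<open>q \<mapsto> \<chi>(q \<otimes> s)\<close>.\<close>

lemma tensor_product_assoc:
  assumes V: "tensor_product R P Q V b1" and T: "tensor_product R V S T b2"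
    and W: "tensor_product R Q S W b3" and S: "fg_projective R S"
  shows "\<exists>b. tensor_product R P W T b"
proof -
  interpret V: tensor_product R P Q V b1 by fact
  interpret T: tensor_product R V S T b2 by fact
  interpret W: tensor_product R Q S W b3 by fact
  obtain n z \<psi> where db: "dual_basis R S n z \<psi>"
    using S fg_projective_iff_dual_basis[OF T.Q.module_axioms] by blast
  note [simp] = V.pure_closed T.pure_closed W.pure_closed
  have "\<exists>h\<in>linear_maps {} W T. \<forall>q\<in>carrier Q. \<forall>s\<in>carrier S. h (b3 q s) = b2 (b1 p q) s"
    if p: "p \<in> carrier P" for p
  proof (rule W.tensor_lift[OF db T.T.abelian_group_axioms])
    show "b2 (b1 p q) \<in> linear_maps {} S T" if "q \<in> carrier Q" for q
      using that p by (intro T.pure_right_additive) simp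
    show "(\<lambda>q. b2 (b1 p q) s) \<in> linear_maps {} Q T" if "s \<in> carrier S" for s
      using that p by (intro linear_mapsI) (auto simp: V.pure_add_right T.pure_add_left)
    show "b2 (b1 p (q \<triangleleft>\<^bsub>Q\<^esub> r)) s = b2 (b1 p q) (r \<odot>\<^bsub>S\<^esub> s)"
      if "q \<in> carrier Q" "r \<in> carrier R" "s \<in> carrier S" for q r s
      using that p by (simp add: V.pure_ract T.pure_balanced)
  qed
  then obtain b where b: "\<And>p. p \<in> carrier P \<Longrightarrow> b p \<in> linear_maps {} W T"
    and bb: "\<And>p q s. \<lbrakk>p \<in> carrier P; q \<in> carrier Q; s \<in> carrier S\<rbrakk> \<Longrightarrow> b p (b3 q s) = b2 (b1 p q) s"
    by metis
  have "tensor_product R P W T b"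
  proof (intro tensor_product.intro tensor_product_axioms.intro)
    show "bimodule R P" "bimodule R W" "bimodule R T" by intro_locales
    show "b p w \<in> carrier T" if "p \<in> carrier P" "w \<in> carrier W" for p w
      using linear_mapsD(1)[OF b] that by blast
    show "b (p \<oplus>\<^bsub>P\<^esub> p') w = b p w \<oplus>\<^bsub>T\<^esub> b p' w"
      if "p \<in> carrier P" "p' \<in> carrier P" "w \<in> carrier W" for p p' w
    proof (rule W.additive_eqI[OF T.T.abelian_group_axioms b _ _ that(3)])
      show "(\<lambda>w. b p w \<oplus>\<^bsub>T\<^esub> b p' w) \<in> linear_maps {} W T"
        using that by (intro linear_mapsI) (auto simp: linear_mapsD[OF b] T.T.a_ac)
    qed (use that in \<open>auto simp: bb V.pure_add_left T.pure_add_left\<close>)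
    show "b p (w \<oplus>\<^bsub>W\<^esub> w') = b p w \<oplus>\<^bsub>T\<^esub> b p w'"
      if "p \<in> carrier P" "w \<in> carrier W" "w' \<in> carrier W" for p w w'
      using linear_mapsD(2)[OF b] that by blast
    show "b (p \<triangleleft>\<^bsub>P\<^esub> r) w = b p (r \<odot>\<^bsub>W\<^esub> w)"
      if "p \<in> carrier P" "r \<in> carrier R" "w \<in> carrier W" for p r w
    proof (rule W.additive_eqI[OF T.T.abelian_group_axioms b _ _ that(3)])
      show "(\<lambda>w. b p (r \<odot>\<^bsub>W\<^esub> w)) \<in> linear_maps {} W T"
        using that by (intro linear_mapsI) (auto simp: linear_mapsD[OF b] W.T.smult_r_distr)
    qed (use that in \<open>auto simp: bb V.pure_balanced V.P.ract_closed simp flip: W.pure_lact\<close>)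
    show "b (r \<odot>\<^bsub>P\<^esub> p) w = r \<odot>\<^bsub>T\<^esub> b p w"
      if "r \<in> carrier R" "p \<in> carrier P" "w \<in> carrier W" for p r w
    proof (rule W.additive_eqI[OF T.T.abelian_group_axioms b _ _ that(3)])
      show "(\<lambda>w. r \<odot>\<^bsub>T\<^esub> b p w) \<in> linear_maps {} W T"
        using that by (intro linear_mapsI) (auto simp: linear_mapsD[OF b] T.T.smult_r_distr)
    qed (use that in \<open>auto simp: bb V.pure_lact T.pure_lact\<close>)
    show "b p (w \<triangleleft>\<^bsub>W\<^esub> r) = b p w \<triangleleft>\<^bsub>T\<^esub> r"
      if "p \<in> carrier P" "w \<in> carrier W" "r \<in> carrier R" for p r w
    proof (rule W.additive_eqI[OF T.T.abelian_group_axioms _ _ _ that(2)])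
      show "(\<lambda>w. b p (w \<triangleleft>\<^bsub>W\<^esub> r)) \<in> linear_maps {} W T" "(\<lambda>w. b p w \<triangleleft>\<^bsub>T\<^esub> r) \<in> linear_maps {} W T"
        using that by (auto intro!: linear_mapsI
            simp: linear_mapsD[OF b] T.T.ract_add W.T.ract_add T.T.ract_closed W.T.ract_closed)
    qed (use that in \<open>auto simp: bb T.Q.ract_closed simp flip: W.pure_ract T.pure_ract\<close>)
    show "carrier T \<subseteq> H" if H: "\<zero>\<^bsub>T\<^esub> \<in> H" "\<And>s t. \<lbrakk>s \<in> H; t \<in> H\<rbrakk> \<Longrightarrow> s \<oplus>\<^bsub>T\<^esub> t \<in> H"
      "\<And>p w. \<lbrakk>p \<in> carrier P; w \<in> carrier W\<rbrakk> \<Longrightarrow> b p w \<in> H" for H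
    proof (intro T.pure_span H(1,2))
      fix v s assume v: "v \<in> carrier V" and s: "s \<in> carrier S"
      from v show "b2 v s \<in> H"
      proof (induction rule: V.tensor_induct)
        case zero
        show ?case
          using additive_zero[OF T.pure_left_linear[OF s] V.T.abelian_group_axioms T.T.abelian_group_axioms] H(1)
          by simp
      next
        case (add u v)
        then show ?case using s H(2) by (simp add: T.pure_add_left)
      next
        case (pure p q)
        then show ?case using s H(3)[of p "b3 q s"] by (simp add: bb)
      qed
    qed
    show "\<exists>c\<in>linear_maps {} T P. \<forall>p\<in>carrier P. \<forall>w\<in>carrier W. c (b p w) = p \<triangleleft>\<^bsub>P\<^esub> \<chi> w"
      if \<chi>: "\<chi> \<in> functionals R W" for \<chi>
    proof -
      define d where "d = (\<lambda>v s. V.contract (\<lambda>q. \<chi> (b3 q s)) v)"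
      have d: "(\<lambda>v. d v s) \<in> linear_maps (carrier R) V P"
        and d_pure: "\<lbrakk>p \<in> carrier P; q \<in> carrier Q\<rbrakk> \<Longrightarrow> d (b1 p q) s = p \<triangleleft>\<^bsub>P\<^esub> \<chi> (b3 q s)"
        if "s \<in> carrier S" for s p q
        unfolding d_def using V.contract[OF W.functional_pure[OF \<chi> that]] by blast+
      note [simp] = functionalD[OF \<chi>]
      obtain c where c: "c \<in> linear_maps {} T P"
        and cb: "\<And>v s. \<lbrakk>v \<in> carrier V; s \<in> carrier S\<rbrakk> \<Longrightarrow> c (b2 v s) = d v s"
      proof -
        have "\<exists>c\<in>linear_maps {} T P. \<forall>v\<in>carrier V. \<forall>s\<in>carrier S. c (b2 v s) = d v s"
        proof (rule T.tensor_lift[OF db V.P.abelian_group_axioms _ linear_maps_additive[OF d]])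
          show "d v \<in> linear_maps {} S P" if v: "v \<in> carrier V" for v
          proof (intro linear_mapsI)
            fix s s' assume s: "s \<in> carrier S" "s' \<in> carrier S"
            show "d v (s \<oplus>\<^bsub>S\<^esub> s') = d v s \<oplus>\<^bsub>P\<^esub> d v s'"
            proof (rule V.additive_eqI[OF V.P.abelian_group_axioms d _ _ v])
              show "(\<lambda>v. d v s \<oplus>\<^bsub>P\<^esub> d v s') \<in> linear_maps {} V P"
                using s by (intro linear_mapsI) (auto simp: linear_mapsD[OF d] V.P.a_ac)
            qed (use s in \<open>auto simp: d_pure W.pure_add_right V.P.ract_add_scalar\<close>)
          qed (use v in \<open>auto simp: linear_mapsD[OF d]\<close>)
          show "d (v \<triangleleft>\<^bsub>V\<^esub> r) s = d v (r \<odot>\<^bsub>S\<^esub> s)"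
            if v: "v \<in> carrier V" and rs: "r \<in> carrier R" "s \<in> carrier S" for v r s
          proof (rule V.additive_eqI[OF V.P.abelian_group_axioms _ d _ v])
            show "(\<lambda>v. d (v \<triangleleft>\<^bsub>V\<^esub> r) s) \<in> linear_maps {} V P"
              using rs by (intro linear_mapsI) (auto simp: linear_mapsD[OF d] V.T.ract_add V.T.ract_closed)
          qed (use rs in \<open>auto simp: d_pure V.Q.ract_closed W.pure_balanced simp flip: V.pure_ract\<close>)
        qed
        then show thesis using that by blast
      qed
      have "c (b p w) = p \<triangleleft>\<^bsub>P\<^esub> \<chi> w" if p: "p \<in> carrier P" and w: "w \<in> carrier W" for p w
      proof (rule W.additive_eqI[OF V.P.abelian_group_axioms linear_maps_comp[OF b[OF p] c] _ _ w])
        show "(\<lambda>w. p \<triangleleft>\<^bsub>P\<^esub> \<chi> w) \<in> linear_maps {} W P"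
          using p by (intro linear_mapsI) (auto simp: V.P.ract_closed V.P.ract_add_scalar)
      qed (use p in \<open>auto simp: bb cb d_pure\<close>)
      with c show ?thesis by blast
    qed
  qed
  then show ?thesis by blast
qed

section \<open>The quotient of the free abelian group is a tensor product\<close>

text \<open>The saturation that defines a scalar action on cosets: the image of a coset, completed to a full
  coset, is the coset of the image.\<close>

lemma set_mult_additive_image:
  fixes F :: "('x \<Rightarrow>\<^sub>0 int) monoid"
  assumes F: "F = free_Abelian_group S" and N: "subgroup N F"
    and L: "\<And>x y. L (x + y) = L x + L y" and LN: "\<And>x. x \<in> N \<Longrightarrow> L x \<in> N"
  shows "N <#>\<^bsub>F\<^esub> L ` (N #>\<^bsub>F\<^esub> c) = N #>\<^bsub>F\<^esub> L c"
proof -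
  have zero: "0 \<in> N" and add: "\<And>x y. \<lbrakk>x \<in> N; y \<in> N\<rbrakk> \<Longrightarrow> x + y \<in> N"
    using subgroup.one_closed[OF N] subgroup.m_closed[OF N] by (simp_all add: F)
  have L0: "L 0 = 0" using L[of 0 0] by simp
  show ?thesis
  proof (intro equalityI subsetI)
    fix x assume "x \<in> N <#>\<^bsub>F\<^esub> L ` (N #>\<^bsub>F\<^esub> c)"
    then obtain m n where "m \<in> N" "n \<in> N" "x = (m + L n) + L c"
      by (auto simp: set_mult_def r_coset_def F L add.assoc)
    then show "x \<in> N #>\<^bsub>F\<^esub> L c" using add LN by (auto simp: r_coset_def F)
  next
    fix x assume "x \<in> N #>\<^bsub>F\<^esub> L c"
    then obtain m where "m \<in> N" "x = m + L c" by (auto simp: r_coset_def F)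
    moreover have "m + L c \<in> N <#>\<^bsub>F\<^esub> L ` (N #>\<^bsub>F\<^esub> c)" if "m \<in> N"
      using that zero unfolding set_mult_def r_coset_def F mult_free_Abelian_group
      by (fastforce intro!: bexI[of _ 0] bexI[of _ m])
    ultimately show "x \<in> N <#>\<^bsub>F\<^esub> L ` (N #>\<^bsub>F\<^esub> c)" by simp
  qed
qed

text \<open>The additive maps \<open>L r\<close> and \<open>L' r\<close> on the free group induce the two actions, because they map
  relations to relations. The contraction along \<open>\<psi>\<close> comes from the freeness of the group on
  \<open>P \<times> Q\<close>, as \<open>(p, q) \<mapsto> p \<psi>(q)\<close> respects the relations.\<close>

lemma tensor_product_tensor:
  fixes P :: "('a, 'b, 'm) bimodule_scheme" and Q :: "('a, 'c, 'n) bimodule_scheme"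
  assumes P: "bimodule R P" and Q: "bimodule R Q"
  shows "\<exists>b. tensor_product R P Q (tensor R P Q) b"
proof -
  interpret P: bimodule R P by fact
  interpret Q: bimodule R Q by fact
  define S where "S = carrier P \<times> carrier Q"
  define F where "F = free_Abelian_group S"
  define rel where "rel = tensor_relations R P Q"
  define N where "N = generate F rel"
  define T where "T = tensor R P Q"
  define \<pi> where "\<pi> = (\<lambda>c. N #>\<^bsub>F\<^esub> c)"
  define L where "L = (\<lambda>r. frag_extend (\<lambda>(p, q). frag_of (r \<odot>\<^bsub>P\<^esub> p, q)) :: ('b \<times> 'c \<Rightarrow>\<^sub>0 int) \<Rightarrow> _)"
  define L' where "L' = (\<lambda>r. frag_extend (\<lambda>(p, q). frag_of (p, q \<triangleleft>\<^bsub>Q\<^esub> r)) :: ('b \<times> 'c \<Rightarrow>\<^sub>0 int) \<Rightarrow> _)"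
  interpret F: comm_group F unfolding F_def by (rule abelian_free_Abelian_group)
  have F_simps [simp]: "x \<otimes>\<^bsub>F\<^esub> y = x + y" "\<one>\<^bsub>F\<^esub> = 0" for x y by (simp_all add: F_def)
  have F_inv [simp]: "x \<in> carrier F \<Longrightarrow> inv\<^bsub>F\<^esub> x = - x" for x by (simp add: F_def)
  have F_add: "\<lbrakk>x \<in> carrier F; y \<in> carrier F\<rbrakk> \<Longrightarrow> x + y \<in> carrier F" for x y
    using F.m_closed by simp
  have F_minus: "x \<in> carrier F \<Longrightarrow> - x \<in> carrier F" for x by (simp add: F_def)
  have F_diff: "\<lbrakk>x \<in> carrier F; y \<in> carrier F\<rbrakk> \<Longrightarrow> x - y \<in> carrier F" for x y
    using F_add[OF _ F_minus] by fastforce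
  have F_frag: "frag_of x \<in> carrier F \<longleftrightarrow> x \<in> S" for x unfolding F_def by simp
  have relI: "\<lbrakk>p \<in> carrier P; p' \<in> carrier P; q \<in> carrier Q\<rbrakk>
      \<Longrightarrow> frag_of (p \<oplus>\<^bsub>P\<^esub> p', q) - frag_of (p, q) - frag_of (p', q) \<in> rel"
    "\<lbrakk>p \<in> carrier P; q \<in> carrier Q; q' \<in> carrier Q\<rbrakk>
      \<Longrightarrow> frag_of (p, q \<oplus>\<^bsub>Q\<^esub> q') - frag_of (p, q) - frag_of (p, q') \<in> rel"
    "\<lbrakk>p \<in> carrier P; r \<in> carrier R; q \<in> carrier Q\<rbrakk>
      \<Longrightarrow> frag_of (p \<triangleleft>\<^bsub>P\<^esub> r, q) - frag_of (p, r \<odot>\<^bsub>Q\<^esub> q) \<in> rel" for p p' q q' r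
    unfolding rel_def tensor_relations_def by blast+
  have relE: "\<Psi> x" if "x \<in> rel"
    "\<And>p p' q. \<lbrakk>p \<in> carrier P; p' \<in> carrier P; q \<in> carrier Q\<rbrakk>
      \<Longrightarrow> \<Psi> (frag_of (p \<oplus>\<^bsub>P\<^esub> p', q) - frag_of (p, q) - frag_of (p', q))"
    "\<And>p q q'. \<lbrakk>p \<in> carrier P; q \<in> carrier Q; q' \<in> carrier Q\<rbrakk>
      \<Longrightarrow> \<Psi> (frag_of (p, q \<oplus>\<^bsub>Q\<^esub> q') - frag_of (p, q) - frag_of (p, q'))"
    "\<And>p r q. \<lbrakk>p \<in> carrier P; r \<in> carrier R; q \<in> carrier Q\<rbrakk>
      \<Longrightarrow> \<Psi> (frag_of (p \<triangleleft>\<^bsub>P\<^esub> r, q) - frag_of (p, r \<odot>\<^bsub>Q\<^esub> q))" for \<Psi> x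
    using that(1) unfolding rel_def tensor_relations_def
    by (elim UnE CollectE exE conjE) (use that(2-4) in simp_all)
  have rel_F: "rel \<subseteq> carrier F"
  proof
    fix x assume "x \<in> rel"
    then show "x \<in> carrier F"
      by (rule relE) (auto intro!: F_diff simp: F_frag S_def P.ract_closed)
  qed
  have N: "subgroup N F" unfolding N_def by (rule F.generate_is_subgroup[OF rel_F])
  have N_F: "x \<in> N \<Longrightarrow> x \<in> carrier F" for x using subgroup.subset[OF N] by blast
  have N0: "0 \<in> N" using subgroup.one_closed[OF N] by simp
  have N_add: "\<lbrakk>x \<in> N; y \<in> N\<rbrakk> \<Longrightarrow> x + y \<in> N" for x y using subgroup.m_closed[OF N] by simp
  have N_minus: "x \<in> N \<Longrightarrow> - x \<in> N" for x using subgroup.m_inv_closed[OF N] N_F by fastforce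
  have N_diff: "\<lbrakk>x \<in> N; y \<in> N\<rbrakk> \<Longrightarrow> x - y \<in> N" for x y using N_add[OF _ N_minus] by fastforce
  have rel_N: "x \<in> rel \<Longrightarrow> x \<in> N" for x unfolding N_def by (rule generate.incl)
  have normal: "N \<lhd> F" using F.subgroup_imp_normal[OF N] .

  have TF: "carrier T = carrier (F Mod N)" "\<zero>\<^bsub>T\<^esub> = N" "X \<oplus>\<^bsub>T\<^esub> Y = X <#>\<^bsub>F\<^esub> Y"
    "r \<odot>\<^bsub>T\<^esub> X = N <#>\<^bsub>F\<^esub> L r ` X" "X \<triangleleft>\<^bsub>T\<^esub> r = N <#>\<^bsub>F\<^esub> L' r ` X" for X Y r
    by (simp_all add: T_def tensor_def Let_def L_def L'_def N_def rel_def F_def S_def)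
  have T_carrier: "carrier T = \<pi> ` carrier F"
    unfolding TF(1) carrier_FactGroup \<pi>_def by (rule refl)
  have pi_add: "\<pi> c \<oplus>\<^bsub>T\<^esub> \<pi> d = \<pi> (c + d)" if "c \<in> carrier F" "d \<in> carrier F" for c d
    using normal.rcos_sum[OF normal that] by (simp add: TF \<pi>_def)
  have pi_zero: "\<zero>\<^bsub>T\<^esub> = \<pi> 0"
    using F.coset_mult_one[OF subgroup.subset[OF N]] by (simp add: TF \<pi>_def)
  have pi_eq: "\<pi> c = \<pi> d" if "c \<in> carrier F" "d \<in> carrier F" "c - d \<in> N" for c d
  proof -
    have "c \<in> N #>\<^bsub>F\<^esub> d" using that(3) unfolding r_coset_def by force
    from F.repr_independence[OF this that(2) N] show ?thesis by (simp add: \<pi>_def)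
  qed
  have L_frag [simp]: "L r (frag_of (p, q)) = frag_of (r \<odot>\<^bsub>P\<^esub> p, q)"
    "L' r (frag_of (p, q)) = frag_of (p, q \<triangleleft>\<^bsub>Q\<^esub> r)" for r p q by (simp_all add: L_def L'_def)
  have L_add: "L r (x + y) = L r x + L r y" "L' r (x + y) = L' r x + L' r y" for r x y
    by (simp_all add: L_def L'_def frag_extend_add)
  have L_diff: "L r (x - y) = L r x - L r y" "L' r (x - y) = L' r x - L' r y" for r x y
    by (simp_all add: L_def L'_def frag_extend_diff)
  have F_induct: "c \<in> carrier F \<Longrightarrow> \<Psi> 0
      \<Longrightarrow> (\<And>x y. \<lbrakk>x \<in> carrier F; y \<in> carrier F; \<Psi> x; \<Psi> y\<rbrakk> \<Longrightarrow> \<Psi> (x - y))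
      \<Longrightarrow> (\<And>p q. \<lbrakk>p \<in> carrier P; q \<in> carrier Q\<rbrakk> \<Longrightarrow> \<Psi> (frag_of (p, q))) \<Longrightarrow> \<Psi> c" for c \<Psi>
    unfolding F_def carrier_free_Abelian_group_iff S_def
    by (rule free_Abelian_group_induct) auto
  have L_F: "L r c \<in> carrier F" "L' r c \<in> carrier F" if r: "r \<in> carrier R" and c: "c \<in> carrier F" for r c
  proof -
    have zero: "L r 0 = 0" "L' r 0 = 0" "0 \<in> carrier F" by (simp_all add: L_def L'_def F_def)
    show "L r c \<in> carrier F"
      by (rule F_induct[OF c]) (use r zero in \<open>simp_all add: F_diff L_diff F_frag S_def\<close>)
    show "L' r c \<in> carrier F"
      by (rule F_induct[OF c]) (use r zero in \<open>simp_all add: F_diff L_diff F_frag S_def Q.ract_closed\<close>)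
  qed
  have hom_N: "f x \<in> N" if x: "x \<in> N" and f: "\<And>x y. f (x - y) = f x - f y"
    and fr: "\<And>x. x \<in> rel \<Longrightarrow> f x \<in> N" for f x
  proof -
    have f0: "f 0 = 0" using f[of 0 0] by simp
    have fm: "f (- y) = - f y" for y using f[of 0 y] f0 by simp
    have fa: "f (y + z) = f y + f z" for y z using f[of y "- z"] fm[of z] by simp
    show ?thesis using x unfolding N_def
    proof (induction rule: generate.induct)
      case one
      then show ?case using N0 f0 by (simp add: N_def)
    next
      case (incl h)
      then show ?case using fr by (simp add: N_def)
    next
      case (inv h)
      then have "inv\<^bsub>F\<^esub> h = - h" using rel_F by (intro F_inv) blast
      then show ?case using N_minus[OF fr[OF inv]] fm by (simp add: N_def)
    next
      case (eng h1 h2)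
      then show ?case using N_add fa by (simp add: N_def)
    qed
  qed
  have L_N: "L r x \<in> N" "L' r x \<in> N" if r: "r \<in> carrier R" and x: "x \<in> N" for r x
  proof -
    have rel: "f y \<in> N" if "y \<in> rel" and f: "f = L r \<or> f = L' r" for y f
      using that(1)
    proof (rule relE)
      fix p p' q assume "p \<in> carrier P" "p' \<in> carrier P" "q \<in> carrier Q"
      then show "f (frag_of (p \<oplus>\<^bsub>P\<^esub> p', q) - frag_of (p, q) - frag_of (p', q)) \<in> N"
        using rel_N[OF relI(1)[of "r \<odot>\<^bsub>P\<^esub> p" "r \<odot>\<^bsub>P\<^esub> p'" q]]
          rel_N[OF relI(1)[of p p' "q \<triangleleft>\<^bsub>Q\<^esub> r"]] r f
        by (auto simp: L_diff P.smult_r_distr Q.ract_closed)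
    next
      fix p q q' assume "p \<in> carrier P" "q \<in> carrier Q" "q' \<in> carrier Q"
      then show "f (frag_of (p, q \<oplus>\<^bsub>Q\<^esub> q') - frag_of (p, q) - frag_of (p, q')) \<in> N"
        using rel_N[OF relI(2)[of "r \<odot>\<^bsub>P\<^esub> p" q q']]
          rel_N[OF relI(2)[of p "q \<triangleleft>\<^bsub>Q\<^esub> r" "q' \<triangleleft>\<^bsub>Q\<^esub> r"]] r f
        by (auto simp: L_diff Q.ract_closed Q.ract_add)
    next
      fix p s q assume "p \<in> carrier P" "s \<in> carrier R" "q \<in> carrier Q"
      then show "f (frag_of (p \<triangleleft>\<^bsub>P\<^esub> s, q) - frag_of (p, s \<odot>\<^bsub>Q\<^esub> q)) \<in> N"
        using rel_N[OF relI(3)[of "r \<odot>\<^bsub>P\<^esub> p" s q]] rel_N[OF relI(3)[of p s "q \<triangleleft>\<^bsub>Q\<^esub> r"]] r f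
        by (auto simp: L_diff P.lact_ract Q.ract_closed Q.lact_ract)
    qed
    show "L r x \<in> N" by (rule hom_N[where f = "L r", OF x L_diff(1)]) (rule rel, auto)
    show "L' r x \<in> N" by (rule hom_N[where f = "L' r", OF x L_diff(2)]) (rule rel, auto)
  qed
  have act: "r \<odot>\<^bsub>T\<^esub> \<pi> c = \<pi> (L r c)" "\<pi> c \<triangleleft>\<^bsub>T\<^esub> r = \<pi> (L' r c)" if "r \<in> carrier R" for r c
    unfolding TF \<pi>_def using set_mult_additive_image[OF F_def N] L_add L_N[OF that] by blast+
  \<comment> \<open>Additive maps that agree on the generators modulo \<open>N\<close> agree modulo \<open>N\<close>.\<close>
  have cong: "\<pi> (f c) = \<pi> (g c)"
    if c: "c \<in> carrier F" and "\<And>x y. f (x - y) = f x - f y" "\<And>x y. g (x - y) = g x - g y"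
      "\<And>x. x \<in> carrier F \<Longrightarrow> f x \<in> carrier F" "\<And>x. x \<in> carrier F \<Longrightarrow> g x \<in> carrier F"
      "\<And>p q. \<lbrakk>p \<in> carrier P; q \<in> carrier Q\<rbrakk> \<Longrightarrow> f (frag_of (p, q)) - g (frag_of (p, q)) \<in> N" for f g c
  proof (rule pi_eq)
    show "f c - g c \<in> N"
    proof (rule F_induct[OF c])
      show "f 0 - g 0 \<in> N" using that(2)[of 0 0] that(3)[of 0 0] N0 by simp
      fix x y assume "f x - g x \<in> N" "f y - g y \<in> N"
      then have "(f x - g x) - (f y - g y) \<in> N" by (rule N_diff)
      then show "f (x - y) - g (x - y) \<in> N" by (simp add: that(2,3) algebra_simps)
    qed (rule that(6))
  qed (use that in auto)
  have rel3: "x - (y + z) \<in> N" if "x - y - z \<in> rel" for x y z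
    using rel_N[OF that] by (simp add: diff_diff_eq)
  have T_bimodule: "bimodule R T"
  proof (rule bimoduleI)
    show "cring R" by (rule P.R.is_cring)
    interpret FN: comm_group "F Mod N" using F.abelian_FactGroup[OF N] .
    have ops: "X \<oplus>\<^bsub>T\<^esub> Y = X \<otimes>\<^bsub>F Mod N\<^esub> Y" "\<zero>\<^bsub>T\<^esub> = \<one>\<^bsub>F Mod N\<^esub>" for X Y
      by (simp_all add: TF)
    show "abelian_group T"
    proof (rule abelian_groupI)
      fix X assume "X \<in> carrier T"
      then show "\<exists>Y\<in>carrier T. Y \<oplus>\<^bsub>T\<^esub> X = \<zero>\<^bsub>T\<^esub>"
        unfolding ops TF(1) using FN.l_inv_ex by blast
    qed (unfold ops TF(1), (rule FN.m_closed FN.one_closed FN.m_assoc FN.l_one FN.m_comm; assumption)+)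
  next
    fix r X assume r: "r \<in> carrier R" and X: "X \<in> carrier T"
    then obtain c where c: "c \<in> carrier F" "X = \<pi> c" by (auto simp: T_carrier)
    show "r \<odot>\<^bsub>T\<^esub> X \<in> carrier T" "X \<triangleleft>\<^bsub>T\<^esub> r \<in> carrier T"
      using r c L_F by (auto simp: act T_carrier)
    {
      fix s assume s: "s \<in> carrier R"
      have "\<pi> (L (r \<oplus>\<^bsub>R\<^esub> s) c) = \<pi> (L r c + L s c)"
        using r s by (intro cong[where f = "L (r \<oplus>\<^bsub>R\<^esub> s)" and g = "\<lambda>c. L r c + L s c", OF c(1)])
          (auto simp: L_diff L_F F_add P.smult_l_distr intro!: rel3 relI)
      then show "(r \<oplus>\<^bsub>R\<^esub> s) \<odot>\<^bsub>T\<^esub> X = r \<odot>\<^bsub>T\<^esub> X \<oplus>\<^bsub>T\<^esub> s \<odot>\<^bsub>T\<^esub> X"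
        using r s c by (simp add: act pi_add L_F)
      have "\<pi> (L' (r \<oplus>\<^bsub>R\<^esub> s) c) = \<pi> (L' r c + L' s c)"
        using r s by (intro cong[where f = "L' (r \<oplus>\<^bsub>R\<^esub> s)" and g = "\<lambda>c. L' r c + L' s c", OF c(1)])
          (auto simp: L_diff L_F F_add Q.ract_add_scalar Q.ract_closed intro!: rel3 relI)
      then show "X \<triangleleft>\<^bsub>T\<^esub> (r \<oplus>\<^bsub>R\<^esub> s) = X \<triangleleft>\<^bsub>T\<^esub> r \<oplus>\<^bsub>T\<^esub> X \<triangleleft>\<^bsub>T\<^esub> s"
        using r s c by (simp add: act pi_add L_F)
      have "\<pi> (L (r \<otimes>\<^bsub>R\<^esub> s) c) = \<pi> (L r (L s c))"
        using r s N0 by (intro cong[where f = "L (r \<otimes>\<^bsub>R\<^esub> s)" and g = "\<lambda>c. L r (L s c)", OF c(1)]) (auto simp: L_diff L_F P.smult_assoc1)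
      then show "(r \<otimes>\<^bsub>R\<^esub> s) \<odot>\<^bsub>T\<^esub> X = r \<odot>\<^bsub>T\<^esub> (s \<odot>\<^bsub>T\<^esub> X)"
        using r s c by (simp add: act)
      have "\<pi> (L' (r \<otimes>\<^bsub>R\<^esub> s) c) = \<pi> (L' s (L' r c))"
        using r s N0 by (intro cong[where f = "L' (r \<otimes>\<^bsub>R\<^esub> s)" and g = "\<lambda>c. L' s (L' r c)", OF c(1)]) (auto simp: L_diff L_F Q.ract_assoc)
      then show "X \<triangleleft>\<^bsub>T\<^esub> (r \<otimes>\<^bsub>R\<^esub> s) = X \<triangleleft>\<^bsub>T\<^esub> r \<triangleleft>\<^bsub>T\<^esub> s"
        using r s c by (simp add: act)
      have "\<pi> (L' s (L r c)) = \<pi> (L r (L' s c))"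
        using r s N0 by (intro cong[where f = "\<lambda>c. L' s (L r c)" and g = "\<lambda>c. L r (L' s c)", OF c(1)]) (auto simp: L_diff L_F)
      then show "(r \<odot>\<^bsub>T\<^esub> X) \<triangleleft>\<^bsub>T\<^esub> s = r \<odot>\<^bsub>T\<^esub> (X \<triangleleft>\<^bsub>T\<^esub> s)"
        using r s c by (simp add: act)
    }
    {
      fix Y assume "Y \<in> carrier T"
      then obtain d where d: "d \<in> carrier F" "Y = \<pi> d" by (auto simp: T_carrier)
      show "r \<odot>\<^bsub>T\<^esub> (X \<oplus>\<^bsub>T\<^esub> Y) = r \<odot>\<^bsub>T\<^esub> X \<oplus>\<^bsub>T\<^esub> r \<odot>\<^bsub>T\<^esub> Y"
        "(X \<oplus>\<^bsub>T\<^esub> Y) \<triangleleft>\<^bsub>T\<^esub> r = X \<triangleleft>\<^bsub>T\<^esub> r \<oplus>\<^bsub>T\<^esub> Y \<triangleleft>\<^bsub>T\<^esub> r"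
        using r c d by (simp_all add: act pi_add L_add L_F)
    }
  next
    fix X assume "X \<in> carrier T"
    then obtain c where c: "c \<in> carrier F" "X = \<pi> c" by (auto simp: T_carrier)
    have "\<pi> (L \<one>\<^bsub>R\<^esub> c) = \<pi> c" "\<pi> (L' \<one>\<^bsub>R\<^esub> c) = \<pi> c"
      using N0 cong[where f = "L \<one>\<^bsub>R\<^esub>" and g = "\<lambda>c. c", OF c(1)]
        cong[where f = "L' \<one>\<^bsub>R\<^esub>" and g = "\<lambda>c. c", OF c(1)]
      by (simp_all add: L_diff L_F Q.ract_one)
    then show "\<one>\<^bsub>R\<^esub> \<odot>\<^bsub>T\<^esub> X = X" "X \<triangleleft>\<^bsub>T\<^esub> \<one>\<^bsub>R\<^esub> = X" using c by (simp_all add: act)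
  qed
  have "tensor_product R P Q T (\<lambda>p q. \<pi> (frag_of (p, q)))"
  proof (intro tensor_product.intro tensor_product_axioms.intro P Q T_bimodule)
    fix p p' q assume pq: "p \<in> carrier P" "q \<in> carrier Q"
    show "\<pi> (frag_of (p, q)) \<in> carrier T" using pq by (auto simp: T_carrier F_frag S_def)
    show "\<pi> (frag_of (p \<oplus>\<^bsub>P\<^esub> p', q)) = \<pi> (frag_of (p, q)) \<oplus>\<^bsub>T\<^esub> \<pi> (frag_of (p', q))"
      if "p' \<in> carrier P"
    proof -
      have "\<pi> (frag_of (p \<oplus>\<^bsub>P\<^esub> p', q)) = \<pi> (frag_of (p, q) + frag_of (p', q))"
        using pq that by (intro pi_eq rel3 relI F_add) (simp_all add: F_frag S_def)
      then show ?thesis using pq that by (simp add: pi_add F_frag S_def)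
    qed
    show "\<pi> (frag_of (p, q \<oplus>\<^bsub>Q\<^esub> q')) = \<pi> (frag_of (p, q)) \<oplus>\<^bsub>T\<^esub> \<pi> (frag_of (p, q'))"
      if "q' \<in> carrier Q" for q'
    proof -
      have "\<pi> (frag_of (p, q \<oplus>\<^bsub>Q\<^esub> q')) = \<pi> (frag_of (p, q) + frag_of (p, q'))"
        using pq that by (intro pi_eq rel3 relI F_add) (simp_all add: F_frag S_def)
      then show ?thesis using pq that by (simp add: pi_add F_frag S_def)
    qed
    fix r assume r: "r \<in> carrier R"
    show "\<pi> (frag_of (p \<triangleleft>\<^bsub>P\<^esub> r, q)) = \<pi> (frag_of (p, r \<odot>\<^bsub>Q\<^esub> q))"
      using pq r by (intro pi_eq rel_N relI) (auto simp: F_frag S_def P.ract_closed)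
    show "\<pi> (frag_of (r \<odot>\<^bsub>P\<^esub> p, q)) = r \<odot>\<^bsub>T\<^esub> \<pi> (frag_of (p, q))"
      "\<pi> (frag_of (p, q \<triangleleft>\<^bsub>Q\<^esub> r)) = \<pi> (frag_of (p, q)) \<triangleleft>\<^bsub>T\<^esub> r"
      using r by (simp_all add: act)
  next
    fix H assume H: "\<zero>\<^bsub>T\<^esub> \<in> H" "\<And>s t. \<lbrakk>s \<in> H; t \<in> H\<rbrakk> \<Longrightarrow> s \<oplus>\<^bsub>T\<^esub> t \<in> H"
      "\<And>p q. \<lbrakk>p \<in> carrier P; q \<in> carrier Q\<rbrakk> \<Longrightarrow> \<pi> (frag_of (p, q)) \<in> H"
    have "\<pi> c \<in> H \<and> \<pi> (- c) \<in> H" if "c \<in> carrier F" for c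
    proof (rule F_induct[OF that])
      show "\<pi> 0 \<in> H \<and> \<pi> (- 0) \<in> H" using H(1) by (simp add: pi_zero)
    next
      fix x y assume xy: "x \<in> carrier F" "y \<in> carrier F"
        and IH: "\<pi> x \<in> H \<and> \<pi> (- x) \<in> H" "\<pi> y \<in> H \<and> \<pi> (- y) \<in> H"
      have "\<pi> x \<oplus>\<^bsub>T\<^esub> \<pi> (- y) \<in> H" "\<pi> y \<oplus>\<^bsub>T\<^esub> \<pi> (- x) \<in> H" using IH H(2) by auto
      then show "\<pi> (x - y) \<in> H \<and> \<pi> (- (x - y)) \<in> H"
        using xy by (simp add: pi_add F_minus)
    next
      \<comment> \<open>The negative of \<open>p \<otimes> q\<close> is \<open>(- p) \<otimes> q\<close>, because \<open>0 \<otimes> q = 0\<close>.\<close>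
      fix p q assume pq: "p \<in> carrier P" "q \<in> carrier Q"
      have "frag_of (\<zero>\<^bsub>P\<^esub>, q) - frag_of (\<zero>\<^bsub>P\<^esub>, q) - frag_of (\<zero>\<^bsub>P\<^esub>, q) \<in> N"
        using rel_N[OF relI(1)[of "\<zero>\<^bsub>P\<^esub>" "\<zero>\<^bsub>P\<^esub>" q]] pq by simp
      moreover have "frag_of (\<zero>\<^bsub>P\<^esub>, q) - frag_of (p, q) - frag_of (\<ominus>\<^bsub>P\<^esub> p, q) \<in> N"
        using rel_N[OF relI(1)[of p "\<ominus>\<^bsub>P\<^esub> p" q]] pq by (simp add: P.r_neg)
      ultimately have "- frag_of (p, q) - frag_of (\<ominus>\<^bsub>P\<^esub> p, q) \<in> N"
        using N_add by fastforce
      then have "\<pi> (- frag_of (p, q)) = \<pi> (frag_of (\<ominus>\<^bsub>P\<^esub> p, q))"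
        using pq by (intro pi_eq F_minus) (simp_all add: F_frag S_def)
      then show "\<pi> (frag_of (p, q)) \<in> H \<and> \<pi> (- frag_of (p, q)) \<in> H" using pq H(3) by simp
    qed
    then show "carrier T \<subseteq> H" by (auto simp: T_carrier)
  next
    fix \<psi> assume \<psi>: "\<psi> \<in> functionals R Q"
    note [simp] = functionalD[OF \<psi>]
    have "(\<lambda>(p, q). p \<triangleleft>\<^bsub>P\<^esub> \<psi> q) ` S \<subseteq> carrier (add_monoid P)"
      by (auto simp: S_def P.ract_closed)
    then obtain h where h: "h \<in> hom F (add_monoid P)"
      and h_frag: "\<And>x. x \<in> S \<Longrightarrow> h (frag_of x) = (\<lambda>(p, q). p \<triangleleft>\<^bsub>P\<^esub> \<psi> q) x"
      unfolding F_def using comm_group.free_Abelian_group_universal[OF P.a_comm_group] by blast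
    interpret h: group_hom F "add_monoid P" h
      using h P.a_comm_group F.is_group by (simp add: group_hom_def group_hom_axioms_def comm_group_def)
    have h_diff: "h (x - y) = h x \<oplus>\<^bsub>P\<^esub> \<ominus>\<^bsub>P\<^esub> h y" if "x \<in> carrier F" "y \<in> carrier F" for x y
      using h.hom_mult[OF that(1) F.inv_closed[OF that(2)]] that h.hom_inv[OF that(2)]
      by (simp add: a_inv_def)
    have cancel: "x \<oplus>\<^bsub>P\<^esub> (y \<oplus>\<^bsub>P\<^esub> (\<ominus>\<^bsub>P\<^esub> x \<oplus>\<^bsub>P\<^esub> \<ominus>\<^bsub>P\<^esub> y)) = \<zero>\<^bsub>P\<^esub>"
      if "x \<in> carrier P" "y \<in> carrier P" for x y
      using P.r_neg[of "x \<oplus>\<^bsub>P\<^esub> y"] that by (simp add: P.minus_add P.a_assoc)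
    have "rel \<subseteq> kernel F (add_monoid P) h"
    proof
      fix x assume x: "x \<in> rel"
      then have "h x = \<zero>\<^bsub>P\<^esub>"
        by (rule relE) (simp_all add: h_diff F_diff F_frag S_def h_frag P.ract_closed P.ract_add
            P.ract_add_scalar P.ract_assoc P.minus_add P.a_ac P.r_neg cancel)
      then show "x \<in> kernel F (add_monoid P) h" using x rel_F by (auto simp: kernel_def)
    qed
    then have "N \<subseteq> kernel F (add_monoid P) h"
      unfolding N_def by (rule F.generate_subgroup_incl[OF _ h.subgroup_kernel])
    from h.FactGroup_universal_kernel[OF normal this]
    obtain g where g: "g \<in> hom (F Mod N) (add_monoid P)"
      and gh: "\<And>x. x \<in> carrier F \<Longrightarrow> g (N #>\<^bsub>F\<^esub> x) = h x" by blast
    have "g \<in> linear_maps {} T P"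
      using g by (auto simp: linear_maps_def hom_def TF)
    moreover have "g (\<pi> (frag_of (p, q))) = p \<triangleleft>\<^bsub>P\<^esub> \<psi> q" if "p \<in> carrier P" "q \<in> carrier Q" for p q
      using that by (simp add: \<pi>_def gh F_frag S_def h_frag)
    ultimately show "\<exists>c\<in>linear_maps {} T P. \<forall>p\<in>carrier P. \<forall>q\<in>carrier Q.
        c (\<pi> (frag_of (p, q))) = p \<triangleleft>\<^bsub>P\<^esub> \<psi> q" by blast
  qed
  then show ?thesis unfolding T_def by blast
qed

section \<open>The monoid of isomorphism classes\<close>

lemma fg_projective_iso:
  assumes P: "bimodule R P" and Q: "bimodule R Q" and h: "h \<in> bimodule_iso R P Q"
    and fg: "fg_projective R P"
  shows "fg_projective R Q"
proof -
  obtain n \<iota> \<pi> where \<iota>: "\<iota> \<in> linear_maps (carrier R) P (free_module R n)"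
    and \<pi>: "\<pi> \<in> linear_maps (carrier R) (free_module R n) P"
    and id: "\<And>x. x \<in> carrier P \<Longrightarrow> \<pi> (\<iota> x) = x" using fg unfolding fg_projective_def by blast
  let ?k = "inv_into (carrier P) h"
  note h' = bimodule_isoD[OF h] and k = bimodule_isoD(1)[OF bimodule_iso_inv[OF P h]]
  have hk: "h (\<pi> (\<iota> (?k y))) = y" if "y \<in> carrier Q" for y
    using that h'(2) id linear_mapsD(1)[OF k that] by (auto simp: bij_betw_def f_inv_into_f)
  show ?thesis unfolding fg_projective_def
    by (intro conjI bimodule_imp_module[OF Q] exI[of _ n] bexI[OF _ linear_maps_comp[OF k \<iota>]]
        bexI[OF _ linear_maps_comp[OF \<pi> h'(1)]] ballI hk)
qed

lemma rank_le_one_iso: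
  assumes P: "bimodule R P" and h: "h \<in> bimodule_iso R P Q" and rk: "rank_le_one R P"
  shows "rank_le_one R Q"
  unfolding rank_le_one_def
proof (intro ballI)
  fix \<phi> x' y' assume \<phi>: "\<phi> \<in> functionals R Q" and "x' \<in> carrier Q" "y' \<in> carrier Q"
  note h' = bimodule_isoD[OF h]
  have onto: "carrier Q = h ` carrier P" using h'(2) by (simp add: bij_betw_def)
  obtain x where x: "x \<in> carrier P" "x' = h x" using \<open>x' \<in> carrier Q\<close> unfolding onto by blast
  obtain y where y: "y \<in> carrier P" "y' = h y" using \<open>y' \<in> carrier Q\<close> unfolding onto by blast
  have \<phi>h: "(\<lambda>v. \<phi> (h v)) \<in> functionals R P" using linear_maps_comp[OF h'(1) \<phi>] .
  have "h (\<phi> (h x) \<odot>\<^bsub>P\<^esub> y) = h (\<phi> (h y) \<odot>\<^bsub>P\<^esub> x)"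
    using rank_le_oneD[OF rk \<phi>h x(1) y(1)] by simp
  then show "\<phi> x' \<odot>\<^bsub>Q\<^esub> y' = \<phi> y' \<odot>\<^bsub>Q\<^esub> x'"
    using x y functionalD(1)[OF \<phi>h] by (simp add: linear_mapsD(3)[OF h'(1)])
qed

lemma central_over_iso:
  assumes h: "h \<in> bimodule_iso R P Q" and K: "K \<subseteq> carrier R" and c: "central_over K P"
  shows "central_over K Q"
proof -
  note h' = bimodule_isoD[OF h]
  have onto: "carrier Q = h ` carrier P" using h'(2) by (simp add: bij_betw_def)
  have "k \<odot>\<^bsub>Q\<^esub> h x = h x \<triangleleft>\<^bsub>Q\<^esub> k" if "k \<in> K" "x \<in> carrier P" for k x
  proof -
    have kR: "k \<in> carrier R" using that K by blast
    have "h (k \<odot>\<^bsub>P\<^esub> x) = h (x \<triangleleft>\<^bsub>P\<^esub> k)" using c that by (simp add: central_over_def)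
    then show ?thesis using that kR by (simp add: linear_mapsD(3)[OF h'(1)] h'(3))
  qed
  then show ?thesis unfolding central_over_def onto by blast
qed

lemma picS_bimodule_iso:
  assumes K: "K \<subseteq> carrier R" and P: "picS_bimodule R K P" and Q: "bimodule R Q"
    and iso: "isomorphic_bimodules R P Q"
  shows "picS_bimodule R K Q"
proof -
  have R: "cring R" using bimodule_imp_cring[OF Q] .
  obtain h where "h \<in> bimodule_iso R P Q" using iso by (auto simp: isomorphic_bimodules_def)
  then show ?thesis
    using P Q fg_projective_iso rank_le_one_iso central_over_iso[OF _ K]
    unfolding picS_bimodule_iff[OF R K] by blast
qed

text \<open>An element of the copy is the singleton of a coordinate vector.\<close>

lemma ubimodule_copy:
  fixes R :: "('a, 'r) ring_scheme"
  assumes P: "bimodule R P" and fg: "fg_projective R P"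
  shows "\<exists>B :: 'a ubimodule. bimodule R B \<and> isomorphic_bimodules R P B"
proof -
  obtain n \<iota> \<pi> where "\<iota> \<in> linear_maps (carrier R) P (free_module R n)"
    and id: "\<And>x. x \<in> carrier P \<Longrightarrow> \<pi> (\<iota> x) = x" using fg unfolding fg_projective_def by blast
  define h where "h = (\<lambda>x. {\<iota> x})"
  define k where "k = inv_into (carrier P) h"
  have inj: "inj_on h (carrier P)"
    by (rule inj_onI) (metis h_def id singleton_inject)
  have kh [simp]: "x \<in> carrier P \<Longrightarrow> k (h x) = x" for x
    unfolding k_def using inj by (rule inv_into_f_f)
  define B where "B = make_bimodule (h ` carrier P) (h \<zero>\<^bsub>P\<^esub>) (\<lambda>X Y. h (k X \<oplus>\<^bsub>P\<^esub> k Y))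
    (\<lambda>r X. h (r \<odot>\<^bsub>P\<^esub> k X)) (\<lambda>X r. h (k X \<triangleleft>\<^bsub>P\<^esub> r))"
  have "bij_betw h (carrier P) (carrier B)" using inj by (simp add: B_def bij_betw_def)
  then have "bimodule R B" "h \<in> bimodule_iso R P B"
    by (auto intro!: bimodule_transport[OF P] simp: B_def)
  then show ?thesis unfolding isomorphic_bimodules_def by blast
qed

text \<open>Finite generation ensures that the class is nonempty; otherwise equality of classes would say
  nothing.\<close>

lemma class_eqD:
  fixes R :: "('a, 'r) ring_scheme"
  assumes P: "bimodule R P" "fg_projective R P" and Q: "bimodule R Q"
    and eq: "bimodule_class R P = bimodule_class R Q"
  shows "isomorphic_bimodules R P Q"
proof -
  obtain B :: "'a ubimodule" where B: "bimodule R B" "isomorphic_bimodules R P B"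
    using ubimodule_copy[OF P] by blast
  then have "B \<in> bimodule_class R Q" using eq by (auto simp: bimodule_class_iff)
  then have "isomorphic_bimodules R Q B" by (simp add: bimodule_class_iff)
  then show ?thesis using B isomorphic_sym[OF Q] isomorphic_trans by metis
qed

lemma mult_PicS:
  "A \<otimes>\<^bsub>PicS R K\<^esub> B = (\<Union>P\<in>A. \<Union>Q\<in>B. bimodule_class R (tensor R P Q))"
  by (simp add: PicS_def)

text \<open>The product of two classes is a union over all their members; each of these members has a tensor
  product isomorphic to \<open>T\<close>, and there is at least one.\<close>

lemma class_mult:
  fixes R :: "('a, 'r) ring_scheme"
  assumes T: "tensor_product R P Q T b" and P: "fg_projective R P" and Q: "fg_projective R Q"
  shows "bimodule_class R P \<otimes>\<^bsub>PicS R K\<^esub> bimodule_class R Q = bimodule_class R T"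
proof -
  interpret tensor_product R P Q T b by fact
  have eq: "bimodule_class R (tensor R B C) = bimodule_class R T"
    if B: "B \<in> bimodule_class R P" and C: "C \<in> bimodule_class R Q" for B C
  proof -
    have bB: "bimodule R B" and bC: "bimodule R C" using B C by (auto simp: bimodule_class_iff)
    obtain h where h: "h \<in> bimodule_iso R P B" using B by (auto simp: bimodule_class_iff isomorphic_bimodules_def)
    obtain k where k: "k \<in> bimodule_iso R Q C" using C by (auto simp: bimodule_class_iff isomorphic_bimodules_def)
    have T': "tensor_product R B C T (\<lambda>p q. b (inv_into (carrier P) h p) (inv_into (carrier Q) k q))"
      by (rule tensor_product_cong[OF T bB bC bimodule_iso_inv[OF P.bimodule_axioms h]
            bimodule_iso_inv[OF Q.bimodule_axioms k]])
    obtain b' where b': "tensor_product R B C (tensor R B C) b'"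
      using tensor_product_tensor[OF bB bC] by blast
    have "isomorphic_bimodules R (tensor R B C) T"
      using tensor_product_unique[OF b' T'] fg_projective_iso[OF Q.bimodule_axioms bC k Q] by blast
    then show ?thesis
      using bimodule_class_cong tensor_product.axioms(3)[OF b'] by blast
  qed
  obtain B :: "'a ubimodule" where "B \<in> bimodule_class R P"
    using ubimodule_copy[OF P.bimodule_axioms P] by (auto simp: bimodule_class_iff)
  moreover obtain C :: "'a ubimodule" where "C \<in> bimodule_class R Q"
    using ubimodule_copy[OF Q.bimodule_axioms Q] by (auto simp: bimodule_class_iff)
  ultimately show ?thesis unfolding mult_PicS using eq by blast
qed

lemma picS_bimoduleD:
  assumes "picS_bimodule R K P"
  shows "bimodule R P" "fg_projective R P" "central_over K P"
  using assms by (auto simp: picS_bimodule_def)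

lemma picS_tensor_product:
  assumes T: "tensor_product R P Q T b" and K: "K \<subseteq> carrier R"
    and P: "picS_bimodule R K P" and Q: "picS_bimodule R K Q"
  shows "picS_bimodule R K T"
proof -
  interpret tensor_product R P Q T b by fact
  obtain n y \<psi> where "dual_basis R Q n y \<psi>"
    using picS_bimoduleD(2)[OF Q] fg_projective_iff_dual_basis[OF Q.module_axioms] by blast
  then show ?thesis
    using P Q central_tensor[OF K] fg_projective_tensor rank_le_one_tensor T.bimodule_axioms
    unfolding picS_bimodule_iff[OF P.R.is_cring K] by blast
qed

lemma class_in_PicS:
  fixes R :: "('a, 'r) ring_scheme"
  assumes K: "K \<subseteq> carrier R" and P: "picS_bimodule R K P"
  shows "bimodule_class R P \<in> carrier (PicS R K)"
proof -
  obtain B :: "'a ubimodule" where B: "bimodule R B" "isomorphic_bimodules R P B"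
    using ubimodule_copy[OF picS_bimoduleD(1,2)[OF P]] by blast
  have "bimodule_class R P = bimodule_class R B"
    using bimodule_class_cong[OF picS_bimoduleD(1)[OF P] B(2)] .
  moreover have "picS_bimodule R K B" using picS_bimodule_iso[OF K P B] .
  ultimately show ?thesis by (auto simp: PicS_def)
qed

lemma PicS_E:
  fixes R :: "('a, 'r) ring_scheme"
  assumes "A \<in> carrier (PicS R K)"
  obtains P :: "'a ubimodule" where "picS_bimodule R K P" "A = bimodule_class R P"
  using assms by (auto simp: PicS_def)

section \<open>Cutting by idempotents, and the monoid laws\<close>

text \<open>The bimodules \<open>e P\<close> and \<open>P e\<close>. They are described by fixed points rather than as images, so that
  a left part and a right part of \<open>P\<close> are equal records as soon as the two fixed sets agree.\<close>

definition left_part where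
  "left_part R e P = P\<lparr>carrier := {x \<in> carrier P. e \<odot>\<^bsub>P\<^esub> x = x}\<rparr>"

definition right_part where
  "right_part R e P = P\<lparr>carrier := {x \<in> carrier P. x \<triangleleft>\<^bsub>P\<^esub> e = x}\<rparr>"

lemma left_part_simps [simp]:
  "x \<in> carrier (left_part R e P) \<longleftrightarrow> x \<in> carrier P \<and> e \<odot>\<^bsub>P\<^esub> x = x"
  "\<zero>\<^bsub>left_part R e P\<^esub> = \<zero>\<^bsub>P\<^esub>"
  "x \<oplus>\<^bsub>left_part R e P\<^esub> y = x \<oplus>\<^bsub>P\<^esub> y"
  "r \<odot>\<^bsub>left_part R e P\<^esub> x = r \<odot>\<^bsub>P\<^esub> x"
  "x \<triangleleft>\<^bsub>left_part R e P\<^esub> r = x \<triangleleft>\<^bsub>P\<^esub> r"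
  by (auto simp: left_part_def)

lemma right_part_simps [simp]:
  "x \<in> carrier (right_part R e P) \<longleftrightarrow> x \<in> carrier P \<and> x \<triangleleft>\<^bsub>P\<^esub> e = x"
  "\<zero>\<^bsub>right_part R e P\<^esub> = \<zero>\<^bsub>P\<^esub>"
  "x \<oplus>\<^bsub>right_part R e P\<^esub> y = x \<oplus>\<^bsub>P\<^esub> y"
  "r \<odot>\<^bsub>right_part R e P\<^esub> x = r \<odot>\<^bsub>P\<^esub> x"
  "x \<triangleleft>\<^bsub>right_part R e P\<^esub> r = x \<triangleleft>\<^bsub>P\<^esub> r"
  by (auto simp: right_part_def)

lemma parts_one:
  assumes "bimodule R P"
  shows "left_part R \<one>\<^bsub>R\<^esub> P = P" "right_part R \<one>\<^bsub>R\<^esub> P = P"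
proof -
  interpret bimodule R P by fact
  have "{x \<in> carrier P. \<one>\<^bsub>R\<^esub> \<odot>\<^bsub>P\<^esub> x = x} = carrier P" "{x \<in> carrier P. x \<triangleleft>\<^bsub>P\<^esub> \<one>\<^bsub>R\<^esub> = x} = carrier P"
    by (auto simp: ract_one)
  then show "left_part R \<one>\<^bsub>R\<^esub> P = P" "right_part R \<one>\<^bsub>R\<^esub> P = P"
    by (simp_all add: left_part_def right_part_def)
qed

lemma left_part_bimodule:
  assumes P: "bimodule R P" and e: "e \<in> carrier R"
  shows "bimodule R (left_part R e P)"
proof -
  interpret bimodule R P by fact
  have "e \<odot>\<^bsub>P\<^esub> (r \<odot>\<^bsub>P\<^esub> x) = r \<odot>\<^bsub>P\<^esub> (e \<odot>\<^bsub>P\<^esub> x)" if "r \<in> carrier R" "x \<in> carrier P" for r x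
    using that e by (simp add: smult_assoc1[symmetric] R.m_comm)
  then show ?thesis unfolding left_part_def
    using e by (intro subbimodule[OF P]) (auto simp: smult_r_distr ract_closed simp flip: lact_ract)
qed

lemma right_part_bimodule:
  assumes P: "bimodule R P" and e: "e \<in> carrier R"
  shows "bimodule R (right_part R e P)"
proof -
  interpret bimodule R P by fact
  have "(x \<triangleleft>\<^bsub>P\<^esub> r) \<triangleleft>\<^bsub>P\<^esub> e = (x \<triangleleft>\<^bsub>P\<^esub> e) \<triangleleft>\<^bsub>P\<^esub> r" if "r \<in> carrier R" "x \<in> carrier P" for r x
    using that e by (simp add: ract_assoc[symmetric] R.m_comm)
  moreover have "\<zero>\<^bsub>P\<^esub> \<triangleleft>\<^bsub>P\<^esub> e = \<zero>\<^bsub>P\<^esub>"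
    using lact_ract[of "\<zero>\<^bsub>R\<^esub>" "\<zero>\<^bsub>P\<^esub>" e] e by (simp add: ract_closed)
  ultimately show ?thesis unfolding right_part_def
    using e by (intro subbimodule[OF P]) (auto simp: ract_add ract_closed lact_ract)
qed

lemma (in cring) idempotent_ideal_iff:
  assumes "e \<in> carrier R" "e \<otimes> e = e"
  shows "x \<in> PIdl e \<longleftrightarrow> x \<in> carrier R \<and> e \<otimes> x = x"
proof
  assume "x \<in> PIdl e"
  then obtain r where "r \<in> carrier R" "x = r \<otimes> e" by (auto simp: cgenideal_def)
  then show "x \<in> carrier R \<and> e \<otimes> x = x" using assms m_lcomm[of e r e] by simp
next
  assume "x \<in> carrier R \<and> e \<otimes> x = x"
  then have "x = x \<otimes> e" "x \<in> carrier R" using assms m_comm[of e x] by simp_all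
  then show "x \<in> PIdl e" by (auto simp: cgenideal_def)
qed

lemma (in cring) picS_ideal:
  assumes K: "K \<subseteq> carrier R" and e: "e \<in> carrier R" "e \<otimes> e = e"
  shows "picS_bimodule R K (ideal_bimodule R (PIdl e))"
  unfolding picS_bimodule_iff[OF is_cring K]
proof (intro conjI)
  let ?D = "ideal_bimodule R (PIdl e)"
  note D = idempotent_ideal_iff[OF e]
  have eD: "e \<in> carrier ?D" using e by (simp add: D)
  have "e \<otimes> (r \<otimes> x) = r \<otimes> x" "e \<otimes> (x \<otimes> r) = x \<otimes> r"
    if "r \<in> carrier R" "x \<in> carrier R" "e \<otimes> x = x" for r x
    using that e m_lcomm[of e r x] m_assoc[of e x r] by simp_all
  then have "bimodule R (ideal_bimodule R (carrier R)\<lparr>carrier := PIdl e\<rparr>)"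
    using e by (intro subbimodule[OF ring_bimodule[OF is_cring]]) (auto simp: D r_distr)
  then show bimod: "bimodule R ?D" by (simp add: ideal_bimodule_def make_bimodule_def)
  interpret D: bimodule R ?D by (rule bimod)
  show "central_over K ?D" using K by (auto simp: central_over_def D m_comm)
  show "fg_projective R ?D"
  proof (rule dual_basis_family[OF D.module_axioms, of "{()}" "\<lambda>_. e" "\<lambda>_ x. x"])
    fix v assume "v \<in> carrier ?D"
    then show "finsum ?D (\<lambda>i. v \<odot>\<^bsub>?D\<^esub> e) {()} = v"
      using e m_comm[of e v] by (simp add: D.M.finsum_insert D)
  qed (use eD in \<open>auto intro!: linear_mapsI simp: D\<close>)
  have lin: "\<phi> x = x \<otimes> \<phi> e" if "\<phi> \<in> functionals R ?D" "x \<in> carrier ?D" for \<phi> x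
    using functionalD(3)[OF that(1) _ eD, of x] that(2) e m_comm[of e x] by (simp add: D)
  show "rank_le_one R ?D" unfolding rank_le_one_def
  proof (intro ballI)
    fix \<phi> x y assume \<phi>: "\<phi> \<in> functionals R ?D" and x: "x \<in> carrier ?D" and y: "y \<in> carrier ?D"
    show "\<phi> x \<odot>\<^bsub>?D\<^esub> y = \<phi> y \<odot>\<^bsub>?D\<^esub> x"
      using x y functionalD(1)[OF \<phi> eD] lin[OF \<phi> x] lin[OF \<phi> y] by (simp add: D m_ac)
  qed
qed

lemma (in cring) ideal_bimodule_projective:
  assumes "e \<in> carrier R" "e \<otimes> e = e"
  shows "bimodule R (ideal_bimodule R (PIdl e))" "fg_projective R (ideal_bimodule R (PIdl e))"
  by (rule picS_bimoduleD[OF picS_ideal[OF empty_subsetI assms]])+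

lemma (in cring) PIdl_one: "PIdl \<one> = carrier R"
  by (intro equalityI subsetI) (simp_all add: idempotent_ideal_iff)

text \<open>The contraction along \<open>\<psi>\<close> is \<open>\<psi>\<close> itself, which maps \<open>e P\<close> to \<open>e R\<close>.\<close>

lemma tensor_ideal_left:
  assumes P: "bimodule R P" and e: "e \<in> carrier R" "e \<otimes>\<^bsub>R\<^esub> e = e"
  shows "tensor_product R (ideal_bimodule R (PIdl\<^bsub>R\<^esub> e)) P (left_part R e P) (\<lambda>d x. d \<odot>\<^bsub>P\<^esub> x)"
proof -
  interpret bimodule R P by fact
  note D = R.idempotent_ideal_iff[OF e]
  have DB: "bimodule R (ideal_bimodule R (PIdl\<^bsub>R\<^esub> e))"
    using R.ideal_bimodule_projective(1)[OF e] .
  show ?thesis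
  proof (intro tensor_product.intro tensor_product_axioms.intro DB P left_part_bimodule e)
    show "carrier (left_part R e P) \<subseteq> H"
      if "\<And>p q. \<lbrakk>p \<in> carrier (ideal_bimodule R (PIdl\<^bsub>R\<^esub> e)); q \<in> carrier P\<rbrakk> \<Longrightarrow> p \<odot>\<^bsub>P\<^esub> q \<in> H" for H
    proof
      fix x assume "x \<in> carrier (left_part R e P)"
      then show "x \<in> H" using that[of e x] e by (simp add: D)
    qed
    show "\<exists>c\<in>linear_maps {} (left_part R e P) (ideal_bimodule R (PIdl\<^bsub>R\<^esub> e)).
        \<forall>p\<in>carrier (ideal_bimodule R (PIdl\<^bsub>R\<^esub> e)). \<forall>q\<in>carrier P.
          c (p \<odot>\<^bsub>P\<^esub> q) = p \<triangleleft>\<^bsub>ideal_bimodule R (PIdl\<^bsub>R\<^esub> e)\<^esub> \<psi> q"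
      if \<psi>: "\<psi> \<in> functionals R P" for \<psi>
    proof (intro bexI[of _ \<psi>] linear_mapsI)
      fix x assume "x \<in> carrier (left_part R e P)"
      then show "\<psi> x \<in> carrier (ideal_bimodule R (PIdl\<^bsub>R\<^esub> e))"
        using functionalD(3)[OF \<psi> e(1), of x] functionalD(1)[OF \<psi>, of x] by (simp add: D)
    qed (auto simp: D functionalD[OF \<psi>])
  qed (use e in \<open>auto simp: D smult_assoc1[symmetric] smult_l_distr smult_r_distr lact_ract\<close>)
qed

text \<open>A functional on \<open>e R\<close> is determined by its value at \<open>e\<close>; the contraction along \<open>\<psi>\<close> is
  \<open>x \<mapsto> x \<psi>(e)\<close>.\<close>

lemma tensor_ideal_right:
  assumes P: "bimodule R P" and e: "e \<in> carrier R" "e \<otimes>\<^bsub>R\<^esub> e = e"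
  shows "tensor_product R P (ideal_bimodule R (PIdl\<^bsub>R\<^esub> e)) (right_part R e P) (\<lambda>x d. x \<triangleleft>\<^bsub>P\<^esub> d)"
proof -
  interpret bimodule R P by fact
  note D = R.idempotent_ideal_iff[OF e]
  let ?D = "ideal_bimodule R (PIdl\<^bsub>R\<^esub> e)"
  have DB: "bimodule R ?D"
    using R.ideal_bimodule_projective(1)[OF e] .
  show ?thesis
  proof (intro tensor_product.intro tensor_product_axioms.intro DB P right_part_bimodule e)
    show "carrier (right_part R e P) \<subseteq> H"
      if "\<And>p q. \<lbrakk>p \<in> carrier P; q \<in> carrier ?D\<rbrakk> \<Longrightarrow> p \<triangleleft>\<^bsub>P\<^esub> q \<in> H" for H
    proof
      fix x assume "x \<in> carrier (right_part R e P)"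
      then show "x \<in> H" using that[of x e] e by (simp add: D)
    qed
    show "\<exists>c\<in>linear_maps {} (right_part R e P) P. \<forall>p\<in>carrier P. \<forall>q\<in>carrier ?D.
          c (p \<triangleleft>\<^bsub>P\<^esub> q) = p \<triangleleft>\<^bsub>P\<^esub> \<psi> q"
      if \<psi>: "\<psi> \<in> functionals R ?D" for \<psi>
    proof (intro bexI[of _ "\<lambda>x. x \<triangleleft>\<^bsub>P\<^esub> \<psi> e"] linear_mapsI ballI)
      have \<psi>e: "\<psi> e \<in> carrier R" using functionalD(1)[OF \<psi>, of e] e by (simp add: D)
      then show "\<And>x. x \<in> carrier (right_part R e P) \<Longrightarrow> x \<triangleleft>\<^bsub>P\<^esub> \<psi> e \<in> carrier P"
        "\<And>x y. \<lbrakk>x \<in> carrier (right_part R e P); y \<in> carrier (right_part R e P)\<rbrakk>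
          \<Longrightarrow> (x \<oplus>\<^bsub>right_part R e P\<^esub> y) \<triangleleft>\<^bsub>P\<^esub> \<psi> e = x \<triangleleft>\<^bsub>P\<^esub> \<psi> e \<oplus>\<^bsub>P\<^esub> y \<triangleleft>\<^bsub>P\<^esub> \<psi> e"
        by (simp_all add: ract_closed ract_add)
      fix p q assume "p \<in> carrier P" "q \<in> carrier ?D"
      then show "(p \<triangleleft>\<^bsub>P\<^esub> q) \<triangleleft>\<^bsub>P\<^esub> \<psi> e = p \<triangleleft>\<^bsub>P\<^esub> \<psi> q"
        using functionalD(3)[OF \<psi>, of q e] \<psi>e e by (simp add: D R.m_comm flip: ract_assoc)
    qed simp
  qed (use e in \<open>auto simp: D ract_closed ract_assoc[symmetric] ract_add ract_add_scalar lact_ract R.m_comm\<close>)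
qed

lemma class_ideal_left:
  fixes R :: "('a, 'r) ring_scheme"
  assumes P: "bimodule R P" "fg_projective R P" and e: "e \<in> carrier R" "e \<otimes>\<^bsub>R\<^esub> e = e"
  shows "bimodule_class R (ideal_bimodule R (PIdl\<^bsub>R\<^esub> e)) \<otimes>\<^bsub>PicS R K\<^esub> bimodule_class R P
    = bimodule_class R (left_part R e P)"
proof -
  interpret cring R using bimodule_imp_cring[OF P(1)] .
  show ?thesis
    using class_mult[OF tensor_ideal_left[OF P(1) e] ideal_bimodule_projective(2)[OF e] P(2)] .
qed

lemma class_ideal_right:
  fixes R :: "('a, 'r) ring_scheme"
  assumes P: "bimodule R P" "fg_projective R P" and e: "e \<in> carrier R" "e \<otimes>\<^bsub>R\<^esub> e = e"
  shows "bimodule_class R P \<otimes>\<^bsub>PicS R K\<^esub> bimodule_class R (ideal_bimodule R (PIdl\<^bsub>R\<^esub> e))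
    = bimodule_class R (right_part R e P)"
proof -
  interpret cring R using bimodule_imp_cring[OF P(1)] .
  show ?thesis
    using class_mult[OF tensor_ideal_right[OF P(1) e] P(2) ideal_bimodule_projective(2)[OF e]] .
qed

lemma picS_left_part:
  assumes P: "picS_bimodule R K P" and K: "K \<subseteq> carrier R"
    and e: "e \<in> carrier R" "e \<otimes>\<^bsub>R\<^esub> e = e"
  shows "picS_bimodule R K (left_part R e P)"
proof -
  interpret cring R using bimodule_imp_cring[OF picS_bimoduleD(1)[OF P]] .
  show ?thesis
    by (rule picS_tensor_product[OF tensor_ideal_left[OF picS_bimoduleD(1)[OF P] e] K picS_ideal[OF K e] P])
qed

text \<open>Both bracketings of a triple product are the class of \<open>(P \<otimes> Q) \<otimes> S\<close>, since this bimodule is also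
  a tensor product of \<open>P\<close> and \<open>Q \<otimes> S\<close>.\<close>

lemma (in cring) monoid_PicS:
  assumes K: "K \<subseteq> carrier R"
  shows "monoid (PicS R K)"
proof (rule monoidI)
  let ?I = "ideal_bimodule R (carrier R)"
  have one: "\<one>\<^bsub>PicS R K\<^esub> = bimodule_class R ?I" by (simp add: PicS_def)
  show "\<one>\<^bsub>PicS R K\<^esub> \<in> carrier (PicS R K)"
    unfolding one using class_in_PicS[OF K picS_ideal[OF K one_closed]] by (simp add: PIdl_one)
  fix A assume "A \<in> carrier (PicS R K)"
  then obtain P :: "'a ubimodule" where P: "picS_bimodule R K P" "A = bimodule_class R P"
    by (rule PicS_E)
  note P' = picS_bimoduleD[OF P(1)]
  show "\<one>\<^bsub>PicS R K\<^esub> \<otimes>\<^bsub>PicS R K\<^esub> A = A" "A \<otimes>\<^bsub>PicS R K\<^esub> \<one>\<^bsub>PicS R K\<^esub> = A"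
    using class_ideal_left[OF P'(1,2), of \<one> K] class_ideal_right[OF P'(1,2), of \<one> K]
    by (simp_all add: one P(2) PIdl_one parts_one[OF P'(1)])
  fix B assume "B \<in> carrier (PicS R K)"
  then obtain Q :: "'a ubimodule" where Q: "picS_bimodule R K Q" "B = bimodule_class R Q"
    by (rule PicS_E)
  note Q' = picS_bimoduleD[OF Q(1)]
  obtain b1 where b1: "tensor_product R P Q (tensor R P Q) b1"
    using tensor_product_tensor[OF P'(1) Q'(1)] by blast
  have PQ: "picS_bimodule R K (tensor R P Q)" using picS_tensor_product[OF b1 K P(1) Q(1)] .
  note PQ' = picS_bimoduleD[OF PQ]
  have AB: "A \<otimes>\<^bsub>PicS R K\<^esub> B = bimodule_class R (tensor R P Q)"
    unfolding P(2) Q(2) using class_mult[OF b1 P'(2) Q'(2)] .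
  show "A \<otimes>\<^bsub>PicS R K\<^esub> B \<in> carrier (PicS R K)" unfolding AB using class_in_PicS[OF K PQ] .
  fix C assume "C \<in> carrier (PicS R K)"
  then obtain S :: "'a ubimodule" where S: "picS_bimodule R K S" "C = bimodule_class R S"
    by (rule PicS_E)
  note S' = picS_bimoduleD[OF S(1)]
  obtain b3 where b3: "tensor_product R Q S (tensor R Q S) b3"
    using tensor_product_tensor[OF Q'(1) S'(1)] by blast
  have QS: "picS_bimodule R K (tensor R Q S)" using picS_tensor_product[OF b3 K Q(1) S(1)] .
  note QS' = picS_bimoduleD[OF QS]
  have BC: "B \<otimes>\<^bsub>PicS R K\<^esub> C = bimodule_class R (tensor R Q S)"
    unfolding Q(2) S(2) using class_mult[OF b3 Q'(2) S'(2)] .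
  obtain b2 where b2: "tensor_product R (tensor R P Q) S (tensor R (tensor R P Q) S) b2"
    using tensor_product_tensor[OF PQ'(1) S'(1)] by blast
  obtain b where b: "tensor_product R P (tensor R Q S) (tensor R (tensor R P Q) S) b"
    using tensor_product_assoc[OF b1 b2 b3 S'(2)] by blast
  show "A \<otimes>\<^bsub>PicS R K\<^esub> B \<otimes>\<^bsub>PicS R K\<^esub> C = A \<otimes>\<^bsub>PicS R K\<^esub> (B \<otimes>\<^bsub>PicS R K\<^esub> C)"
    unfolding AB BC unfolding P(2) S(2)
    using class_mult[OF b2 PQ'(2) S'(2)] class_mult[OF b P'(2) QS'(2)] by simp
qed

section \<open>The partial action as a family of ring endomorphisms\<close>

text \<open>The group and the ring carry separate prefixes here, which keeps their equally named laws apart.\<close>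

locale partial_action_ring = G: group G + R: cring R
  for G :: "('g, 'm) monoid_scheme" and R :: "('a, 'r) ring_scheme" (structure) +
  fixes e :: "'g \<Rightarrow> 'a" and \<alpha> :: "'g \<Rightarrow> 'a \<Rightarrow> 'a"
  assumes partial_action: "unital_partial_action G R e \<alpha>"
begin

lemma e_closed [simp]: "g \<in> carrier G \<Longrightarrow> e g \<in> carrier R"
  and e_idem [simp]: "g \<in> carrier G \<Longrightarrow> e g \<otimes> e g = e g"
  using unital_partial_action.e_closed[OF partial_action] unital_partial_action.e_idem[OF partial_action]
  by auto

lemma e_absorb [simp]: "\<lbrakk>g \<in> carrier G; r \<in> carrier R\<rbrakk> \<Longrightarrow> e g \<otimes> (e g \<otimes> r) = e g \<otimes> r"
  by (simp flip: R.m_assoc)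

lemma pdom_iff: "g \<in> carrier G \<Longrightarrow> x \<in> pdom R e g \<longleftrightarrow> x \<in> carrier R \<and> e g \<otimes> x = x"
  unfolding pdom_def by (rule R.idempotent_ideal_iff) simp_all

lemma pdom_prod_iff:
  assumes g: "g \<in> carrier G" and h: "h \<in> carrier G"
  shows "x \<in> pdom R e g \<cdot> pdom R e h
    \<longleftrightarrow> x \<in> carrier R \<and> e g \<otimes> x = x \<and> e h \<otimes> x = x"
proof
  assume "x \<in> pdom R e g \<cdot> pdom R e h"
  then show "x \<in> carrier R \<and> e g \<otimes> x = x \<and> e h \<otimes> x = x"
  proof (induction rule: ideal_prod.induct)
    case (prod i j)
    then show ?case
      using R.m_assoc[of "e g" i j] R.m_lcomm[of "e h" i j] g h by (simp add: pdom_iff)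
  next
    case (sum x y)
    then show ?case using g h by (simp add: R.r_distr)
  qed
next
  assume x: "x \<in> carrier R \<and> e g \<otimes> x = x \<and> e h \<otimes> x = x"
  have "e g \<otimes> x \<in> pdom R e g \<cdot> pdom R e h"
    by (rule ideal_prod.prod) (use x g h in \<open>simp_all add: pdom_iff\<close>)
  then show "x \<in> pdom R e g \<cdot> pdom R e h" using x by simp
qed

lemma act_hom: "g \<in> carrier G \<Longrightarrow> \<alpha> g \<in> ring_hom (pdom_ring R e (inv\<^bsub>G\<^esub> g)) (pdom_ring R e g)"
  using unital_partial_action.act_iso[OF partial_action] by (simp add: ring_iso_def)

text \<open>The isomorphism \<open>\<alpha>\<^sub>g\<close>, extended to all of \<open>R\<close> by cutting with \<open>1\<^bsub>g\<inverse>\<^esub>\<close>. It is additive and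
  multiplicative with \<open>\<beta> g 1 = 1\<^sub>g\<close>, and turns the domain conditions of a partial action into factors
  \<open>1\<^sub>g\<close>.\<close>

definition \<beta> where "\<beta> g r = \<alpha> g (r \<otimes> e (inv\<^bsub>G\<^esub> g))"

lemma e_times_in_pdom: "\<lbrakk>g \<in> carrier G; r \<in> carrier R\<rbrakk> \<Longrightarrow> r \<otimes> e g \<in> pdom R e g"
  by (simp add: pdom_iff R.m_lcomm)

lemma \<beta>_in_pdom: "\<lbrakk>g \<in> carrier G; r \<in> carrier R\<rbrakk> \<Longrightarrow> \<beta> g r \<in> pdom R e g"
  using ring_hom_closed[OF act_hom[of g], of "r \<otimes> e (inv\<^bsub>G\<^esub> g)"] e_times_in_pdom
  by (simp add: \<beta>_def pdom_ring_def)

lemma \<beta>_closed [simp]: "\<lbrakk>g \<in> carrier G; r \<in> carrier R\<rbrakk> \<Longrightarrow> \<beta> g r \<in> carrier R"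
  and e_\<beta> [simp]: "\<lbrakk>g \<in> carrier G; r \<in> carrier R\<rbrakk> \<Longrightarrow> e g \<otimes> \<beta> g r = \<beta> g r"
  using \<beta>_in_pdom by (simp_all add: pdom_iff)

lemma \<beta>_add:
  assumes "g \<in> carrier G" "r \<in> carrier R" "s \<in> carrier R"
  shows "\<beta> g (r \<oplus> s) = \<beta> g r \<oplus> \<beta> g s"
  using ring_hom_add[OF act_hom[of g], of "r \<otimes> e (inv\<^bsub>G\<^esub> g)" "s \<otimes> e (inv\<^bsub>G\<^esub> g)"]
    e_times_in_pdom assms by (simp add: \<beta>_def pdom_ring_def R.l_distr)

lemma \<beta>_mult:
  assumes "g \<in> carrier G" "r \<in> carrier R" "s \<in> carrier R"
  shows "\<beta> g (r \<otimes> s) = \<beta> g r \<otimes> \<beta> g s"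
proof -
  have "(r \<otimes> e (inv\<^bsub>G\<^esub> g)) \<otimes> (s \<otimes> e (inv\<^bsub>G\<^esub> g)) = (r \<otimes> s) \<otimes> e (inv\<^bsub>G\<^esub> g)"
    using assms by (simp add: R.m_ac)
  then show ?thesis
    using ring_hom_mult[OF act_hom[of g], of "r \<otimes> e (inv\<^bsub>G\<^esub> g)" "s \<otimes> e (inv\<^bsub>G\<^esub> g)"]
      e_times_in_pdom assms by (simp add: \<beta>_def pdom_ring_def)
qed

lemma \<beta>_pdom: "\<lbrakk>g \<in> carrier G; r \<in> carrier R; e (inv\<^bsub>G\<^esub> g) \<otimes> r = r\<rbrakk> \<Longrightarrow> \<beta> g r = \<alpha> g r"
  by (simp add: \<beta>_def R.m_comm)

lemma \<beta>_one: "g \<in> carrier G \<Longrightarrow> \<beta> g \<one> = e g"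
  using ring_hom_one[OF act_hom[of g]] by (simp add: \<beta>_def pdom_ring_def)

text \<open>The isomorphism \<open>\<alpha>\<^sub>g\<close> maps \<open>D\<^bsub>g\<inverse>\<^esub> D\<^sub>h\<close> onto \<open>D\<^sub>g D\<^bsub>g h\<^esub>\<close>, hence the identity element of the first ideal
  to that of the second.\<close>

lemma \<beta>_e:
  assumes g: "g \<in> carrier G" and h: "h \<in> carrier G"
  shows "\<beta> g (e h) = e g \<otimes> e (g \<otimes>\<^bsub>G\<^esub> h)"
proof -
  let ?D = "pdom R e (inv\<^bsub>G\<^esub> g) \<cdot> pdom R e h" and ?D' = "pdom R e g \<cdot> pdom R e (g \<otimes>\<^bsub>G\<^esub> h)"
  let ?w = "e g \<otimes> e (g \<otimes>\<^bsub>G\<^esub> h)"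
  have image: "\<alpha> g ` ?D = ?D'" by (rule unital_partial_action.act_pdom[OF partial_action g h])
  have "?w \<in> ?D'" using g h by (simp add: pdom_prod_iff R.m_lcomm)
  then obtain t where t: "t \<in> ?D" "?w = \<alpha> g t" using image by (metis imageE)
  have tR: "t \<in> carrier R" "e (inv\<^bsub>G\<^esub> g) \<otimes> t = t" "e h \<otimes> t = t"
    using t g h by (simp_all add: pdom_prod_iff)
  have "?w = \<beta> g t" using t g tR by (simp add: \<beta>_pdom)
  also have "\<dots> = \<beta> g (e h) \<otimes> \<beta> g t" using g h tR by (simp flip: \<beta>_mult)
  also have "\<beta> g t = ?w" using t g tR by (simp add: \<beta>_pdom)
  finally have w: "?w = \<beta> g (e h) \<otimes> ?w" .
  have "\<beta> g (e h) = \<alpha> g (e (inv\<^bsub>G\<^esub> g) \<otimes> e h)" using g h by (simp add: \<beta>_def R.m_comm)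
  moreover have "e (inv\<^bsub>G\<^esub> g) \<otimes> e h \<in> ?D"
    using g h R.m_lcomm[of "e h" "e (inv\<^bsub>G\<^esub> g)" "e h"] by (simp add: pdom_prod_iff)
  ultimately have "\<beta> g (e h) \<in> ?D'" using image by blast
  then have "e g \<otimes> \<beta> g (e h) = \<beta> g (e h)" "e (g \<otimes>\<^bsub>G\<^esub> h) \<otimes> \<beta> g (e h) = \<beta> g (e h)"
    using g h by (simp_all add: pdom_prod_iff)
  then have "?w \<otimes> \<beta> g (e h) = \<beta> g (e h)" using g h by (simp add: R.m_assoc)
  then show ?thesis using w g h by (simp add: R.m_comm)
qed

text \<open>By the previous lemma, \<open>\<beta> h r 1\<^bsub>g\<inverse>\<^esub>\<close> is the image under \<open>\<alpha>\<^sub>h\<close> of \<open>r 1\<^bsub>(g h)\<inverse>\<^esub> 1\<^bsub>h\<inverse>\<^esub>\<close>, and on this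
  element \<open>\<alpha>\<^sub>g \<circ> \<alpha>\<^sub>h\<close> agrees with \<open>\<alpha>\<^bsub>g h\<^esub>\<close>.\<close>

lemma \<beta>_comp:
  assumes g: "g \<in> carrier G" and h: "h \<in> carrier G" and r: "r \<in> carrier R"
  shows "\<beta> g (\<beta> h r) = e g \<otimes> \<beta> (g \<otimes>\<^bsub>G\<^esub> h) r"
proof -
  let ?k = "inv\<^bsub>G\<^esub> (g \<otimes>\<^bsub>G\<^esub> h)"
  let ?t = "r \<otimes> e ?k \<otimes> e (inv\<^bsub>G\<^esub> h)"
  have k: "?k \<in> carrier G" "h \<otimes>\<^bsub>G\<^esub> ?k = inv\<^bsub>G\<^esub> g"
    using g h by (simp_all add: G.inv_mult_group flip: G.m_assoc)
  have gh: "g \<otimes>\<^bsub>G\<^esub> h \<otimes>\<^bsub>G\<^esub> inv\<^bsub>G\<^esub> h = g" using g h by (simp add: G.m_assoc)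
  have "\<beta> h r \<otimes> e (inv\<^bsub>G\<^esub> g) = (e h \<otimes> \<beta> h r) \<otimes> e (inv\<^bsub>G\<^esub> g)" using g h r by simp
  also have "\<dots> = \<beta> h r \<otimes> \<beta> h (e ?k)"
    unfolding \<beta>_e[OF h k(1)] k(2) using g h r by (simp add: R.m_ac del: e_\<beta>)
  also have "\<dots> = \<alpha> h ?t" using h r k by (simp add: \<beta>_mult flip: \<beta>_def)
  finally have "\<beta> g (\<beta> h r) = \<alpha> g (\<alpha> h ?t)" unfolding \<beta>_def[of g] by simp
  also have "\<dots> = \<alpha> (g \<otimes>\<^bsub>G\<^esub> h) ?t"
    using g h r k by (intro unital_partial_action.act_act[OF partial_action])
      (simp_all add: pdom_prod_iff R.m_ac)
  also have "\<dots> = \<beta> (g \<otimes>\<^bsub>G\<^esub> h) (r \<otimes> e (inv\<^bsub>G\<^esub> h))"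
    using g h r k by (simp add: \<beta>_def R.m_ac)
  also have "\<dots> = \<beta> (g \<otimes>\<^bsub>G\<^esub> h) r \<otimes> (e (g \<otimes>\<^bsub>G\<^esub> h) \<otimes> e g)"
    using g h r by (simp add: \<beta>_mult \<beta>_e gh)
  also have "\<dots> = e g \<otimes> (e (g \<otimes>\<^bsub>G\<^esub> h) \<otimes> \<beta> (g \<otimes>\<^bsub>G\<^esub> h) r)"
    using g h r by (simp add: R.m_ac del: e_\<beta>)
  finally show ?thesis using g h r by simp
qed

lemma e_one: "e \<one>\<^bsub>G\<^esub> = \<one>"
proof -
  have "\<one> \<in> pdom R e \<one>\<^bsub>G\<^esub>" using unital_partial_action.pdom_unit[OF partial_action] by simp
  then show ?thesis by (simp add: pdom_iff)
qed

lemma \<beta>_unit: "r \<in> carrier R \<Longrightarrow> \<beta> \<one>\<^bsub>G\<^esub> r = r"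
  using unital_partial_action.act_unit[OF partial_action] by (simp add: \<beta>_def e_one)

lemma \<beta>_inv: "\<lbrakk>g \<in> carrier G; r \<in> carrier R\<rbrakk> \<Longrightarrow> \<beta> (inv\<^bsub>G\<^esub> g) (\<beta> g r) = e (inv\<^bsub>G\<^esub> g) \<otimes> r"
  and \<beta>_inv': "\<lbrakk>g \<in> carrier G; r \<in> carrier R\<rbrakk> \<Longrightarrow> \<beta> g (\<beta> (inv\<^bsub>G\<^esub> g) r) = e g \<otimes> r"
  by (simp_all add: \<beta>_comp \<beta>_unit)

lemma \<beta>_inv_eq: "g \<in> carrier G \<Longrightarrow> \<alpha> (inv\<^bsub>G\<^esub> g) (r \<otimes> e g) = \<beta> (inv\<^bsub>G\<^esub> g) r"
  by (simp add: \<beta>_def)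

lemma invariants_subset: "invariants G R e \<alpha> \<subseteq> carrier R"
  by (auto simp: invariants_def)

lemma \<beta>_invariant:
  "\<lbrakk>k \<in> invariants G R e \<alpha>; g \<in> carrier G\<rbrakk> \<Longrightarrow> \<beta> g k = e g \<otimes> k"
  by (auto simp: invariants_def \<beta>_def R.m_comm)

section \<open>Twisted bimodules\<close>

text \<open>\<open>E'\<close> is \<open>E\<close> with scalars acting through \<open>\<alpha>\<^bsub>g\<inverse>\<^esub>\<close>, so a functional on \<open>E\<close> becomes one on \<open>E'\<close> after
  composition with \<open>\<alpha>\<^sub>g\<close>. Left modules suffice, so that the lemma serves both the twist of a central
  bimodule and the twisted ideal, whose right actions differ.\<close>

lemma dual_basis_twist:
  assumes g: "g \<in> carrier G" and E: "module R E" and E': "module R E'"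
    and id: "\<And>x. x \<in> carrier E \<Longrightarrow> e (inv\<^bsub>G\<^esub> g) \<odot>\<^bsub>E\<^esub> x = x"
    and same: "carrier E' = carrier E" "\<And>x y. x \<oplus>\<^bsub>E'\<^esub> y = x \<oplus>\<^bsub>E\<^esub> y"
    and smult: "\<And>r x. \<lbrakk>r \<in> carrier R; x \<in> carrier E\<rbrakk> \<Longrightarrow> r \<odot>\<^bsub>E'\<^esub> x = \<beta> (inv\<^bsub>G\<^esub> g) r \<odot>\<^bsub>E\<^esub> x"
    and db: "dual_basis R E n x \<phi>"
  shows "dual_basis R E' n x (\<lambda>i v. \<beta> g (\<phi> i v))"
  unfolding dual_basis_def
proof (intro conjI allI impI ballI)
  interpret E: module R E by fact
  interpret E': module R E' by fact
  note [simp] = dual_basisD(1)[OF db] functionalD[OF dual_basisD(2)[OF db]]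
  show "x i \<in> carrier E'" if "i < n" for i using that by (simp add: same)
  show "(\<lambda>v. \<beta> g (\<phi> i v)) \<in> functionals R E'" if "i < n" for i
  proof (intro linear_mapsI)
    fix r v assume "r \<in> carrier R" "v \<in> carrier E'"
    then show "\<beta> g (\<phi> i (r \<odot>\<^bsub>E'\<^esub> v)) = r \<odot>\<^bsub>ideal_bimodule R (carrier R)\<^esub> \<beta> g (\<phi> i v)"
      using that g R.m_lcomm[of "e g" r "\<beta> g (\<phi> i v)"]
      by (simp add: same smult \<beta>_mult \<beta>_inv' R.m_assoc)
  qed (use that g in \<open>simp_all add: same \<beta>_add\<close>)
  fix v assume "v \<in> carrier E'"
  then have v: "v \<in> carrier E" by (simp add: same)
  have eq: "\<beta> g (\<phi> i v) \<odot>\<^bsub>E'\<^esub> x i = \<phi> i v \<odot>\<^bsub>E\<^esub> x i" if "i < n" for i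
  proof -
    have "\<beta> g (\<phi> i v) \<odot>\<^bsub>E'\<^esub> x i = (\<phi> i v \<otimes> e (inv\<^bsub>G\<^esub> g)) \<odot>\<^bsub>E\<^esub> x i"
      using that g v by (simp add: smult \<beta>_inv R.m_comm)
    then show ?thesis using that g v by (simp add: E.smult_assoc1 id)
  qed
  have "(\<lambda>x. x) \<in> linear_maps {} E E'" by (intro linear_mapsI) (simp_all add: same)
  from additive_finsum[OF this E.abelian_group_axioms E'.abelian_group_axioms, of "{..<n}"
      "\<lambda>i. \<phi> i v \<odot>\<^bsub>E\<^esub> x i"]
  have "finsum E (\<lambda>i. \<phi> i v \<odot>\<^bsub>E\<^esub> x i) {..<n} = finsum E' (\<lambda>i. \<phi> i v \<odot>\<^bsub>E\<^esub> x i) {..<n}"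
    using v by simp
  also have "\<dots> = finsum E' (\<lambda>i. \<beta> g (\<phi> i v) \<odot>\<^bsub>E'\<^esub> x i) {..<n}"
    using v by (intro E'.finsum_cong') (auto simp: eq same)
  finally show "v = finsum E' (\<lambda>i. \<beta> g (\<phi> i v) \<odot>\<^bsub>E'\<^esub> x i) {..<n}"
    using dual_basisD(3)[OF db v] by simp
qed

text \<open>Composition with \<open>\<beta> g\<inverse>\<close> turns functionals on \<open>E'\<close> into functionals on \<open>E\<close>.\<close>

lemma rank_le_one_twist:
  assumes g: "g \<in> carrier G" and E: "module R E" and rk: "rank_le_one R E"
    and id: "\<And>x. x \<in> carrier E \<Longrightarrow> e (inv\<^bsub>G\<^esub> g) \<odot>\<^bsub>E\<^esub> x = x"
    and same: "carrier E' = carrier E" "\<And>x y. x \<oplus>\<^bsub>E'\<^esub> y = x \<oplus>\<^bsub>E\<^esub> y"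
    and smult: "\<And>r x. \<lbrakk>r \<in> carrier R; x \<in> carrier E\<rbrakk> \<Longrightarrow> r \<odot>\<^bsub>E'\<^esub> x = \<beta> (inv\<^bsub>G\<^esub> g) r \<odot>\<^bsub>E\<^esub> x"
  shows "rank_le_one R E'"
  unfolding rank_le_one_def
proof (intro ballI)
  interpret E: module R E by fact
  fix \<chi> x y assume \<chi>: "\<chi> \<in> functionals R E'" and xy: "x \<in> carrier E'" "y \<in> carrier E'"
  note [simp] = functionalD[OF \<chi>, unfolded same]
  have "(\<lambda>v. \<beta> (inv\<^bsub>G\<^esub> g) (\<chi> v)) \<in> functionals R E"
  proof (intro linear_mapsI)
    fix r v assume r: "r \<in> carrier R" and v: "v \<in> carrier E"
    have "r \<odot>\<^bsub>E\<^esub> v = (r \<otimes> e (inv\<^bsub>G\<^esub> g)) \<odot>\<^bsub>E\<^esub> v"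
      using r v g by (simp add: E.smult_assoc1 id)
    also have "\<dots> = \<beta> g r \<odot>\<^bsub>E'\<^esub> v" using r v g by (simp add: smult \<beta>_inv R.m_comm)
    finally have "\<chi> (r \<odot>\<^bsub>E\<^esub> v) = \<beta> g r \<otimes> \<chi> v" using r v g by simp
    then show "\<beta> (inv\<^bsub>G\<^esub> g) (\<chi> (r \<odot>\<^bsub>E\<^esub> v)) = r \<odot>\<^bsub>ideal_bimodule R (carrier R)\<^esub> \<beta> (inv\<^bsub>G\<^esub> g) (\<chi> v)"
      using r v g R.m_lcomm[of "e (inv\<^bsub>G\<^esub> g)" r "\<beta> (inv\<^bsub>G\<^esub> g) (\<chi> v)"]
      by (simp add: \<beta>_mult \<beta>_inv R.m_assoc)
  qed (use g in \<open>simp_all add: \<beta>_add\<close>)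
  from rank_le_oneD[OF rk this, of x y] xy
  show "\<chi> x \<odot>\<^bsub>E'\<^esub> y = \<chi> y \<odot>\<^bsub>E'\<^esub> x" by (simp add: same smult)
qed

end

lemma abelian_group_cong:
  assumes E: "abelian_group E" and same: "carrier E' = carrier E" "\<zero>\<^bsub>E'\<^esub> = \<zero>\<^bsub>E\<^esub>"
    "\<And>x y. x \<oplus>\<^bsub>E'\<^esub> y = x \<oplus>\<^bsub>E\<^esub> y"
  shows "abelian_group E'"
proof -
  interpret E: abelian_group E by fact
  show ?thesis
  proof (rule abelian_groupI)
    fix x assume "x \<in> carrier E'"
    then show "\<exists>y\<in>carrier E'. y \<oplus>\<^bsub>E'\<^esub> x = \<zero>\<^bsub>E'\<^esub>"
      by (intro bexI[of _ "\<ominus>\<^bsub>E\<^esub> x"]) (simp_all add: same E.l_neg)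
  qed (simp_all add: same E.a_ac)
qed

context partial_action_ring
begin

lemma twisted_pdom_simps [simp]:
  assumes "g \<in> carrier G"
  shows "x \<in> carrier (twisted_pdom G R e \<alpha> g) \<longleftrightarrow> x \<in> carrier R \<and> e (inv\<^bsub>G\<^esub> g) \<otimes> x = x"
    "\<zero>\<^bsub>twisted_pdom G R e \<alpha> g\<^esub> = \<zero>"
    "x \<oplus>\<^bsub>twisted_pdom G R e \<alpha> g\<^esub> y = x \<oplus> y"
    "r \<odot>\<^bsub>twisted_pdom G R e \<alpha> g\<^esub> x = \<beta> (inv\<^bsub>G\<^esub> g) r \<otimes> x"
    "x \<triangleleft>\<^bsub>twisted_pdom G R e \<alpha> g\<^esub> r = x \<otimes> r"
  using assms by (simp_all add: twisted_pdom_def pdom_iff \<beta>_inv_eq)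

lemma pdom_bimodule: "g \<in> carrier G \<Longrightarrow> K \<subseteq> carrier R \<Longrightarrow> picS_bimodule R K (ideal_bimodule R (pdom R e g))"
  unfolding pdom_def by (rule R.picS_ideal) simp_all

lemma twisted_pdom_bimodule:
  assumes g: "g \<in> carrier G"
  shows "bimodule R (twisted_pdom G R e \<alpha> g)"
proof (rule bimoduleI[OF R.is_cring])
  have absorb: "e (inv\<^bsub>G\<^esub> g) \<otimes> (x \<otimes> r) = x \<otimes> r"
    "e (inv\<^bsub>G\<^esub> g) \<otimes> (r \<otimes> x) = r \<otimes> x"
    if "x \<in> carrier R" "e (inv\<^bsub>G\<^esub> g) \<otimes> x = x" "r \<in> carrier R" for x r
    using that g R.m_assoc[of "e (inv\<^bsub>G\<^esub> g)" x r] R.m_lcomm[of "e (inv\<^bsub>G\<^esub> g)" r x] by simp_all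
  have "abelian_group (ideal_bimodule R (pdom R e (inv\<^bsub>G\<^esub> g)))"
    using picS_bimoduleD(1)[OF pdom_bimodule[of "inv\<^bsub>G\<^esub> g" "{}"]] bimodule_imp_abelian_group g by auto
  then show "abelian_group (twisted_pdom G R e \<alpha> g)"
    by (rule abelian_group_cong) (simp_all add: twisted_pdom_def)
  show "x \<triangleleft>\<^bsub>twisted_pdom G R e \<alpha> g\<^esub> r \<in> carrier (twisted_pdom G R e \<alpha> g)"
    "r \<odot>\<^bsub>twisted_pdom G R e \<alpha> g\<^esub> x \<in> carrier (twisted_pdom G R e \<alpha> g)"
    if "x \<in> carrier (twisted_pdom G R e \<alpha> g)" "r \<in> carrier R" for x r
    using that g by (simp_all add: absorb)
qed (use g in \<open>simp_all add: \<beta>_add \<beta>_mult \<beta>_one R.l_distr R.r_distr R.m_assoc\<close>)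

lemma picS_twisted_pdom:
  assumes g: "g \<in> carrier G"
  shows "picS_bimodule R (invariants G R e \<alpha>) (twisted_pdom G R e \<alpha> g)"
  unfolding picS_bimodule_iff[OF R.is_cring invariants_subset]
proof (intro conjI)
  let ?D = "ideal_bimodule R (pdom R e (inv\<^bsub>G\<^esub> g))" and ?A = "twisted_pdom G R e \<alpha> g"
  have ginv: "inv\<^bsub>G\<^esub> g \<in> carrier G" using g by simp
  note D = pdom_bimodule[OF ginv invariants_subset]
  note D' = bimodule_imp_module[OF picS_bimoduleD(1)[OF D]]
  show A: "bimodule R ?A" by (rule twisted_pdom_bimodule[OF g])
  show "central_over (invariants G R e \<alpha>) ?A"
    unfolding central_over_def
  proof (intro ballI)
    fix k x assume k: "k \<in> invariants G R e \<alpha>" and x: "x \<in> carrier ?A"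
    then have "k \<in> carrier R" using invariants_subset by blast
    then show "k \<odot>\<^bsub>?A\<^esub> x = x \<triangleleft>\<^bsub>?A\<^esub> k"
      using k x g R.m_lcomm[of k "e (inv\<^bsub>G\<^esub> g)" x] by (simp add: \<beta>_invariant R.m_assoc R.m_comm[of x k])
  qed
  have same: "carrier ?A = carrier ?D" "x \<oplus>\<^bsub>?A\<^esub> y = x \<oplus>\<^bsub>?D\<^esub> y" for x y
    by (simp_all add: twisted_pdom_def)
  have id: "x \<in> carrier ?D \<Longrightarrow> e (inv\<^bsub>G\<^esub> g) \<odot>\<^bsub>?D\<^esub> x = x" for x
    using g by (simp add: pdom_iff)
  have smult: "\<lbrakk>r \<in> carrier R; x \<in> carrier ?D\<rbrakk> \<Longrightarrow> r \<odot>\<^bsub>?A\<^esub> x = \<beta> (inv\<^bsub>G\<^esub> g) r \<odot>\<^bsub>?D\<^esub> x" for r x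
    using g by simp
  obtain n x \<phi> where "dual_basis R ?D n x \<phi>"
    using picS_bimoduleD(2)[OF D] fg_projective_iff_dual_basis[OF D'] by blast
  from dual_basis_twist[OF g D' bimodule_imp_module[OF A] id same smult this]
  show "fg_projective R ?A" using fg_projective_iff_dual_basis[OF bimodule_imp_module[OF A]] by blast
  have "rank_le_one R ?D" using D unfolding picS_bimodule_iff[OF R.is_cring invariants_subset] by blast
  from rank_le_one_twist[OF g D' this id same smult] show "rank_le_one R ?A" .
qed

lemma twist_simps [simp]:
  assumes "g \<in> carrier G"
  shows "carrier (twist G R e \<alpha> g E) = carrier E"
    "\<zero>\<^bsub>twist G R e \<alpha> g E\<^esub> = \<zero>\<^bsub>E\<^esub>"
    "x \<oplus>\<^bsub>twist G R e \<alpha> g E\<^esub> y = x \<oplus>\<^bsub>E\<^esub> y"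
    "r \<odot>\<^bsub>twist G R e \<alpha> g E\<^esub> x = \<beta> (inv\<^bsub>G\<^esub> g) r \<odot>\<^bsub>E\<^esub> x"
    "x \<triangleleft>\<^bsub>twist G R e \<alpha> g E\<^esub> r = \<beta> (inv\<^bsub>G\<^esub> g) r \<odot>\<^bsub>E\<^esub> x"
  using assms by (simp_all add: twist_def \<beta>_inv_eq)

text \<open>A model of \<open>A\<^sub>g \<otimes> E\<close> for central \<open>E\<close> on which \<open>1\<^bsub>g\<inverse>\<^esub>\<close> acts as the identity.\<close>

definition left_twist where
  "left_twist g E = E\<lparr>smult := (\<lambda>r x. \<beta> (inv\<^bsub>G\<^esub> g) r \<odot>\<^bsub>E\<^esub> x)\<rparr>"

lemma left_twist_simps [simp]:
  "carrier (left_twist g E) = carrier E"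
  "\<zero>\<^bsub>left_twist g E\<^esub> = \<zero>\<^bsub>E\<^esub>"
  "x \<oplus>\<^bsub>left_twist g E\<^esub> y = x \<oplus>\<^bsub>E\<^esub> y"
  "r \<odot>\<^bsub>left_twist g E\<^esub> x = \<beta> (inv\<^bsub>G\<^esub> g) r \<odot>\<^bsub>E\<^esub> x"
  "x \<triangleleft>\<^bsub>left_twist g E\<^esub> r = x \<triangleleft>\<^bsub>E\<^esub> r"
  by (simp_all add: left_twist_def)

lemma twist_bimodules:
  assumes g: "g \<in> carrier G" and E: "bimodule R E"
    and id: "\<And>x. x \<in> carrier E \<Longrightarrow> e (inv\<^bsub>G\<^esub> g) \<odot>\<^bsub>E\<^esub> x = x"
  shows "bimodule R (left_twist g E)" "bimodule R (twist G R e \<alpha> g E)"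
proof -
  interpret E: bimodule R E by fact
  have ab: "abelian_group (left_twist g E)" "abelian_group (twist G R e \<alpha> g E)"
    using g by (auto intro!: abelian_group_cong[OF E.abelian_group_axioms])
  have comm: "r \<odot>\<^bsub>E\<^esub> (s \<odot>\<^bsub>E\<^esub> x) = s \<odot>\<^bsub>E\<^esub> (r \<odot>\<^bsub>E\<^esub> x)"
    if "r \<in> carrier R" "s \<in> carrier R" "x \<in> carrier E" for r s x
    using that by (simp add: R.m_comm flip: E.smult_assoc1)
  show "bimodule R (left_twist g E)"
    using g by (intro bimoduleI[OF R.is_cring ab(1)])
      (simp_all add: \<beta>_add \<beta>_mult \<beta>_one id E.smult_l_distr E.smult_r_distr E.smult_assoc1
        E.ract_closed E.ract_add_scalar E.ract_add E.ract_assoc E.ract_one E.lact_ract)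
  show "bimodule R (twist G R e \<alpha> g E)"
    using g by (intro bimoduleI[OF R.is_cring ab(2)])
      (simp_all add: \<beta>_add \<beta>_mult \<beta>_one id E.smult_l_distr E.smult_r_distr E.smult_assoc1 comm)
qed

lemma picS_twist:
  assumes g: "g \<in> carrier G" and K: "K \<subseteq> carrier R" and E: "picS_bimodule R K E"
    and id: "\<And>x. x \<in> carrier E \<Longrightarrow> e (inv\<^bsub>G\<^esub> g) \<odot>\<^bsub>E\<^esub> x = x"
  shows "picS_bimodule R K (twist G R e \<alpha> g E)"
  unfolding picS_bimodule_iff[OF R.is_cring K]
proof (intro conjI)
  let ?E = "twist G R e \<alpha> g E"
  note E' = bimodule_imp_module[OF picS_bimoduleD(1)[OF E]]
  show tw: "bimodule R ?E" by (rule twist_bimodules[OF g picS_bimoduleD(1)[OF E] id])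
  show "central_over K ?E" using g by (simp add: central_over_def)
  obtain n x \<phi> where "dual_basis R E n x \<phi>"
    using picS_bimoduleD(2)[OF E] fg_projective_iff_dual_basis[OF E'] by blast
  from dual_basis_twist[OF g E' bimodule_imp_module[OF tw] id _ _ _ this]
  show "fg_projective R ?E"
    using fg_projective_iff_dual_basis[OF bimodule_imp_module[OF tw]] g by fastforce
  have "rank_le_one R E" using E unfolding picS_bimodule_iff[OF R.is_cring K] by blast
  from rank_le_one_twist[where E' = ?E, OF g E' this id] show "rank_le_one R ?E" using g by simp
qed

text \<open>\<open>D\<^sub>g \<otimes> A\<^bsub>g h\<^esub>\<close> has the carrier \<open>D\<^bsub>h\<inverse>\<^esub> D\<^bsub>(g h)\<inverse>\<^esub>\<close>. Since \<open>A\<^sub>h\<close> is generated by \<open>1\<^bsub>h\<inverse>\<^esub>\<close> as a left module,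
  the contraction along \<open>\<psi>\<close> is \<open>t \<mapsto> \<beta> h t \<psi>(1\<^bsub>h\<inverse>\<^esub>)\<close>.\<close>

lemma tensor_twisted_pdom:
  assumes g: "g \<in> carrier G" and h: "h \<in> carrier G"
  shows "tensor_product R (twisted_pdom G R e \<alpha> g) (twisted_pdom G R e \<alpha> h)
    (left_part R (e g) (twisted_pdom G R e \<alpha> (g \<otimes>\<^bsub>G\<^esub> h))) (\<lambda>c d. \<beta> (inv\<^bsub>G\<^esub> h) c \<otimes> d)"
proof -
  let ?A = "twisted_pdom G R e \<alpha> g" and ?B = "twisted_pdom G R e \<alpha> h"
    and ?C = "left_part R (e g) (twisted_pdom G R e \<alpha> (g \<otimes>\<^bsub>G\<^esub> h))"
  let ?g = "inv\<^bsub>G\<^esub> g" and ?h = "inv\<^bsub>G\<^esub> h" and ?k = "inv\<^bsub>G\<^esub> (g \<otimes>\<^bsub>G\<^esub> h)"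
  have cl [simp]: "?g \<in> carrier G" "?h \<in> carrier G" "?k \<in> carrier G" "g \<otimes>\<^bsub>G\<^esub> h \<in> carrier G"
    using g h by simp_all
  have mult: "?h \<otimes>\<^bsub>G\<^esub> ?g = ?k" "?k \<otimes>\<^bsub>G\<^esub> g = ?h" "h \<otimes>\<^bsub>G\<^esub> ?k = ?g"
    using g h by (simp_all add: G.inv_mult_group G.m_assoc) (simp flip: G.m_assoc)
  have C: "t \<in> carrier ?C \<longleftrightarrow> t \<in> carrier R \<and> e ?k \<otimes> t = t \<and> e ?h \<otimes> t = t" for t
  proof -
    have "\<beta> ?k (e g) = e ?k \<otimes> e ?h" using g by (simp add: \<beta>_e mult)
    then show ?thesis
      using R.m_lcomm[of "e ?k" "e ?h" t] by (auto simp: R.m_assoc)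
  qed
  have pure_in: "e ?k \<otimes> (\<beta> ?h c \<otimes> d) = \<beta> ?h c \<otimes> d"
    "e ?h \<otimes> (\<beta> ?h c \<otimes> d) = \<beta> ?h c \<otimes> d"
    if c: "c \<in> carrier R" "e ?g \<otimes> c = c" and d: "d \<in> carrier R" for c d
  proof -
    have "\<beta> ?h c = \<beta> ?h (e ?g) \<otimes> \<beta> ?h c" using c by (simp flip: \<beta>_mult)
    also have "\<dots> = e ?k \<otimes> \<beta> ?h c"
      using c R.m_lcomm[of "e ?h" "e ?k" "\<beta> ?h c"] by (simp add: \<beta>_e mult R.m_assoc)
    finally have "e ?k \<otimes> \<beta> ?h c = \<beta> ?h c" by simp
    then show "e ?k \<otimes> (\<beta> ?h c \<otimes> d) = \<beta> ?h c \<otimes> d"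
      "e ?h \<otimes> (\<beta> ?h c \<otimes> d) = \<beta> ?h c \<otimes> d"
      using c d by (simp_all flip: R.m_assoc)
  qed
  show ?thesis
  proof (intro tensor_product.intro tensor_product_axioms.intro twisted_pdom_bimodule g h cl
      left_part_bimodule e_closed)
    fix p q assume p: "p \<in> carrier ?A" and q: "q \<in> carrier ?B"
    then have p': "p \<in> carrier R" "e ?g \<otimes> p = p" and q': "q \<in> carrier R" "e ?h \<otimes> q = q"
      using g h by simp_all
    show "\<beta> ?h p \<otimes> q \<in> carrier ?C" using p' q' by (simp add: C pure_in del: left_part_simps)
    {
      fix p' assume "p' \<in> carrier ?A"
      then show "\<beta> ?h (p \<oplus>\<^bsub>?A\<^esub> p') \<otimes> q = (\<beta> ?h p \<otimes> q) \<oplus>\<^bsub>?C\<^esub> (\<beta> ?h p' \<otimes> q)"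
        using p q g h by (simp add: \<beta>_add R.l_distr)
    }
    {
      fix q' assume "q' \<in> carrier ?B"
      then show "\<beta> ?h p \<otimes> (q \<oplus>\<^bsub>?B\<^esub> q') = (\<beta> ?h p \<otimes> q) \<oplus>\<^bsub>?C\<^esub> (\<beta> ?h p \<otimes> q')"
        using p q g h by (simp add: R.r_distr)
    }
    fix r assume r: "r \<in> carrier R"
    show "\<beta> ?h (p \<triangleleft>\<^bsub>?A\<^esub> r) \<otimes> q = \<beta> ?h p \<otimes> (r \<odot>\<^bsub>?B\<^esub> q)"
      using p' q' r g h by (simp add: \<beta>_mult R.m_assoc)
    show "\<beta> ?h p \<otimes> (q \<triangleleft>\<^bsub>?B\<^esub> r) = (\<beta> ?h p \<otimes> q) \<triangleleft>\<^bsub>?C\<^esub> r"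
      using p' q' r g h by (simp add: R.m_assoc)
    have "\<beta> ?h (\<beta> ?g r \<otimes> p) \<otimes> q = \<beta> ?k r \<otimes> (e ?h \<otimes> (\<beta> ?h p \<otimes> q))"
      using p' q' r by (simp add: \<beta>_mult \<beta>_comp mult R.m_ac del: e_\<beta>)
    then show "\<beta> ?h (r \<odot>\<^bsub>?A\<^esub> p) \<otimes> q = r \<odot>\<^bsub>?C\<^esub> (\<beta> ?h p \<otimes> q)"
      using p' q' r g h by (simp add: pure_in)
  next
    fix H assume H: "\<And>p q. \<lbrakk>p \<in> carrier ?A; q \<in> carrier ?B\<rbrakk> \<Longrightarrow> \<beta> ?h p \<otimes> q \<in> H"
    show "carrier ?C \<subseteq> H"
    proof
      fix t assume "t \<in> carrier ?C"
      then have t: "t \<in> carrier R" "e ?k \<otimes> t = t" "e ?h \<otimes> t = t" unfolding C by auto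
      have "\<beta> h t = \<beta> h (e ?k) \<otimes> \<beta> h t" using t h by (simp flip: \<beta>_mult)
      also have "\<dots> = e ?g \<otimes> \<beta> h t"
        using t h R.m_lcomm[of "e h" "e ?g" "\<beta> h t"] by (simp add: \<beta>_e mult R.m_assoc)
      finally have "\<beta> h t \<in> carrier ?A" using t g h by simp
      moreover have "e ?h \<in> carrier ?B" using h by simp
      ultimately have "\<beta> ?h (\<beta> h t) \<otimes> e ?h \<in> H" by (rule H)
      then show "t \<in> H" using t h by (simp add: \<beta>_inv R.m_comm)
    qed
  next
    fix \<psi> assume \<psi>: "\<psi> \<in> functionals R ?B"
    have eB: "e ?h \<in> carrier ?B" using h by simp
    have \<psi>e: "\<psi> (e ?h) \<in> carrier R" using functionalD(1)[OF \<psi> eB] .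
    have \<psi>_eq: "\<psi> q = \<beta> h q \<otimes> \<psi> (e ?h)" if "q \<in> carrier ?B" for q
    proof -
      have "q = \<beta> h q \<odot>\<^bsub>?B\<^esub> e ?h" using that h R.m_comm[of q "e ?h"] by (simp add: \<beta>_inv R.m_assoc)
      then show ?thesis using functionalD(3)[OF \<psi> _ eB, of "\<beta> h q"] that h by simp
    qed
    show "\<exists>c\<in>linear_maps {} ?C ?A. \<forall>p\<in>carrier ?A. \<forall>q\<in>carrier ?B.
        c (\<beta> ?h p \<otimes> q) = p \<triangleleft>\<^bsub>?A\<^esub> \<psi> q"
    proof (intro bexI[of _ "\<lambda>t. \<beta> h t \<otimes> \<psi> (e ?h)"] linear_mapsI ballI)
      fix t assume "t \<in> carrier ?C"
      then have t: "t \<in> carrier R" "e ?k \<otimes> t = t" "e ?h \<otimes> t = t" unfolding C by auto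
      have "\<beta> h t = \<beta> h (e ?k) \<otimes> \<beta> h t" using t h by (simp flip: \<beta>_mult)
      also have "\<dots> = e ?g \<otimes> \<beta> h t"
        using t h R.m_lcomm[of "e h" "e ?g" "\<beta> h t"] by (simp add: \<beta>_e mult R.m_assoc)
      finally show "\<beta> h t \<otimes> \<psi> (e ?h) \<in> carrier ?A"
        using t g h \<psi>e by (simp flip: R.m_assoc)
    next
      fix s t assume "s \<in> carrier ?C" "t \<in> carrier ?C"
      then have "s \<in> carrier R" "t \<in> carrier R" unfolding C by auto
      then show "\<beta> h (s \<oplus>\<^bsub>?C\<^esub> t) \<otimes> \<psi> (e ?h)
          = (\<beta> h s \<otimes> \<psi> (e ?h)) \<oplus>\<^bsub>?A\<^esub> (\<beta> h t \<otimes> \<psi> (e ?h))"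
        using g h \<psi>e by (simp add: \<beta>_add R.l_distr)
    next
      fix p q assume p: "p \<in> carrier ?A" and q: "q \<in> carrier ?B"
      then have pq: "p \<in> carrier R" "q \<in> carrier R" using g h by simp_all
      have "\<beta> h (\<beta> ?h p \<otimes> q) = p \<otimes> (e h \<otimes> \<beta> h q)"
        using pq h by (simp add: \<beta>_mult \<beta>_inv' R.m_ac del: e_\<beta>)
      then have "\<beta> h (\<beta> ?h p \<otimes> q) \<otimes> \<psi> (e ?h) = p \<otimes> (\<beta> h q \<otimes> \<psi> (e ?h))"
        using pq h \<psi>e by (simp add: R.m_assoc)
      then show "\<beta> h (\<beta> ?h p \<otimes> q) \<otimes> \<psi> (e ?h) = p \<triangleleft>\<^bsub>?A\<^esub> \<psi> q"
        using \<psi>_eq[OF q] g by simp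
    qed simp
  qed
qed

text \<open>The two factorisations behind \<open>A\<^sub>g \<otimes> E \<cong> E' \<otimes> A\<^sub>g\<close> for central \<open>E\<close>, with \<open>E'\<close> the twist of
  \<open>1\<^bsub>g\<inverse>\<^esub> E\<close>. In the second one the contraction along \<open>\<psi>\<close> is multiplication by
  \<open>\<beta> g\<inverse> (\<psi>(1\<^bsub>g\<inverse>\<^esub>))\<close>, because \<open>1\<^bsub>g\<inverse>\<^esub>\<close> generates \<open>A\<^sub>g\<close>.\<close>

lemma tensor_twisted_pdom_central:
  assumes g: "g \<in> carrier G" and E: "bimodule R E" and central: "central_over (carrier R) E"
  defines "L \<equiv> left_part R (e (inv\<^bsub>G\<^esub> g)) E"
  shows "tensor_product R (twisted_pdom G R e \<alpha> g) E (left_twist g L) (\<lambda>d x. d \<odot>\<^bsub>E\<^esub> x)"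
    "tensor_product R (twist G R e \<alpha> g L) (twisted_pdom G R e \<alpha> g) (left_twist g L) (\<lambda>x d. d \<odot>\<^bsub>E\<^esub> x)"
proof -
  interpret E: bimodule R E by fact
  let ?A = "twisted_pdom G R e \<alpha> g" and ?g = "inv\<^bsub>G\<^esub> g"
  have cl [simp]: "?g \<in> carrier G" using g by simp
  have L: "bimodule R L" unfolding L_def using left_part_bimodule[OF E] by simp
  have id: "x \<in> carrier L \<Longrightarrow> e ?g \<odot>\<^bsub>L\<^esub> x = x" for x by (simp add: L_def)
  note tw = twist_bimodules[OF g L id]
  have ract: "x \<triangleleft>\<^bsub>E\<^esub> r = r \<odot>\<^bsub>E\<^esub> x" if "r \<in> carrier R" "x \<in> carrier E" for r x
    using central that by (simp add: central_over_def)
  have absorb: "e ?g \<odot>\<^bsub>E\<^esub> (d \<odot>\<^bsub>E\<^esub> x) = d \<odot>\<^bsub>E\<^esub> x"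
    if "d \<in> carrier R" "e ?g \<otimes> d = d" "x \<in> carrier E" for d x
    using that by (simp flip: E.smult_assoc1)
  have comm: "r \<odot>\<^bsub>E\<^esub> (s \<odot>\<^bsub>E\<^esub> x) = s \<odot>\<^bsub>E\<^esub> (r \<odot>\<^bsub>E\<^esub> x)"
    if "r \<in> carrier R" "s \<in> carrier R" "x \<in> carrier E" for r s x
    using that by (simp add: R.m_comm flip: E.smult_assoc1)
  have eA: "e ?g \<in> carrier ?A" using g by simp
  show "tensor_product R ?A E (left_twist g L) (\<lambda>d x. d \<odot>\<^bsub>E\<^esub> x)"
  proof (intro tensor_product.intro tensor_product_axioms.intro twisted_pdom_bimodule g E tw)
    fix H assume H: "\<And>p q. \<lbrakk>p \<in> carrier ?A; q \<in> carrier E\<rbrakk> \<Longrightarrow> p \<odot>\<^bsub>E\<^esub> q \<in> H"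
    show "carrier (left_twist g L) \<subseteq> H"
    proof
      fix x assume "x \<in> carrier (left_twist g L)"
      then show "x \<in> H" using H[OF eA, of x] by (simp add: L_def)
    qed
  next
    fix \<psi> assume \<psi>: "\<psi> \<in> functionals R E"
    show "\<exists>c\<in>linear_maps {} (left_twist g L) ?A. \<forall>p\<in>carrier ?A. \<forall>q\<in>carrier E.
        c (p \<odot>\<^bsub>E\<^esub> q) = p \<triangleleft>\<^bsub>?A\<^esub> \<psi> q"
    proof (intro bexI[of _ \<psi>] linear_mapsI ballI)
      fix x assume "x \<in> carrier (left_twist g L)"
      then show "\<psi> x \<in> carrier ?A"
        using functionalD(3)[OF \<psi>, of "e ?g" x] functionalD(1)[OF \<psi>, of x] g by (simp add: L_def)
    qed (use g in \<open>simp_all add: L_def functionalD[OF \<psi>]\<close>)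
  qed (use g in \<open>simp_all add: L_def absorb E.smult_l_distr E.smult_r_distr E.smult_assoc1 E.lact_ract\<close>)
  show "tensor_product R (twist G R e \<alpha> g L) ?A (left_twist g L) (\<lambda>x d. d \<odot>\<^bsub>E\<^esub> x)"
  proof (intro tensor_product.intro tensor_product_axioms.intro twisted_pdom_bimodule g tw)
    fix H assume H: "\<And>p q. \<lbrakk>p \<in> carrier (twist G R e \<alpha> g L); q \<in> carrier ?A\<rbrakk> \<Longrightarrow> q \<odot>\<^bsub>E\<^esub> p \<in> H"
    show "carrier (left_twist g L) \<subseteq> H"
    proof
      fix x assume "x \<in> carrier (left_twist g L)"
      then show "x \<in> H" using H[OF _ eA, of x] g by (simp add: L_def)
    qed
  next
    fix \<psi> assume \<psi>: "\<psi> \<in> functionals R ?A"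
    have \<psi>e: "\<psi> (e ?g) \<in> carrier R" using functionalD(1)[OF \<psi> eA] .
    have \<psi>_eq: "\<psi> d = \<beta> g d \<otimes> \<psi> (e ?g)" if "d \<in> carrier ?A" for d
    proof -
      have "d = \<beta> g d \<odot>\<^bsub>?A\<^esub> e ?g" using that g R.m_comm[of d "e ?g"] by (simp add: \<beta>_inv R.m_assoc)
      then show ?thesis using functionalD(3)[OF \<psi> _ eA, of "\<beta> g d"] that g by simp
    qed
    let ?c = "\<lambda>x. \<beta> ?g (\<psi> (e ?g)) \<odot>\<^bsub>E\<^esub> x"
    have "?c (d \<odot>\<^bsub>E\<^esub> x) = \<beta> ?g (\<psi> d) \<odot>\<^bsub>E\<^esub> x" if x: "x \<in> carrier L" and d: "d \<in> carrier ?A" for x d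
    proof -
      have "\<beta> ?g (\<psi> d) = d \<otimes> \<beta> ?g (\<psi> (e ?g))"
        unfolding \<psi>_eq[OF d] using d g \<psi>e by (simp add: \<beta>_mult \<beta>_inv)
      then show ?thesis using x d g \<psi>e by (simp add: L_def comm E.smult_assoc1)
    qed
    then show "\<exists>c\<in>linear_maps {} (left_twist g L) (twist G R e \<alpha> g L).
        \<forall>p\<in>carrier (twist G R e \<alpha> g L). \<forall>q\<in>carrier ?A. c (q \<odot>\<^bsub>E\<^esub> p) = p \<triangleleft>\<^bsub>twist G R e \<alpha> g L\<^esub> \<psi> q"
      using g \<psi>e by (intro bexI[of _ ?c] linear_mapsI ballI)
        (simp_all add: L_def E.smult_r_distr absorb)
  qed (use g in \<open>simp_all add: L_def absorb E.smult_l_distr E.smult_r_distr E.smult_assoc1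
      ract comm R.m_comm\<close>)
qed

end

section \<open>The representation attached to a cocycle\<close>

lemma picS_bimodule_mono:
  assumes "picS_bimodule R K' P" "K \<subseteq> K'"
  shows "picS_bimodule R K P"
  using assms unfolding picS_bimodule_def algebra_hom_def central_over_def by blast

context partial_action_ring
begin

abbreviation inv_ring where "inv_ring \<equiv> invariants G R e \<alpha>"
abbreviation PicK where "PicK \<equiv> PicS R inv_ring"
abbreviation PicK_mult (infixl \<open>\<star>\<close> 70) where "A \<star> B \<equiv> A \<otimes>\<^bsub>PicK\<^esub> B"

lemma pdom_class_left:
  fixes P :: "('a, 'b, 'k) bimodule_scheme"
  assumes "g \<in> carrier G" "bimodule R P" "fg_projective R P"
  shows "pdom_class R e g \<otimes>\<^bsub>PicS R K\<^esub> bimodule_class R P = bimodule_class R (left_part R (e g) P)"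
  unfolding pdom_class_def pdom_def using assms by (intro class_ideal_left) simp_all

lemma pdom_class_right:
  fixes P :: "('a, 'b, 'k) bimodule_scheme"
  assumes "g \<in> carrier G" "bimodule R P" "fg_projective R P"
  shows "bimodule_class R P \<otimes>\<^bsub>PicS R K\<^esub> pdom_class R e g = bimodule_class R (right_part R (e g) P)"
  unfolding pdom_class_def pdom_def using assms by (intro class_ideal_right) simp_all

lemma pdom_class_in: "g \<in> carrier G \<Longrightarrow> K \<subseteq> carrier R \<Longrightarrow> pdom_class R e g \<in> carrier (PicS R K)"
  unfolding pdom_class_def by (intro class_in_PicS pdom_bimodule)

lemma pdom_class_idem:
  assumes "g \<in> carrier G"
  shows "pdom_class R e g \<otimes>\<^bsub>PicS R K\<^esub> pdom_class R e g = pdom_class R e g"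
proof -
  let ?D = "ideal_bimodule R (pdom R e g)"
  note D = picS_bimoduleD[OF pdom_bimodule[OF assms empty_subsetI]]
  have "{x \<in> pdom R e g. e g \<otimes> x = x} = pdom R e g" using assms by (auto simp: pdom_iff)
  then have "left_part R (e g) ?D = ?D"
    by (simp add: left_part_def ideal_bimodule_def make_bimodule_def)
  then show ?thesis using pdom_class_left[OF assms D(1,2)] by (simp add: pdom_class_def)
qed

lemma pdom_class_one: "pdom_class R e \<one>\<^bsub>G\<^esub> = \<one>\<^bsub>PicS R K\<^esub>"
  by (simp add: pdom_class_def PicS_def unital_partial_action.pdom_unit[OF partial_action])

lemma pdom_class_commute:
  fixes P :: "('a, 'b, 'k) bimodule_scheme"
  assumes g: "g \<in> carrier G" and P: "picS_bimodule R (carrier R) P"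
  shows "pdom_class R e g \<otimes>\<^bsub>PicS R K\<^esub> bimodule_class R P
    = bimodule_class R P \<otimes>\<^bsub>PicS R K\<^esub> pdom_class R e g"
proof -
  note P' = picS_bimoduleD[OF P]
  have "{x \<in> carrier P. e g \<odot>\<^bsub>P\<^esub> x = x} = {x \<in> carrier P. x \<triangleleft>\<^bsub>P\<^esub> e g = x}"
    using P'(3) g by (auto simp: central_over_def)
  then show ?thesis
    using pdom_class_left[OF g P'(1,2)] pdom_class_right[OF g P'(1,2)]
    by (simp add: left_part_def right_part_def)
qed

lemma Phi0_in: "g \<in> carrier G \<Longrightarrow> Phi0 G R e \<alpha> g \<in> carrier PicK"
  unfolding Phi0_def by (intro class_in_PicS picS_twisted_pdom invariants_subset)

lemma Phi0_mult:
  assumes g: "g \<in> carrier G" and h: "h \<in> carrier G"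
  shows "Phi0 G R e \<alpha> g \<otimes>\<^bsub>PicS R K\<^esub> Phi0 G R e \<alpha> h
    = pdom_class R e g \<otimes>\<^bsub>PicS R K\<^esub> Phi0 G R e \<alpha> (g \<otimes>\<^bsub>G\<^esub> h)"
proof -
  have gh: "g \<otimes>\<^bsub>G\<^esub> h \<in> carrier G" using g h by simp
  note A = picS_bimoduleD(1,2)[OF picS_twisted_pdom]
  show ?thesis unfolding Phi0_def
    using class_mult[OF tensor_twisted_pdom[OF g h] A(2)[OF g] A(2)[OF h], where K = K]
      pdom_class_left[OF g A[OF gh], where K = K] by simp
qed

text \<open>Both sides are the part of \<open>A\<^sub>g\<close> on which \<open>1\<^sub>h\<close> acts as the identity from the right, since
  \<open>\<beta> g\<inverse> (1\<^bsub>g h\<^esub>) = 1\<^bsub>g\<inverse>\<^esub> 1\<^sub>h\<close>.\<close>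

lemma Phi0_pdom_class:
  assumes g: "g \<in> carrier G" and h: "h \<in> carrier G"
  shows "Phi0 G R e \<alpha> g \<otimes>\<^bsub>PicS R K\<^esub> pdom_class R e h
    = pdom_class R e (g \<otimes>\<^bsub>G\<^esub> h) \<otimes>\<^bsub>PicS R K\<^esub> Phi0 G R e \<alpha> g"
proof -
  let ?A = "twisted_pdom G R e \<alpha> g"
  have gh: "g \<otimes>\<^bsub>G\<^esub> h \<in> carrier G" using g h by simp
  note A = picS_bimoduleD(1,2)[OF picS_twisted_pdom[OF g]]
  have "inv\<^bsub>G\<^esub> g \<otimes>\<^bsub>G\<^esub> (g \<otimes>\<^bsub>G\<^esub> h) = h" using g h by (simp flip: G.m_assoc)
  then have \<beta>: "\<beta> (inv\<^bsub>G\<^esub> g) (e (g \<otimes>\<^bsub>G\<^esub> h)) = e (inv\<^bsub>G\<^esub> g) \<otimes> e h" using g h by (simp add: \<beta>_e)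
  have "e (g \<otimes>\<^bsub>G\<^esub> h) \<odot>\<^bsub>?A\<^esub> x = x \<triangleleft>\<^bsub>?A\<^esub> e h" if "x \<in> carrier ?A" for x
    using that g h R.m_lcomm[of "e (inv\<^bsub>G\<^esub> g)" "e h" x]
    by (simp add: \<beta> R.m_assoc R.m_comm[of x "e h"])
  then have "{x \<in> carrier ?A. e (g \<otimes>\<^bsub>G\<^esub> h) \<odot>\<^bsub>?A\<^esub> x = x} = {x \<in> carrier ?A. x \<triangleleft>\<^bsub>?A\<^esub> e h = x}"
    by auto
  then have "left_part R (e (g \<otimes>\<^bsub>G\<^esub> h)) ?A = right_part R (e h) ?A"
    by (simp only: left_part_def right_part_def)
  then show ?thesis unfolding Phi0_def
    using pdom_class_left[OF gh A, where K = K] pdom_class_right[OF h A, where K = K] by simp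
qed

lemma Phi0_one: "Phi0 G R e \<alpha> \<one>\<^bsub>G\<^esub> = \<one>\<^bsub>PicS R K\<^esub>"
proof -
  have "(\<lambda>x. x) \<in> bimodule_iso R (twisted_pdom G R e \<alpha> \<one>\<^bsub>G\<^esub>) (ideal_bimodule R (carrier R))"
    by (intro bimodule_isoI linear_mapsI)
      (auto simp: \<beta>_unit e_one bij_betw_def inj_on_def twisted_pdom_def
        unital_partial_action.pdom_unit[OF partial_action] unital_partial_action.act_unit[OF partial_action])
  then have "isomorphic_bimodules R (twisted_pdom G R e \<alpha> \<one>\<^bsub>G\<^esub>) (ideal_bimodule R (carrier R))"
    unfolding isomorphic_bimodules_def by blast
  then show ?thesis
    unfolding Phi0_def PicS_def
    by (simp add: bimodule_class_cong[OF twisted_pdom_bimodule[OF G.one_closed]])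
qed

lemma act_star_class:
  fixes E :: "('a, 'b, 'k) bimodule_scheme"
  assumes g: "g \<in> carrier G" and E: "bimodule R E" "fg_projective R E"
    and id: "\<And>x. x \<in> carrier E \<Longrightarrow> e (inv\<^bsub>G\<^esub> g) \<odot>\<^bsub>E\<^esub> x = x"
  shows "act_star G R e \<alpha> g (bimodule_class R E) = bimodule_class R (twist G R e \<alpha> g E)"
proof -
  have "bimodule_class R (twist G R e \<alpha> g B) = bimodule_class R (twist G R e \<alpha> g E)"
    if B: "B \<in> bimodule_class R E" for B
  proof -
    obtain h where h: "h \<in> bimodule_iso R E B" using B by (auto simp: bimodule_class_def)
    note h' = bimodule_isoD[OF h]
    have "h \<in> bimodule_iso R (twist G R e \<alpha> g E) (twist G R e \<alpha> g B)"
      using g h'(2) by (intro bimodule_isoI linear_mapsI) (simp_all add: linear_mapsD[OF h'(1)])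
    then show ?thesis
      using bimodule_class_cong[OF twist_bimodules(2)[OF g E(1) id]] unfolding isomorphic_bimodules_def
      by blast
  qed
  moreover obtain B :: "'a ubimodule" where "B \<in> bimodule_class R E"
    using ubimodule_copy[OF E] by (auto simp: bimodule_class_iff)
  ultimately show ?thesis unfolding act_star_def by blast
qed

text \<open>Moving a central bimodule past \<open>A\<^sub>g\<close> from right to left applies \<open>\<alpha>\<^sup>*\<^sub>g\<close> to it.\<close>

lemma Phi0_central:
  fixes E :: "('a, 'b, 'k) bimodule_scheme"
  assumes g: "g \<in> carrier G" and E: "picS_bimodule R (carrier R) E"
  defines "A \<equiv> act_star G R e \<alpha> g (bimodule_class R E \<otimes>\<^bsub>PicS R (carrier R)\<^esub> pdom_class R e (inv\<^bsub>G\<^esub> g))"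
  shows "Phi0 G R e \<alpha> g \<otimes>\<^bsub>PicS R K\<^esub> bimodule_class R E = A \<otimes>\<^bsub>PicS R K\<^esub> Phi0 G R e \<alpha> g"
    and "A \<in> carrier PicK"
proof -
  have ginv: "inv\<^bsub>G\<^esub> g \<in> carrier G" using g by simp
  note E' = picS_bimoduleD[OF E]
  let ?L = "left_part R (e (inv\<^bsub>G\<^esub> g)) E" and ?A = "twisted_pdom G R e \<alpha> g"
  have L: "picS_bimodule R (carrier R) ?L"
    using picS_left_part[OF E subset_refl] g by simp
  have id: "x \<in> carrier ?L \<Longrightarrow> e (inv\<^bsub>G\<^esub> g) \<odot>\<^bsub>?L\<^esub> x = x" for x by simp
  have "bimodule_class R E \<otimes>\<^bsub>PicS R (carrier R)\<^esub> pdom_class R e (inv\<^bsub>G\<^esub> g) = bimodule_class R ?L"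
    using pdom_class_commute[OF ginv E] pdom_class_left[OF ginv E'(1,2)] by simp
  then have A: "A = bimodule_class R (twist G R e \<alpha> g ?L)"
    unfolding A_def using act_star_class[OF g picS_bimoduleD(1,2)[OF L] id] by simp
  have tw: "picS_bimodule R (carrier R) (twist G R e \<alpha> g ?L)"
    by (rule picS_twist[OF g subset_refl L id])
  show "A \<in> carrier PicK" unfolding A
    by (rule class_in_PicS[OF invariants_subset picS_bimodule_mono[OF tw invariants_subset]])
  note A' = picS_bimoduleD(2)[OF picS_twisted_pdom[OF g]]
  note T = tensor_twisted_pdom_central[OF g E'(1,3)]
  show "Phi0 G R e \<alpha> g \<otimes>\<^bsub>PicS R K\<^esub> bimodule_class R E = A \<otimes>\<^bsub>PicS R K\<^esub> Phi0 G R e \<alpha> g"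
    unfolding A Phi0_def
    using class_mult[OF T(1) A' E'(2), where K = K]
      class_mult[OF T(2) picS_bimoduleD(2)[OF tw] A', where K = K] by simp
qed

lemma act_star_one:
  fixes E :: "('a, 'b, 'k) bimodule_scheme"
  assumes E: "picS_bimodule R (carrier R) E"
  shows "act_star G R e \<alpha> \<one>\<^bsub>G\<^esub> (bimodule_class R E) = bimodule_class R E"
proof -
  interpret E: bimodule R E using picS_bimoduleD(1)[OF E] .
  note E' = picS_bimoduleD[OF E]
  have id: "x \<in> carrier E \<Longrightarrow> e (inv\<^bsub>G\<^esub> \<one>\<^bsub>G\<^esub>) \<odot>\<^bsub>E\<^esub> x = x" for x by (simp add: e_one)
  have "(\<lambda>x. x) \<in> bimodule_iso R (twist G R e \<alpha> \<one>\<^bsub>G\<^esub> E) E"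
    using E'(3) by (intro bimodule_isoI linear_mapsI)
      (simp_all add: \<beta>_unit bij_betw_def inj_on_def central_over_def)
  then show ?thesis
    using act_star_class[OF G.one_closed E'(1,2) id]
      bimodule_class_cong[OF twist_bimodules(2)[OF G.one_closed E'(1) id]]
    unfolding isomorphic_bimodules_def by blast
qed

end

locale partial_action_cocycle = partial_action_ring G R e \<alpha>
  for G :: "('g, 'm) monoid_scheme" and R :: "('a, 'r) ring_scheme" (structure)
    and e :: "'g \<Rightarrow> 'a" and \<alpha> :: "'g \<Rightarrow> 'a \<Rightarrow> 'a" +
  fixes f :: "'g \<Rightarrow> 'a ubimodule set"
  assumes cocycle: "f \<in> cocycles G R e \<alpha>"
begin

sublocale M: monoid PicK by (rule R.monoid_PicS[OF invariants_subset])

abbreviation \<Phi> where "\<Phi> \<equiv> Phi G R e \<alpha> f"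
abbreviation \<Phi>\<^sub>0 where "\<Phi>\<^sub>0 \<equiv> Phi0 G R e \<alpha>"
abbreviation D where "D \<equiv> pdom_class R e"

lemma cocycle_value:
  assumes g: "g \<in> carrier G"
  obtains P :: "'a ubimodule" where "picS_bimodule R (carrier R) P" "f g = bimodule_class R P"
    "D g \<star> f g = f g"
proof -
  have "f g \<in> carrier (PicS_ideal R e g)" using cocycle g by (auto simp: cocycles_def Units_def)
  then obtain A where A: "A \<in> carrier (PicS R (carrier R))" "f g = D g \<otimes>\<^bsub>PicS R (carrier R)\<^esub> A"
    by (auto simp: PicS_ideal_def)
  obtain Q :: "'a ubimodule" where Q: "picS_bimodule R (carrier R) Q" "A = bimodule_class R Q"
    by (rule PicS_E[OF A(1)])
  have fg: "f g = bimodule_class R (left_part R (e g) Q)"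
    using A(2) pdom_class_left[OF g picS_bimoduleD(1,2)[OF Q(1)]] Q(2) by simp
  have P: "picS_bimodule R (carrier R) (left_part R (e g) Q)"
    using picS_left_part[OF Q(1) subset_refl] g by simp
  have "left_part R (e g) (left_part R (e g) Q) = left_part R (e g) Q"
    by (simp add: left_part_def)
  then have "D g \<star> f g = f g"
    unfolding fg using pdom_class_left[OF g picS_bimoduleD(1,2)[OF P]] by simp
  with P fg show thesis using that by blast
qed

lemma f_in:
  assumes "g \<in> carrier G"
  shows "f g \<in> carrier PicK"
proof -
  obtain P :: "'a ubimodule" where P: "picS_bimodule R (carrier R) P" "f g = bimodule_class R P"
    by (rule cocycle_value[OF assms])
  show ?thesis unfolding P(2)
    by (rule class_in_PicS[OF invariants_subset picS_bimodule_mono[OF P(1) invariants_subset]])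
qed

lemmas in_PicK = f_in Phi0_in pdom_class_in[OF _ invariants_subset]

lemma Phi_eq: "\<Phi> g = f g \<star> \<Phi>\<^sub>0 g"
  by (simp add: Phi_def)

lemma Phi_in: "g \<in> carrier G \<Longrightarrow> \<Phi> g \<in> carrier PicK"
  by (simp add: Phi_eq in_PicK)

lemma D_commute:
  assumes g: "g \<in> carrier G" and h: "h \<in> carrier G"
  shows "D g \<star> f h = f h \<star> D g"
proof -
  obtain P :: "'a ubimodule" where P: "picS_bimodule R (carrier R) P" "f h = bimodule_class R P"
    by (rule cocycle_value[OF h])
  show ?thesis unfolding P(2) by (rule pdom_class_commute[OF g P(1)])
qed

lemma D_Phi:
  assumes g: "g \<in> carrier G"
  shows "D g \<star> \<Phi> g = \<Phi> g"
proof -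
  have "D g \<star> f g = f g" by (rule cocycle_value[OF g])
  then show ?thesis unfolding Phi_eq using g by (simp add: in_PicK flip: M.m_assoc)
qed

lemma Phi_D:
  assumes g: "g \<in> carrier G" and h: "h \<in> carrier G"
  shows "\<Phi> g \<star> D h = D (g \<otimes>\<^bsub>G\<^esub> h) \<star> \<Phi> g"
proof -
  have gh: "g \<otimes>\<^bsub>G\<^esub> h \<in> carrier G" using g h by simp
  have "\<Phi> g \<star> D h = f g \<star> (\<Phi>\<^sub>0 g \<star> D h)"
    unfolding Phi_eq using g h by (simp add: M.m_assoc in_PicK)
  also have "\<dots> = f g \<star> D (g \<otimes>\<^bsub>G\<^esub> h) \<star> \<Phi>\<^sub>0 g"
    using g gh by (simp add: Phi0_pdom_class[OF g h] M.m_assoc in_PicK)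
  also have "\<dots> = D (g \<otimes>\<^bsub>G\<^esub> h) \<star> \<Phi> g"
    unfolding Phi_eq using g gh by (simp add: D_commute[symmetric] M.m_assoc in_PicK)
  finally show ?thesis .
qed

text \<open>Move \<open>f(h)\<close> to the left past \<open>\<Phi>\<^sub>0(g)\<close>, where it becomes the second factor of the cocycle identity;
  then \<open>f(g) A = f(g h) [D\<^sub>g]\<close> and \<open>\<Phi>\<^sub>0(g) \<Phi>\<^sub>0(h) = [D\<^sub>g] \<Phi>\<^sub>0(g h)\<close>.\<close>

lemma Phi_mult:
  assumes g: "g \<in> carrier G" and h: "h \<in> carrier G"
  shows "\<Phi> g \<star> \<Phi> h = D g \<star> \<Phi> (g \<otimes>\<^bsub>G\<^esub> h)"
proof -
  have gh: "g \<otimes>\<^bsub>G\<^esub> h \<in> carrier G" using g h by simp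
  obtain P :: "'a ubimodule" where P: "picS_bimodule R (carrier R) P" "f h = bimodule_class R P"
    by (rule cocycle_value[OF h])
  define A where "A = act_star G R e \<alpha> g (f h \<otimes>\<^bsub>PicS R (carrier R)\<^esub> D (inv\<^bsub>G\<^esub> g))"
  have A: "\<Phi>\<^sub>0 g \<star> f h = A \<star> \<Phi>\<^sub>0 g" "A \<in> carrier PicK"
    unfolding A_def P(2) by (rule Phi0_central[OF g P(1)])+
  have "f (g \<otimes>\<^bsub>G\<^esub> h) \<otimes>\<^bsub>PicS R (carrier R)\<^esub> D g = f g \<otimes>\<^bsub>PicS R (carrier R)\<^esub> A"
    unfolding A_def using cocycle g h by (simp add: cocycles_def)
  then have coc: "f (g \<otimes>\<^bsub>G\<^esub> h) \<star> D g = f g \<star> A"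
    by (simp only: mult_PicS)
  have "\<Phi> g \<star> \<Phi> h = f g \<star> (\<Phi>\<^sub>0 g \<star> f h) \<star> \<Phi>\<^sub>0 h"
    unfolding Phi_eq using g h by (simp add: M.m_assoc in_PicK)
  also have "\<dots> = (f g \<star> A) \<star> (\<Phi>\<^sub>0 g \<star> \<Phi>\<^sub>0 h)"
    unfolding A(1) using g h A(2) by (simp add: M.m_assoc in_PicK)
  also have "\<dots> = (D g \<star> f (g \<otimes>\<^bsub>G\<^esub> h)) \<star> (D g \<star> \<Phi>\<^sub>0 (g \<otimes>\<^bsub>G\<^esub> h))"
    by (simp add: coc[symmetric] D_commute[OF g gh] Phi0_mult[OF g h])
  also have "\<dots> = D g \<star> (f (g \<otimes>\<^bsub>G\<^esub> h) \<star> D g) \<star> \<Phi>\<^sub>0 (g \<otimes>\<^bsub>G\<^esub> h)"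
    using g gh by (simp add: M.m_assoc in_PicK)
  also have "\<dots> = (D g \<star> D g) \<star> \<Phi> (g \<otimes>\<^bsub>G\<^esub> h)"
    unfolding Phi_eq D_commute[OF g gh, symmetric] using g gh by (simp add: M.m_assoc in_PicK)
  finally show ?thesis using pdom_class_idem[OF g] by simp
qed

text \<open>The cocycle identity at \<open>(1, 1)\<close> makes \<open>f(1)\<close> idempotent, and \<open>f(1)\<close> is a unit of
  \<open>X\<^sub>1 = PicS(R)\<close>.\<close>

lemma Phi_one: "\<Phi> \<one>\<^bsub>G\<^esub> = \<one>\<^bsub>PicK\<^esub>"
proof -
  let ?u = "f \<one>\<^bsub>G\<^esub>"
  have D1: "D \<one>\<^bsub>G\<^esub> = \<one>\<^bsub>PicK\<^esub>" by (rule pdom_class_one)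
  have u: "?u \<in> carrier PicK" by (simp add: in_PicK)
  obtain P :: "'a ubimodule" where P: "picS_bimodule R (carrier R) P" "?u = bimodule_class R P"
    by (rule cocycle_value[OF G.one_closed])
  have "?u \<in> Units (PicS_ideal R e \<one>\<^bsub>G\<^esub>)" using cocycle by (auto simp: cocycles_def)
  then obtain v where v: "v \<in> carrier (PicS_ideal R e \<one>\<^bsub>G\<^esub>)"
    "?u \<otimes>\<^bsub>PicS_ideal R e \<one>\<^bsub>G\<^esub>\<^esub> v = \<one>\<^bsub>PicS_ideal R e \<one>\<^bsub>G\<^esub>\<^esub>" by (auto simp: Units_def)
  have uv: "?u \<star> v = \<one>\<^bsub>PicK\<^esub>"
    using v(2) by (simp add: PicS_ideal_def mult_PicS D1)
  obtain A where A: "A \<in> carrier (PicS R (carrier R))" "v = D \<one>\<^bsub>G\<^esub> \<otimes>\<^bsub>PicS R (carrier R)\<^esub> A"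
    using v(1) by (auto simp: PicS_ideal_def)
  obtain Q :: "'a ubimodule" where Q: "picS_bimodule R (carrier R) Q" "A = bimodule_class R Q"
    by (rule PicS_E[OF A(1)])
  have "A \<in> carrier PicK" unfolding Q(2)
    by (rule class_in_PicS[OF invariants_subset picS_bimodule_mono[OF Q(1) invariants_subset]])
  then have "D \<one>\<^bsub>G\<^esub> \<star> A \<in> carrier PicK" by (simp add: in_PicK)
  then have vK: "v \<in> carrier PicK" unfolding A(2) by (simp only: mult_PicS)
  have "?u \<otimes>\<^bsub>PicS R (carrier R)\<^esub> D \<one>\<^bsub>G\<^esub>
      = ?u \<otimes>\<^bsub>PicS R (carrier R)\<^esub> act_star G R e \<alpha> \<one>\<^bsub>G\<^esub> (?u \<otimes>\<^bsub>PicS R (carrier R)\<^esub> D \<one>\<^bsub>G\<^esub>)"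
  proof -
    have "\<forall>g\<in>carrier G. \<forall>h\<in>carrier G. f (g \<otimes>\<^bsub>G\<^esub> h) \<otimes>\<^bsub>PicS R (carrier R)\<^esub> D g
        = f g \<otimes>\<^bsub>PicS R (carrier R)\<^esub> act_star G R e \<alpha> g (f h \<otimes>\<^bsub>PicS R (carrier R)\<^esub> D (inv\<^bsub>G\<^esub> g))"
      using cocycle unfolding cocycles_def by blast
    from bspec[OF bspec[OF this G.one_closed] G.one_closed] show ?thesis by simp
  qed
  then have "?u \<star> D \<one>\<^bsub>G\<^esub> = ?u \<star> act_star G R e \<alpha> \<one>\<^bsub>G\<^esub> (?u \<star> D \<one>\<^bsub>G\<^esub>)"
    by (simp only: mult_PicS)
  then have "?u = ?u \<star> act_star G R e \<alpha> \<one>\<^bsub>G\<^esub> ?u" using u by (simp add: D1)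
  then have uu: "?u = ?u \<star> ?u" using act_star_one[OF P(1)] P(2) by simp
  have "?u \<star> v = ?u \<star> (?u \<star> v)" using uu u vK by (metis M.m_assoc)
  then have "?u = \<one>\<^bsub>PicK\<^esub>" using u uv by simp
  then show ?thesis by (simp add: Phi_eq Phi0_one[where K = inv_ring])
qed

lemma Phi_inv: "g \<in> carrier G \<Longrightarrow> \<Phi> g \<star> \<Phi> (inv\<^bsub>G\<^esub> g) = D g"
  by (simp add: Phi_mult Phi_one in_PicK)

lemma partial_representation_Phi: "partial_representation G PicK \<Phi>"
proof (intro partial_representation.intro partial_representation_axioms.intro
    G.is_group M.monoid_axioms)
  show "\<Phi> \<in> carrier G \<rightarrow> carrier PicK" using Phi_in by blast
  show "\<Phi> \<one>\<^bsub>G\<^esub> = \<one>\<^bsub>PicK\<^esub>" by (rule Phi_one)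
  fix g h assume g: "g \<in> carrier G" and h: "h \<in> carrier G"
  have gh: "g \<otimes>\<^bsub>G\<^esub> h \<in> carrier G" "inv\<^bsub>G\<^esub> g \<in> carrier G" "inv\<^bsub>G\<^esub> h \<in> carrier G" using g h by simp_all
  have "\<Phi> (inv\<^bsub>G\<^esub> g) \<star> D g = \<Phi> (inv\<^bsub>G\<^esub> g)"
    using Phi_D[OF gh(2) g] g gh by (simp add: pdom_class_one[where K = inv_ring] Phi_in)
  then show "\<Phi> (inv\<^bsub>G\<^esub> g) \<star> \<Phi> g \<star> \<Phi> h = \<Phi> (inv\<^bsub>G\<^esub> g) \<star> \<Phi> (g \<otimes>\<^bsub>G\<^esub> h)"
    using g h gh by (simp add: M.m_assoc Phi_in Phi_mult[OF g h] in_PicK flip: M.m_assoc[of _ "D g"])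
  have "\<Phi> g \<star> \<Phi> h \<star> \<Phi> (inv\<^bsub>G\<^esub> h) = \<Phi> g \<star> D h"
    using g h gh by (simp add: M.m_assoc Phi_in Phi_inv)
  also have "\<dots> = \<Phi> (g \<otimes>\<^bsub>G\<^esub> h) \<star> \<Phi> (inv\<^bsub>G\<^esub> h)"
    using g h gh by (simp add: Phi_D Phi_mult G.m_assoc)
  finally show "\<Phi> g \<star> \<Phi> h \<star> \<Phi> (inv\<^bsub>G\<^esub> h) = \<Phi> (g \<otimes>\<^bsub>G\<^esub> h) \<star> \<Phi> (inv\<^bsub>G\<^esub> h)" .
qed

end

section \<open>Endomorphisms of the representing bimodules\<close>

context partial_action_ring
begin

lemma pdom_cring:
  assumes g: "g \<in> carrier G"
  shows "cring (pdom_ring R e g)"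
proof (rule cringI)
  show "abelian_group (pdom_ring R e g)"
  proof (rule abelian_groupI)
    fix x assume "x \<in> carrier (pdom_ring R e g)"
    then show "\<exists>y\<in>carrier (pdom_ring R e g). y \<oplus>\<^bsub>pdom_ring R e g\<^esub> x = \<zero>\<^bsub>pdom_ring R e g\<^esub>"
      using g by (intro bexI[of _ "\<ominus> x"])
        (simp_all add: pdom_ring_def pdom_iff R.l_neg R.r_minus)
  qed (use g in \<open>simp_all add: pdom_ring_def pdom_iff R.r_distr R.a_ac\<close>)
  show "comm_monoid (pdom_ring R e g)"
  proof (rule comm_monoidI)
    fix x y assume "x \<in> carrier (pdom_ring R e g)" "y \<in> carrier (pdom_ring R e g)"
    then show "x \<otimes>\<^bsub>pdom_ring R e g\<^esub> y \<in> carrier (pdom_ring R e g)"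
      using g R.m_assoc[of "e g" x y] by (simp add: pdom_ring_def pdom_iff)
  qed (use g in \<open>simp_all add: pdom_ring_def pdom_iff R.m_ac\<close>)
qed (use g in \<open>simp_all add: pdom_ring_def pdom_iff R.l_distr\<close>)

lemma pdom_module:
  assumes g: "g \<in> carrier G" and J: "module R J" and id: "\<And>x. x \<in> carrier J \<Longrightarrow> e g \<odot>\<^bsub>J\<^esub> x = x"
  shows "module (pdom_ring R e g) J"
proof -
  interpret J: module R J by fact
  show ?thesis using g
    by (intro moduleI pdom_cring J.abelian_group_axioms)
      (simp_all add: pdom_ring_def pdom_iff J.smult_l_distr J.smult_r_distr J.smult_assoc1 id)
qed

text \<open>Since \<open>r x = (r 1\<^sub>g) x\<close>, endomorphisms that are linear over \<open>D\<^sub>g\<close> are linear over \<open>R\<close>, hence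
  homotheties.\<close>

lemma homothety_algebra_iso:
  assumes g: "g \<in> carrier G" and J: "module R J" and id: "\<And>x. x \<in> carrier J \<Longrightarrow> e g \<odot>\<^bsub>J\<^esub> x = x"
    and fg: "fg_projective R J" and rk: "rank_le_one R J"
    and faithful: "\<And>d. \<lbrakk>d \<in> pdom R e g; \<And>x. x \<in> carrier J \<Longrightarrow> d \<odot>\<^bsub>J\<^esub> x = \<zero>\<^bsub>J\<^esub>\<rbrakk> \<Longrightarrow> d = \<zero>"
  shows "(\<lambda>d. \<lambda>x\<in>carrier J. d \<odot>\<^bsub>J\<^esub> x)
    \<in> algebra_iso (carrier R) (pdom_algebra R e g) (End_algebra (pdom R e g) J)"
proof -
  interpret J: module R J by fact
  let ?\<theta> = "\<lambda>d. \<lambda>x\<in>carrier J. d \<odot>\<^bsub>J\<^esub> x" and ?E = "End_algebra (pdom R e g) J"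
  have D: "d \<in> pdom R e g \<Longrightarrow> d \<in> carrier R" for d using g by (simp add: pdom_iff)
  have in_E: "?\<theta> d \<in> carrier ?E" if "d \<in> pdom R e g" for d
    using D that
    by (auto simp: End_algebra_def linear_maps_def J.smult_r_distr R.m_comm simp flip: J.smult_assoc1)
  have "?\<theta> \<in> ring_hom (pdom_algebra R e g) ?E"
    using in_E D id
    by (intro ring_hom_memI)
      (auto simp: pdom_algebra_def End_algebra_def compose_def fun_eq_iff restrict_def
        J.smult_l_distr J.smult_assoc1)
  moreover have "?\<theta> (k \<otimes> d) = k \<odot>\<^bsub>?E\<^esub> ?\<theta> d" if "k \<in> carrier R" "d \<in> pdom R e g" for k d
    using that D by (auto simp: End_algebra_def fun_eq_iff restrict_def J.smult_assoc1)
  moreover have "bij_betw ?\<theta> (pdom R e g) (carrier ?E)"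
    unfolding bij_betw_def
  proof
    show "inj_on ?\<theta> (pdom R e g)"
    proof (rule inj_onI)
      fix c d assume c: "c \<in> pdom R e g" and d: "d \<in> pdom R e g" and eq: "?\<theta> c = ?\<theta> d"
      have "c \<ominus> d \<in> pdom R e g"
        using c d g by (simp add: pdom_iff R.minus_eq R.r_distr R.r_minus)
      moreover have "(c \<ominus> d) \<odot>\<^bsub>J\<^esub> x = \<zero>\<^bsub>J\<^esub>" if x: "x \<in> carrier J" for x
        using fun_cong[OF eq, of x] x D[OF c] D[OF d]
        by (simp add: R.minus_eq J.smult_l_distr J.smult_l_minus J.r_neg)
      ultimately have "c \<ominus> d = \<zero>" by (rule faithful)
      then show "c = d"
        using R.minus_equality[of c "\<ominus> d"] D[OF c] D[OF d] by (simp add: R.minus_eq)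
    qed
    show "?\<theta> ` pdom R e g = carrier ?E"
    proof
      show "?\<theta> ` pdom R e g \<subseteq> carrier ?E" using in_E by blast
      show "carrier ?E \<subseteq> ?\<theta> ` pdom R e g"
      proof
        fix h assume h: "h \<in> carrier ?E"
        then have hD: "h \<in> linear_maps (pdom R e g) J J" and ext: "h \<in> extensional (carrier J)"
          by (simp_all add: End_algebra_def)
        have restrict: "r \<odot>\<^bsub>J\<^esub> x = (r \<otimes> e g) \<odot>\<^bsub>J\<^esub> x" if "r \<in> carrier R" "x \<in> carrier J" for r x
          using that g by (simp add: J.smult_assoc1 id)
        have "h \<in> linear_maps (carrier R) J J"
        proof (intro linear_mapsI)
          fix r x assume r: "r \<in> carrier R" and x: "x \<in> carrier J"
          show "h (r \<odot>\<^bsub>J\<^esub> x) = r \<odot>\<^bsub>J\<^esub> h x"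
            unfolding restrict[OF r x] restrict[OF r linear_mapsD(1)[OF hD x]]
            using e_times_in_pdom[OF g r] x by (rule linear_mapsD(3)[OF hD])
        qed (use linear_mapsD[OF hD] in auto)
        then obtain r where r: "r \<in> carrier R" "\<And>x. x \<in> carrier J \<Longrightarrow> h x = r \<odot>\<^bsub>J\<^esub> x"
          using rank_le_one_endomorphism_scalar[OF J _ rk] fg fg_projective_iff_dual_basis[OF J] by metis
        have "h = ?\<theta> (r \<otimes> e g)"
          using ext r restrict by (auto simp: extensional_def fun_eq_iff)
        then show "h \<in> ?\<theta> ` pdom R e g" using e_times_in_pdom[OF g r(1)] by blast
      qed
    qed
  qed
  ultimately show ?thesis
    by (simp add: algebra_iso_def algebra_hom_def pdom_algebra_def)
qed

end

context partial_action_cocycle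
begin

lemma representative_picS:
  assumes g: "g \<in> carrier G" and J: "bimodule R J" "bimodule_class R J = \<Phi> g"
  shows "picS_bimodule R inv_ring J"
proof -
  obtain P :: "'a ubimodule" where P: "picS_bimodule R inv_ring P" "\<Phi> g = bimodule_class R P"
    by (rule PicS_E[OF Phi_in[OF g]])
  have "isomorphic_bimodules R P J"
    using class_eqD[OF picS_bimoduleD(1,2)[OF P(1)] J(1)] P(2) J(2) by simp
  then show ?thesis by (rule picS_bimodule_iso[OF invariants_subset P(1) J(1)])
qed

text \<open>The class of \<open>J\<close> absorbs \<open>[D\<^sub>g]\<close>, so \<open>J\<close> is isomorphic to \<open>1\<^sub>g J\<close>.\<close>

lemma representative_unital:
  assumes g: "g \<in> carrier G" and J: "bimodule R J" "bimodule_class R J = \<Phi> g"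
    and x: "x \<in> carrier J"
  shows "e g \<odot>\<^bsub>J\<^esub> x = x"
proof -
  interpret J: bimodule R J by fact
  note pic = picS_bimoduleD[OF representative_picS[OF g J]]
  have "bimodule_class R J = bimodule_class R (left_part R (e g) J)"
    using D_Phi[OF g] pdom_class_left[OF g pic(1,2), where K = inv_ring] unfolding J(2)[symmetric] by simp
  then have "isomorphic_bimodules R J (left_part R (e g) J)"
    by (rule class_eqD[OF pic(1,2) left_part_bimodule[OF J(1) e_closed[OF g]]])
  then obtain h where h: "h \<in> bimodule_iso R J (left_part R (e g) J)"
    by (auto simp: isomorphic_bimodules_def)
  note hD = linear_mapsD[OF bimodule_isoD(1)[OF h]]
  have "h (e g \<odot>\<^bsub>J\<^esub> x) = h x" using hD(1)[OF x] hD(3)[of "e g" x] g x by simp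
  moreover have "inj_on h (carrier J)" using bimodule_isoD(2)[OF h] by (simp add: bij_betw_def)
  ultimately show ?thesis using g x by (simp add: inj_on_eq_iff)
qed

text \<open>If \<open>Q\<close> represents \<open>\<Phi>(g\<inverse>)\<close>, then \<open>d\<close> kills \<open>J \<otimes> Q \<cong> D\<^sub>g\<close>, and in particular \<open>1\<^sub>g\<close>.\<close>

lemma representative_faithful:
  fixes J :: "('a, 'j, 'k) bimodule_scheme"
  assumes g: "g \<in> carrier G" and J: "bimodule R J" "bimodule_class R J = \<Phi> g"
    and d: "d \<in> pdom R e g" and zero: "\<And>x. x \<in> carrier J \<Longrightarrow> d \<odot>\<^bsub>J\<^esub> x = \<zero>\<^bsub>J\<^esub>"
  shows "d = \<zero>"
proof -
  have ginv: "inv\<^bsub>G\<^esub> g \<in> carrier G" using g by simp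
  have dR: "d \<in> carrier R" "e g \<otimes> d = d" using d g by (simp_all add: pdom_iff)
  note J' = picS_bimoduleD[OF representative_picS[OF g J]]
  obtain Q :: "'a ubimodule" where Q: "picS_bimodule R inv_ring Q" "\<Phi> (inv\<^bsub>G\<^esub> g) = bimodule_class R Q"
    by (rule PicS_E[OF Phi_in[OF ginv]])
  note Q' = picS_bimoduleD[OF Q(1)]
  let ?D = "ideal_bimodule R (pdom R e g)"
  note D' = picS_bimoduleD[OF pdom_bimodule[OF g empty_subsetI]]
  obtain b where b: "tensor_product R J Q (tensor R J Q) b"
    using tensor_product_tensor[OF J(1) Q'(1)] by blast
  interpret T: tensor_product R J Q "tensor R J Q" b by fact
  have "bimodule_class R ?D = bimodule_class R (tensor R J Q)"
    using class_mult[OF b J'(2) Q'(2), where K = inv_ring] Phi_inv[OF g] J(2) Q(2)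
    by (simp add: pdom_class_def)
  then have "isomorphic_bimodules R ?D (tensor R J Q)"
    using class_eqD[OF D'(1,2) T.T.bimodule_axioms] by simp
  then obtain h where h: "h \<in> bimodule_iso R ?D (tensor R J Q)" by (auto simp: isomorphic_bimodules_def)
  note hD = linear_mapsD[OF bimodule_isoD(1)[OF h]]
  have ann: "d \<odot>\<^bsub>tensor R J Q\<^esub> t = \<zero>\<^bsub>tensor R J Q\<^esub>" if "t \<in> carrier (tensor R J Q)" for t
    using that
  proof (induction rule: T.tensor_induct)
    case zero
    show ?case using dR by simp
  next
    case (add s t)
    then show ?case using dR by (simp add: T.T.smult_r_distr)
  next
    case (pure p q)
    then have "d \<odot>\<^bsub>tensor R J Q\<^esub> b p q = b \<zero>\<^bsub>J\<^esub> q"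
      using dR by (simp add: zero flip: T.pure_lact)
    then show ?case
      using additive_zero[OF T.pure_left_linear[OF pure(2)] T.P.abelian_group_axioms
          T.T.abelian_group_axioms] by simp
  qed
  have "e g \<in> carrier ?D" using g by (simp add: pdom_iff)
  then have "h (d \<otimes> e g) = \<zero>\<^bsub>tensor R J Q\<^esub>"
    using hD(3)[of d "e g"] hD(1)[of "e g"] ann dR by simp
  also have "\<dots> = h \<zero>"
    using additive_zero[OF bimodule_isoD(1)[OF h] bimodule_imp_abelian_group[OF D'(1)]
        T.T.abelian_group_axioms] by simp
  finally have "h d = h \<zero>" using dR g by (simp add: R.m_comm)
  moreover have "\<zero> \<in> pdom R e g" using g by (simp add: pdom_iff)
  moreover have "inj_on h (pdom R e g)" using bimodule_isoD(2)[OF h] by (simp add: bij_betw_def)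
  ultimately show ?thesis using d by (simp add: inj_on_eq_iff)
qed

lemma representative_endomorphisms:
  assumes g: "g \<in> carrier G" and J: "bimodule R J" "bimodule_class R J = \<Phi> g"
  shows "module (pdom_ring R e g) J"
    and "algebra_iso (carrier R) (pdom_algebra R e g) (End_algebra (pdom R e g) J) \<inter>
      algebra_iso (pdom R e g) (pdom_algebra R e g) (End_algebra (pdom R e g) J) \<noteq> {}"
proof -
  note pic = representative_picS[OF g J]
  note id = representative_unital[OF g J]
  note J' = bimodule_imp_module[OF J(1)]
  show "module (pdom_ring R e g) J" by (rule pdom_module[OF g J' id])
  have rk: "rank_le_one R J" using pic unfolding picS_bimodule_iff[OF R.is_cring invariants_subset] by blast
  have "(\<lambda>d. \<lambda>x\<in>carrier J. d \<odot>\<^bsub>J\<^esub> x)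
      \<in> algebra_iso (carrier R) (pdom_algebra R e g) (End_algebra (pdom R e g) J)"
    by (rule homothety_algebra_iso[OF g J' id picS_bimoduleD(2)[OF pic] rk representative_faithful[OF g J]])
  moreover have "algebra_iso (carrier R) (pdom_algebra R e g) (End_algebra (pdom R e g) J)
      \<subseteq> algebra_iso (pdom R e g) (pdom_algebra R e g) (End_algebra (pdom R e g) J)"
    using g by (auto simp: algebra_iso_def algebra_hom_def pdom_iff)
  ultimately show "algebra_iso (carrier R) (pdom_algebra R e g) (End_algebra (pdom R e g) J) \<inter>
      algebra_iso (pdom R e g) (pdom_algebra R e g) (End_algebra (pdom R e g) J) \<noteq> {}" by blast
qed

end

theorem lemma6p3:
  fixes G :: "('g, 'm) monoid_scheme" and R :: "('a, 'r) ring_scheme"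
    and e :: "'g \<Rightarrow> 'a" and \<alpha> :: "'g \<Rightarrow> 'a \<Rightarrow> 'a"
    and f :: "'g \<Rightarrow> 'a ubimodule set"
  assumes "finite (carrier G)"
    and "unital_partial_action G R e \<alpha>"
    and "partial_Galois G R e \<alpha>"
    and "f \<in> cocycles G R e \<alpha>"
  shows "partial_representation G (PicS R (invariants G R e \<alpha>)) (Phi G R e \<alpha> f) \<and>
    (\<forall>g\<in>carrier G.
       Phi G R e \<alpha> f g \<otimes>\<^bsub>PicS R (invariants G R e \<alpha>)\<^esub> Phi G R e \<alpha> f (inv\<^bsub>G\<^esub> g)
       = pdom_class R e g) \<and>
    (\<forall>g\<in>carrier G. \<forall>J :: ('a, 'j) bimodule.
       bimodule R J \<and> bimodule_class R J = Phi G R e \<alpha> f g \<longrightarrow>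
       module (pdom_ring R e g) J \<and>
       algebra_iso (carrier R) (pdom_algebra R e g) (End_algebra (pdom R e g) J) \<inter>
       algebra_iso (pdom R e g) (pdom_algebra R e g) (End_algebra (pdom R e g) J) \<noteq> {})"
proof -
  interpret A: unital_partial_action G R e \<alpha> by fact
  interpret partial_action_cocycle G R e \<alpha> f
    using assms(2,4) A.group_axioms A.cring_axioms
    by (intro partial_action_cocycle.intro partial_action_ring.intro partial_action_ring_axioms.intro
        partial_action_cocycle_axioms.intro)
  show ?thesis
    using partial_representation_Phi Phi_inv representative_endomorphisms by blast
qed

end
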